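(* Let $M\ge 1$ be an integer. (i) Let $x_1,\dots,x_M,a,b_1,\dots,b_{M+2},c_1,c_2$ be complex parameters and put $$d=\frac{a^2q^2}{c_1c_2b_1b_2\cdots b_{M+2}x_1x_2\cdots x_M}.$$ Suppose $|d|<1$. Then $$W^{M,2}(\{x_i\}_{1\le i\le M};a;\{b_j\}_{1\le j\le M+2};c_1,c_2;d)$$ $$=\prod_{i=1}^M \frac{(aqx_i)_\infty}{(aqx_i/c_1)_\infty}\prod_{j=1}^{M+2}\frac{(aq/(c_1b_j))_\infty}{(aq/b_j)_\infty}\cdot\frac{(c_1d,c_2)_\infty}{(d,c_2/c_1)_\infty}\;{}_{M+3}\varphi_{M+2}\left(\begin{array}{c} c_1,\{aq/(c_2b_j)\}_{1\le j\le M+2}\\ qc_1/c_2,\,c_1d,\,\{aqx_i/c_2\}_{1\le i\le M}\end{array};q\right)+\mathrm{idem}(c_1;c_2),$$ where $\mathrm{idem}(c_1;c_2)$ denotes the preceding expression repeated with $c_1$ and $c_2$ interchanged. (ii) Equivalently, for complex parameters $a_1,\dots,a_{M+3},b_1,\dots,b_{M+3}$ with $a_1\cdots a_{M+3}=q^2b_1\cdots b_{M+3}$ and $|a_{M+1}/b_{M+3}|<1$, $$\int_{q/a_{M+2}}^{q/a_{M+3}}\prod_{k=1}^{M+3}\frac{(a_kt)_\infty}{(b_kt)_\infty}d_qt$$ $$=\prod_{i=1}^M\frac{(qa_i/a_{M+2},qa_i/a_{M+3})_\infty}{(q^2a_ib_{M+3}/(a_{M+2}a_{M+3}))_\infty}\prod_{j=1}^{M+2}(q^2b_jb_{M+3}/(a_{M+2}a_{M+3}))_\infty\prod_{j=1}^{M+3}\frac{1}{(qb_j/a_{M+2},qb_j/a_{M+3})_\infty}$$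 $$\times (q,a_{M+1}/b_{M+3},a_{M+2}/a_{M+3},a_{M+3}/a_{M+2})_\infty\,\frac{(1-q)q}{a_{M+3}-a_{M+2}}$$ $$\times W^{M,2}\left(\{a_i\}_{1\le i\le M};\frac{qb_{M+3}}{a_{M+2}a_{M+3}};\left\{\frac1{b_j}\right\}_{1\le j\le M+2};\frac{qb_{M+3}}{a_{M+2}},\frac{qb_{M+3}}{a_{M+3}};\frac{a_{M+1}}{b_{M+3}}\right).$$
   Context: Fix $q\in\mathbb C$ with $0<|q|<1$. Notation: $(a)_\infty=\prod_{i\ge0}(1-aq^i)$, $(a)_l=(a)_\infty/(aq^l)_\infty$, $(a_1,\dots,a_r)_l=(a_1)_l\cdots(a_r)_l$ (also for $l=\infty$). It is always assumed that none of the denominators vanishes. Jackson integral: $\int_0^\tau f(t)d_qt=(1-q)\sum_{n=0}^\infty f(\tau q^n)\tau q^n$ and $\int_{\tau_1}^{\tau_2}=\int_0^{\tau_2}-\int_0^{\tau_1}$. Basic hypergeometric series: ${}_{r+1}\varphi_r\left(\begin{array}{c}a_1,\dots,a_{r+1}\\ b_1,\dots,b_r\end{array};z\right)=\sum_{l\ge0}\frac{(a_1,\dots,a_{r+1})_l}{(q,b_1,\dots,b_r)_l}z^l$. Kajihara's very well-poised series (case $N=2$), convergent for $|z|<1$: $$W^{M,2}(\{x_i\}_{1\le i\le M};a;\{u_j\}_{1\le j\le M+2};v_1,v_2;z)=\sum_{l\in\mathbb Z_{\ge0}^M}z^{|l|}\frac{\Delta(xq^l)}{\Delta(x)}\prod_{i=1}^M\left(\frac{1-ax_iq^{|l|+l_i}}{1-ax_i}\frac{(ax_i)_{|l|}\prod_{j=1}^{M+2}(x_iu_j)_{l_i}}{\prod_{j=1}^M(qx_i/x_j)_{l_i}\prod_{k=1}^2(aqx_i/v_k)_{l_i}}\right)\frac{(v_1,v_2)_{|l|}}{\prod_{j=1}^{M+2}(aq/u_j)_{|l|}},$$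 where $|l|=l_1+\cdots+l_M$, $xq^l=\{x_iq^{l_i}\}_{1\le i\le M}$ and $\Delta(x)=\prod_{1\le i<j\le M}(x_i-x_j)$. *)

theory Defs
  imports "HOL-Analysis.Analysis"
begin

definition qpoch_inf :: "complex \<Rightarrow> complex \<Rightarrow> complex" where
  "qpoch_inf q a = (\<Prod>i. 1 - a * q ^ i)"

text \<open>
  For a natural number \<open>l\<close>, the quotient of \<open>qpoch_inf q a\<close> by \<open>qpoch_inf q (a * q ^ l)\<close> is this
  finite product (lemma \<open>qpoch_eq_quotient\<close> below). The product form keeps the right value
  in the terminating case, where \<open>a = q powi (- n)\<close> makes that quotient \<open>0 / 0\<close>.
\<close>

definition qpoch :: "complex \<Rightarrow> complex \<Rightarrow> nat \<Rightarrow> complex" where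
  "qpoch q a l = (\<Prod>i<l. 1 - a * q ^ i)"

lemma convergent_prod_qpoch_inf:
  assumes "norm q < 1"
  shows "convergent_prod (\<lambda>i. 1 - a * q ^ i :: complex)"
proof -
  have "summable (\<lambda>i. norm a * norm q ^ i)"
    using assms by (intro summable_mult summable_geometric) auto
  then have "abs_convergent_prod (\<lambda>i. 1 - a * q ^ i)"
    unfolding abs_convergent_prod_conv_summable by (simp add: norm_mult norm_power)
  then show ?thesis
    by (rule abs_convergent_prod_imp_convergent_prod)
qed

lemma qpoch_mult_qpoch_inf:
  assumes "norm q < 1"
  shows "qpoch q a l * qpoch_inf q (a * q ^ l) = qpoch_inf q a"
proof -
  have L: "(\<lambda>n. \<Prod>i\<le>n. 1 - a * q ^ l * q ^ i) \<longlonglongrightarrow> qpoch_inf q (a * q ^ l)"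
    unfolding qpoch_inf_def
    using convergent_prod_LIMSEQ[OF convergent_prod_qpoch_inf[OF assms]] by blast
  have R: "(\<lambda>n. \<Prod>i\<le>n. 1 - a * q ^ i) \<longlonglongrightarrow> qpoch_inf q a"
    unfolding qpoch_inf_def
    using convergent_prod_LIMSEQ[OF convergent_prod_qpoch_inf[OF assms]] by blast
  have "(\<Prod>i\<le>n + l. 1 - a * q ^ i) = qpoch q a l * (\<Prod>i\<le>n. 1 - a * q ^ l * q ^ i)" for n
  proof (induction n)
    case 0
    have "{..l} = insert l {..<l}" by auto
    then show ?case by (simp add: qpoch_def)
  next
    case (Suc n)
    then show ?case by (simp add: power_add algebra_simps)
  qed
  moreover have "(\<lambda>n. \<Prod>i\<le>n + l. 1 - a * q ^ i) \<longlonglongrightarrow> qpoch_inf q a"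
    by (rule LIMSEQ_ignore_initial_segment[OF R])
  ultimately have "(\<lambda>n. qpoch q a l * (\<Prod>i\<le>n. 1 - a * q ^ l * q ^ i)) \<longlonglongrightarrow> qpoch_inf q a"
    by simp
  moreover have "(\<lambda>n. qpoch q a l * (\<Prod>i\<le>n. 1 - a * q ^ l * q ^ i))
      \<longlonglongrightarrow> qpoch q a l * qpoch_inf q (a * q ^ l)"
    by (intro tendsto_mult tendsto_const L)
  ultimately show ?thesis
    by (metis LIMSEQ_unique)
qed

lemma qpoch_eq_quotient:
  assumes "norm q < 1" "qpoch_inf q (a * q ^ l) \<noteq> 0"
  shows "qpoch q a l = qpoch_inf q a / qpoch_inf q (a * q ^ l)"
  using qpoch_mult_qpoch_inf[OF assms(1), of a l] assms(2) by (simp add: field_simps)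

definition jackson0 :: "complex \<Rightarrow> (complex \<Rightarrow> complex) \<Rightarrow> complex \<Rightarrow> complex" where
  "jackson0 q f \<tau> = (1 - q) * (\<Sum>n. f (\<tau> * q ^ n) * (\<tau> * q ^ n))"

definition jackson_integral ::
  "complex \<Rightarrow> complex \<Rightarrow> complex \<Rightarrow> (complex \<Rightarrow> complex) \<Rightarrow> complex" where
  "jackson_integral q \<tau>1 \<tau>2 f = jackson0 q f \<tau>2 - jackson0 q f \<tau>1"

text \<open>
  The series of type \<open>(r + 1, r)\<close>; it is only used with \<open>length as = length bs + 1\<close>.
\<close>

definition basic_hypergeom ::
  "complex \<Rightarrow> complex list \<Rightarrow> complex list \<Rightarrow> complex \<Rightarrow> complex" where
  "basic_hypergeom q as bs z =
     (\<Sum>l. (\<Prod>a\<leftarrow>as. qpoch q a l) / (\<Prod>b\<leftarrow>q # bs. qpoch q b l) * z ^ l)"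

text \<open>
  Families of parameters are functions on \<open>nat\<close> of which only the values at \<open>1, \<dots>, M\<close>
  (or \<open>M + 2\<close>, \<open>M + 3\<close>) matter; multi-indices are the elements of \<open>{1..M} \<rightarrow>\<^sub>E UNIV\<close>.
\<close>

definition vdm :: "nat \<Rightarrow> (nat \<Rightarrow> complex) \<Rightarrow> complex" where
  "vdm M x = (\<Prod>(i, j) \<in> {(i, j). 1 \<le> i \<and> i < j \<and> j \<le> M}. x i - x j)"

definition kajihara_term ::
  "complex \<Rightarrow> nat \<Rightarrow> (nat \<Rightarrow> complex) \<Rightarrow> complex \<Rightarrow> (nat \<Rightarrow> complex) \<Rightarrow> complex \<Rightarrow> complex
     \<Rightarrow> complex \<Rightarrow> (nat \<Rightarrow> nat) \<Rightarrow> complex" where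
  "kajihara_term q M x a u v1 v2 z l =
     (let s = (\<Sum>i=1..M. l i) in
        z ^ s
        * (vdm M (\<lambda>i. x i * q ^ l i) / vdm M x)
        * (\<Prod>i=1..M.
             (1 - a * x i * q ^ (s + l i)) / (1 - a * x i)
             * (qpoch q (a * x i) s * (\<Prod>j=1..M+2. qpoch q (x i * u j) (l i)))
             / ((\<Prod>j=1..M. qpoch q (q * x i / x j) (l i))
                * (qpoch q (a * q * x i / v1) (l i) * qpoch q (a * q * x i / v2) (l i))))
        * ((qpoch q v1 s * qpoch q v2 s) / (\<Prod>j=1..M+2. qpoch q (a * q / u j) s)))"

definition kajihara_W ::
  "complex \<Rightarrow> nat \<Rightarrow> (nat \<Rightarrow> complex) \<Rightarrow> complex \<Rightarrow> (nat \<Rightarrow> complex) \<Rightarrow> complex \<Rightarrow> complex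
     \<Rightarrow> complex \<Rightarrow> complex" where
  "kajihara_W q M x a u v1 v2 z =
     (\<Sum>\<^sub>\<infinity>l \<in> {1..M} \<rightarrow>\<^sub>E UNIV. kajihara_term q M x a u v1 v2 z l)"

text \<open>
  No denominator in the series vanishes, including those inside the arguments of \<open>qpoch\<close>.
\<close>

definition kajihara_W_defined ::
  "complex \<Rightarrow> nat \<Rightarrow> (nat \<Rightarrow> complex) \<Rightarrow> complex \<Rightarrow> (nat \<Rightarrow> complex) \<Rightarrow> complex \<Rightarrow> complex \<Rightarrow> bool"
where
  "kajihara_W_defined q M x a u v1 v2 \<longleftrightarrow>
     (\<forall>i\<in>{1..M}. x i \<noteq> 0) \<and> (\<forall>j\<in>{1..M+2}. u j \<noteq> 0) \<and> v1 \<noteq> 0 \<and> v2 \<noteq> 0 \<and>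
     vdm M x \<noteq> 0 \<and>
     (\<forall>i\<in>{1..M}. 1 - a * x i \<noteq> 0) \<and>
     (\<forall>i\<in>{1..M}. \<forall>j\<in>{1..M}. \<forall>n. qpoch q (q * x i / x j) n \<noteq> 0) \<and>
     (\<forall>i\<in>{1..M}. \<forall>n. qpoch q (a * q * x i / v1) n \<noteq> 0 \<and> qpoch q (a * q * x i / v2) n \<noteq> 0) \<and>
     (\<forall>j\<in>{1..M+2}. \<forall>n. qpoch q (a * q / u j) n \<noteq> 0)"

text \<open>
  The \<open>idem (c1; c2)\<close> partner of this expression is \<open>two_term_rhs q M x a b d c2 c1\<close>:
  the parameter \<open>d\<close> is symmetric in \<open>c1\<close> and \<open>c2\<close>.
\<close>

definition two_term_rhs ::
  "complex \<Rightarrow> nat \<Rightarrow> (nat \<Rightarrow> complex) \<Rightarrow> complex \<Rightarrow> (nat \<Rightarrow> complex) \<Rightarrow> complex \<Rightarrow> complex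
     \<Rightarrow> complex \<Rightarrow> complex" where
  "two_term_rhs q M x a b d c1 c2 =
     (\<Prod>i=1..M. qpoch_inf q (a * q * x i) / qpoch_inf q (a * q * x i / c1))
     * (\<Prod>j=1..M+2. qpoch_inf q (a * q / (c1 * b j)) / qpoch_inf q (a * q / b j))
     * ((qpoch_inf q (c1 * d) * qpoch_inf q c2) / (qpoch_inf q d * qpoch_inf q (c2 / c1)))
     * basic_hypergeom q
         (c1 # map (\<lambda>j. a * q / (c2 * b j)) [1..<M+3])
         (q * c1 / c2 # c1 * d # map (\<lambda>i. a * q * x i / c2) [1..<M+1])
         q"

end

theory Submission
  imports Defs "HOL-Complex_Analysis.Complex_Analysis"
begin

text \<open>
  Both parts are the same identity: after multiplication by the vanishing factors of all
  denominators it equates an entire function \<open>jnorm\<close> of the parameters \<open>b j\<close> (the Jackson integral)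
  with a multiple of a function \<open>kseries\<close> (Kajihara's series) that is holomorphic where \<open>|z| < 1\<close>.

  Both sides satisfy the same contiguous relation between the shifts \<open>b j \<mapsto> q b j\<close> for three of
  the indices \<open>j\<close>.  For the integral this is the linear dependence of \<open>1 - b j t\<close> for three values of
  \<open>j\<close>; for the series it is a multidimensional telescoping that rests on Lagrange interpolation.
  If \<open>b j = x m\<close>, both sides reduce to the case of dimension \<open>M - 1\<close>, so by induction on \<open>M\<close> and the
  contiguous relation they agree for \<open>b j = x m q\<^sup>N\<close>, for every \<open>N\<close>.  These points accumulate at
  \<open>0\<close>, and the identity theorem gives the general case.  For \<open>M = 0\<close> the identity is the
  nonterminating q-Saalschuetz sum, which a first order recursion in one of the \<open>b j\<close> reduces to the
  case where they all vanish.
\<close>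

text \<open>The argument of the series is
  \<open>z = c * c' * (\<Prod>j\<in>J. b j) / (\<Prod>i\<in>I. x i)\<close> with
  \<open>card J = card I + 2\<close>. Only the \<open>b j\<close> with \<open>j \<in> J\<close> are
  moved; the last parameter \<open>b j0\<close> enters the series through \<open>B\<close>, not
  through \<open>z\<close>, and stays fixed. Whichever \<open>j \<in> J\<close> is shifted,
  \<open>z\<close> and \<open>jalpha\<close> are multiplied by \<open>q\<close>, so the three
  shifted identities share all their prefactors. The obstacle is convergence: the step from
  \<open>x m * q ^ N\<close> to \<open>x m * q ^ (N + 1)\<close> applies the relation where
  \<open>|z|\<close> may exceed 1. Hence it is proved under \<open>|q * z| < 1\<close>, although it
  is built from the terms at \<open>z\<close>, whose series may diverge there; only the boundary
  terms of the telescoping have to tend to 0, and these are compared with the terms of a shifted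
  series. Interpolation needs distinct nodes. Coinciding parameters are reached by continuity, as
  they fill a countable subset of a suitable complex line. The end points are
  \<open>c = q / a (M+2)\<close>, \<open>c' = q / a (M+3)\<close> in part (ii) and
  \<open>c = a * q / c2\<close>, \<open>c' = a * q / c1\<close> in part (i). The latter degenerate
  for \<open>a = 0\<close>, which a special case of the q-Saalschuetz sum settles.\<close>

lemma sum_Lagrange_zero:
  fixes p :: "'a :: field poly"
  assumes "finite S" "degree p + 2 \<le> card S"
  shows "(\<Sum>t\<in>S. poly p t / (\<Prod>u\<in>S - {t}. t - u)) = 0"
proof -
  define w where "w = (\<lambda>t. \<Prod>u\<in>S - {t}. t - u)"
  define L where "L = (\<lambda>t. \<Prod>u\<in>S - {t}. [:- u, 1:])"
  \<comment> \<open>The interpolating polynomial of \<open>p\<close> minus \<open>p\<close>: it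
    vanishes at \<open>card S\<close> points and has smaller degree, so it is zero. The sum in
    question is the coefficient of the interpolant in degree \<open>card S - 1\<close>, where
    \<open>p\<close> has none.\<close>
  define r where "r = (\<Sum>t\<in>S. smult (poly p t / w t) (L t)) - p"
  have w0: "w t \<noteq> 0" if "t \<in> S" for t
    using that assms(1) by (auto simp: w_def)
  have degL: "degree (L t) = card S - 1" and leadL: "coeff (L t) (card S - 1) = 1" if "t \<in> S" for t
  proof -
    show d: "degree (L t) = card S - 1"
      using that assms(1) by (simp add: L_def degree_prod_eq_sum_degree)
    have "lead_coeff (L t) = 1"
      by (simp add: L_def lead_coeff_prod)
    then show "coeff (L t) (card S - 1) = 1" using d by simp
  qed
  have "poly r s = 0" if s: "s \<in> S" for s
  proof -
    have "poly (L t) s = (if t = s then w s else 0)" if "t \<in> S" for t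
      using that s assms(1) by (auto simp: L_def w_def poly_prod)
    then have "(\<Sum>t\<in>S. poly p t / w t * poly (L t) s) = (\<Sum>t\<in>S. if t = s then poly p s else 0)"
      using w0 by (intro sum.cong) auto
    then show ?thesis
      using s assms(1) by (simp add: r_def poly_sum)
  qed
  moreover have "degree r \<le> card S - 1"
    unfolding r_def using assms degL
    by (intro degree_diff_le degree_sum_le) (auto intro: order.trans[OF degree_smult_le])
  ultimately have "r = 0"
  proof -
    assume *: "\<And>s. s \<in> S \<Longrightarrow> poly r s = 0" "degree r \<le> card S - 1"
    show "r = 0"
    proof (rule ccontr)
      assume "r \<noteq> 0"
      then have "card S \<le> card {x. poly r x = 0}"
        using * poly_roots_finite[of r] by (intro card_mono) auto
      also have "\<dots> \<le> degree r" by (rule card_poly_roots_bound) fact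
      finally show False using * assms by simp
    qed
  qed
  then have "coeff r (card S - 1) = 0" by simp
  moreover have "coeff p (card S - 1) = 0"
    using assms by (intro coeff_eq_0) auto
  ultimately show ?thesis
    using leadL by (simp add: r_def coeff_sum w_def)
qed

text \<open>A countable set contains no ball, so its complement is dense in \<open>S\<close>. This
  is how degenerate parameters are reached from generic ones.\<close>

lemma continuous_zero_off_countable:
  fixes f :: "complex \<Rightarrow> complex"
  assumes "continuous_on S f" "open S" "countable N" "\<And>w. w \<in> S - N \<Longrightarrow> f w = 0" "w \<in> S"
  shows "f w = 0"
proof (rule ccontr)
  assume "f w \<noteq> 0"
  have "open (S \<inter> f -` (- {0}))"
    using assms by (intro continuous_open_preimage) auto
  moreover have "w \<in> S \<inter> f -` (- {0})" using \<open>f w \<noteq> 0\<close> assms by auto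
  ultimately obtain e where e: "e > 0" "ball w e \<subseteq> S \<inter> f -` (- {0})"
    by (meson open_contains_ball)
  then have "ball w e \<subseteq> N" using assms(4) by force
  then show False
    using uncountable_ball[OF \<open>e > 0\<close>, of w] assms(3) countable_subset by blast
qed

lemma has_sum_diff:
  fixes f g :: "'a \<Rightarrow> 'b :: {topological_semigroup_mult, ring_1, topological_ab_group_add}"
  assumes "(f has_sum a) A" "(g has_sum b) A"
  shows "((\<lambda>x. f x - g x) has_sum (a - b)) A"
  using has_sum_add[OF assms(1) has_sum_uminusI[OF assms(2)]] by simp

text \<open>Weierstrass M-test on small closed balls; the majorant is only asked for near each
  point, since the bounds below are only locally uniform.\<close>

lemma holomorphic_infsum:
  fixes f :: "'i \<Rightarrow> complex \<Rightarrow> complex"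
  assumes S: "open S"
    and hol: "\<And>k. k \<in> A \<Longrightarrow> f k holomorphic_on S"
    and bd: "\<And>x. x \<in> S \<Longrightarrow> \<exists>d M. 0 < d \<and> M summable_on A \<and>
               (\<forall>k\<in>A. \<forall>w\<in>S \<inter> ball x d. norm (f k w) \<le> M k)"
  shows "(\<lambda>w. \<Sum>\<^sub>\<infinity>k\<in>A. f k w) holomorphic_on S"
proof -
  have "(\<lambda>w. \<Sum>\<^sub>\<infinity>k\<in>A. f k w) field_differentiable (at x)" if x: "x \<in> S" for x
  proof -
    obtain d M where d: "0 < d" "M summable_on A"
      "\<And>k w. k \<in> A \<Longrightarrow> w \<in> S \<inter> ball x d \<Longrightarrow> norm (f k w) \<le> M k"
      using bd[OF x] by blast
    obtain e where e: "e > 0" "cball x e \<subseteq> S \<inter> ball x d"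
      using S x d(1) by (metis IntI centre_in_ball open_Int open_ball open_contains_cball)
    have ul: "uniform_limit (cball x e) (\<lambda>X y. \<Sum>k\<in>X. f k y) (\<lambda>y. \<Sum>\<^sub>\<infinity>k\<in>A. f k y)
        (finite_subsets_at_top A)"
      by (rule Weierstrass_m_test_general[OF _ d(2)]) (use d(3) e in blast)
    have "eventually (\<lambda>X. continuous_on (cball x e) (\<lambda>y. \<Sum>k\<in>X. f k y) \<and>
        (\<lambda>y. \<Sum>k\<in>X. f k y) holomorphic_on ball x e) (finite_subsets_at_top A)"
    proof (rule eventually_finite_subsets_at_top_weakI)
      fix X assume X: "finite X" "X \<subseteq> A"
      then have h: "(\<lambda>y. \<Sum>k\<in>X. f k y) holomorphic_on S"
        using hol by (intro holomorphic_intros) auto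
      show "continuous_on (cball x e) (\<lambda>y. \<Sum>k\<in>X. f k y) \<and> (\<lambda>y. \<Sum>k\<in>X. f k y) holomorphic_on ball x e"
        using h e holomorphic_on_imp_continuous_on continuous_on_subset holomorphic_on_subset
          ball_subset_cball by (metis (no_types, lifting) Int_subset_iff subset_trans)
    qed
    then have "(\<lambda>y. \<Sum>\<^sub>\<infinity>k\<in>A. f k y) holomorphic_on ball x e"
      using holomorphic_uniform_limit[OF _ ul] by auto
    then show ?thesis
      using e(1) by (auto simp: holomorphic_on_def at_within_open[OF _ open_ball])
  qed
  then show ?thesis
    by (auto simp: holomorphic_on_def intro: field_differentiable_at_within)
qed

subsection \<open>q-Pochhammer symbols\<close>

locale q_disc =
  fixes q :: complex
  assumes q_nz: "q \<noteq> 0" and q_lt: "norm q < 1"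
begin

abbreviation P :: "complex \<Rightarrow> complex" where "P \<equiv> qpoch_inf q"
abbreviation R :: "complex \<Rightarrow> nat \<Rightarrow> complex" where "R \<equiv> qpoch q"

lemma qpoch_0 [simp]: "R a 0 = 1"
  by (simp add: qpoch_def)

lemma qpoch_Suc: "R a (Suc n) = R a n * (1 - a * q ^ n)"
  by (simp add: qpoch_def)

lemma qpoch_Suc_left: "R a (Suc n) = (1 - a) * R (a * q) n"
  by (simp add: qpoch_def prod.lessThan_Suc_shift mult.assoc del: prod.lessThan_Suc)

lemma qpoch_inf_shift: "P a = R a n * P (a * q ^ n)"
  using qpoch_mult_qpoch_inf[OF q_lt] by simp

lemma qpoch_inf_step: "P a = (1 - a) * P (a * q)"
  using qpoch_inf_shift[of a 1] by (simp add: qpoch_def)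

lemma qpoch_inf_0 [simp]: "P 0 = 1"
  by (simp add: qpoch_inf_def)

lemma qpoch_inf_1 [simp]: "P 1 = 0"
  using qpoch_inf_step[of 1] by simp

lemma qpoch_LIMSEQ: "(\<lambda>n. R a n) \<longlonglongrightarrow> P a"
proof -
  have "(\<lambda>n. \<Prod>i\<le>n. 1 - a * q ^ i) \<longlonglongrightarrow> P a"
    unfolding qpoch_inf_def
    using convergent_prod_LIMSEQ[OF convergent_prod_qpoch_inf[OF q_lt]] .
  then show ?thesis
    unfolding qpoch_def using LIMSEQ_lessThan_iff_atMost by blast
qed

lemma qpoch_inf_nonzero:
  assumes "\<And>n. R a n \<noteq> 0"
  shows "P a \<noteq> 0"
  unfolding qpoch_inf_def
proof (rule prodinf_nonzero[OF convergent_prod_qpoch_inf[OF q_lt]])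
  fix i show "1 - a * q ^ i \<noteq> 0"
    using assms[of "Suc i"] by (auto simp: qpoch_Suc)
qed

lemma qpoch_nonzero: "P a \<noteq> 0 \<Longrightarrow> R a n \<noteq> 0"
  using qpoch_inf_shift[of a n] by auto

lemma qpoch_inf_nonzero_iff: "P a \<noteq> 0 \<longleftrightarrow> (\<forall>n. a * q ^ n \<noteq> 1)"
  unfolding qpoch_inf_def
proof
  assume *: "(\<Prod>i. 1 - a * q ^ i) \<noteq> 0"
  show "\<forall>n. a * q ^ n \<noteq> 1"
  proof
    fix n
    have "R a (Suc n) \<noteq> 0" using * qpoch_nonzero unfolding qpoch_inf_def by blast
    then show "a * q ^ n \<noteq> 1" by (auto simp: qpoch_Suc)
  qed
next
  assume "\<forall>n. a * q ^ n \<noteq> 1"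
  then show "(\<Prod>i. 1 - a * q ^ i) \<noteq> 0"
    by (intro prodinf_nonzero[OF convergent_prod_qpoch_inf[OF q_lt]]) auto
qed

lemma norm_power_q_le_1: "norm (q ^ n) \<le> 1"
  using q_lt by (simp add: norm_power power_le_one)

lemma qpoch_inf_nonzero_lt_1: "norm a < 1 \<Longrightarrow> P a \<noteq> 0"
proof -
  assume a: "norm a < 1"
  have "norm (a * q ^ n) < 1" for n
    using a norm_power_q_le_1[of n] by (metis mult_le_one mult_less_le_imp_less norm_ge_zero
      norm_mult order_le_less_trans mult.right_neutral mult_left_mono)
  then show ?thesis
    unfolding qpoch_inf_nonzero_iff by (metis norm_one less_irrefl)
qed

lemma prod_le_exp_geometric:
  assumes "t \<ge> 0"
  shows "(\<Prod>i<n. 1 + t * norm q ^ i) \<le> exp (t / (1 - norm q))"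
proof -
  have "(\<Prod>i<n. 1 + t * norm q ^ i) \<le> (\<Prod>i<n. exp (t * norm q ^ i))"
    using assms by (intro prod_mono) (auto intro!: add_nonneg_nonneg)
  also have "\<dots> = exp (\<Sum>i<n. t * norm q ^ i)" by (simp add: exp_sum)
  also have "(\<Sum>i<n. t * norm q ^ i) \<le> t * (1 / (1 - norm q))"
  proof -
    have "(\<Sum>i<n. norm q ^ i) \<le> (\<Sum>i. norm q ^ i)"
      using q_lt by (intro sum_le_suminf summable_geometric) auto
    also have "\<dots> = 1 / (1 - norm q)" using q_lt by (intro suminf_geometric) auto
    finally show ?thesis using assms unfolding sum_distrib_left[symmetric] by (rule mult_left_mono)
  qed
  finally show ?thesis by simp
qed

lemma norm_qpoch_le:
  assumes "norm a \<le> r"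
  shows "norm (R a n) \<le> exp (r / (1 - norm q))"
proof -
  have "norm (R a n) = (\<Prod>i<n. norm (1 - a * q ^ i))"
    by (simp add: qpoch_def prod_norm)
  also have "\<dots> \<le> (\<Prod>i<n. 1 + r * norm q ^ i)"
  proof (intro prod_mono conjI norm_ge_zero)
    fix i
    have "norm (1 - a * q ^ i) \<le> norm (1::complex) + norm (a * q ^ i)" by (rule norm_triangle_ineq4)
    also have "\<dots> \<le> 1 + r * norm q ^ i"
      using assms by (simp add: norm_mult norm_power mult_right_mono)
    finally show "norm (1 - a * q ^ i) \<le> 1 + r * norm q ^ i" .
  qed
  also have "\<dots> \<le> exp (r / (1 - norm q))"
    using assms norm_ge_zero[of a] by (intro prod_le_exp_geometric) linarith
  finally show ?thesis .
qed

lemma norm_qpoch_inf_le: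
  assumes "norm a \<le> r"
  shows "norm (P a) \<le> exp (r / (1 - norm q))"
  by (rule Lim_norm_ubound[OF _ qpoch_LIMSEQ]) (use norm_qpoch_le[OF assms] in auto)

lemma norm_qpoch_inf_power_le:
  assumes "norm a \<le> r"
  shows "norm (P (a * q ^ n)) \<le> exp (r / (1 - norm q))"
proof (rule norm_qpoch_inf_le)
  have "norm (a * q ^ n) \<le> norm a * 1"
    unfolding norm_mult by (intro mult_left_mono norm_power_q_le_1) auto
  then show "norm (a * q ^ n) \<le> r" using assms by simp
qed

text \<open>The inverse of \<open>R a n\<close> is \<open>P (a * q ^ n) / P a\<close>, so an upper
  bound for infinite products replaces a lower bound for finite ones.\<close>

lemma bounded_inverse_qpoch:
  assumes "P a \<noteq> 0"
  obtains C where "C > 0" "\<And>n. norm (inverse (R a n)) \<le> C"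
proof
  show "exp (norm a / (1 - norm q)) / norm (P a) > 0" using assms by simp
  fix n
  have "inverse (R a n) = P (a * q ^ n) / P a"
    using qpoch_inf_shift[of a n] assms by (auto simp: field_simps)
  then show "norm (inverse (R a n)) \<le> exp (norm a / (1 - norm q)) / norm (P a)"
    using norm_qpoch_inf_power_le[of a "norm a" n] by (simp add: norm_divide divide_right_mono)
qed

lemma holomorphic_qpoch_inf_UNIV: "P holomorphic_on UNIV"
proof (rule holomorphic_uniform_sequence[where f = "\<lambda>n a. R a n"])
  show "(\<lambda>a. R a n) holomorphic_on UNIV" for n
    unfolding qpoch_def by (intro holomorphic_intros)
  fix x :: complex
  have "uniformly_convergent_on (cball x 1) (\<lambda>N a. \<Prod>n<N. 1 - a * q ^ n)"
  proof (rule uniformly_convergent_on_prod')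
    show "uniformly_convergent_on (cball x 1) (\<lambda>N a. \<Sum>n<N. norm (1 - a * q ^ n - 1))"
    proof (rule Weierstrass_m_test')
      show "summable (\<lambda>n. (norm x + 1) * norm q ^ n)"
        using q_lt by (intro summable_mult summable_geometric) auto
      fix n a assume "a \<in> cball x 1"
      then have "norm a \<le> norm x + 1"
        by (smt (verit) dist_norm mem_cball norm_minus_commute norm_triangle_sub)
      then show "norm (norm (1 - a * q ^ n - 1)) \<le> (norm x + 1) * norm q ^ n"
        by (simp add: norm_mult norm_power mult_right_mono)
    qed
  qed (auto intro!: continuous_intros)
  then obtain g where g: "uniform_limit (cball x 1) (\<lambda>N a. R a N) g sequentially"
    unfolding uniformly_convergent_on_def qpoch_def by blast
  have "g a = P a" if "a \<in> cball x 1" for a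
    using tendsto_uniform_limitI[OF g that] qpoch_LIMSEQ LIMSEQ_unique by blast
  then have "uniform_limit (cball x 1) (\<lambda>N a. R a N) P sequentially \<longleftrightarrow>
        uniform_limit (cball x 1) (\<lambda>N a. R a N) g sequentially"
    by (intro uniform_limit_cong) auto
  with g show "\<exists>d. 0 < d \<and> cball x d \<subseteq> UNIV \<and> uniform_limit (cball x d) (\<lambda>n a. R a n) P sequentially"
    by (intro exI[of _ 1]) auto
qed auto

lemma holomorphic_qpoch_inf [holomorphic_intros]:
  "f holomorphic_on S \<Longrightarrow> (\<lambda>w. P (f w)) holomorphic_on S"
  using holomorphic_on_compose_gen[OF _ holomorphic_qpoch_inf_UNIV, of f S] by (auto simp: o_def)

lemma holomorphic_qpoch [holomorphic_intros]:
  "f holomorphic_on S \<Longrightarrow> (\<lambda>w. R (f w) n) holomorphic_on S"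
  unfolding qpoch_def by (intro holomorphic_intros)

lemma qpoch_inf_tendsto_1:
  assumes "f \<longlonglongrightarrow> 0"
  shows "(\<lambda>n. P (f n)) \<longlonglongrightarrow> 1"
proof -
  have "isCont P 0"
    using holomorphic_on_imp_continuous_on[OF holomorphic_qpoch_inf_UNIV]
    by (simp add: continuous_on_eq_continuous_at)
  then have "(\<lambda>n. P (f n)) \<longlonglongrightarrow> P 0" using assms by (rule isCont_tendsto_compose)
  then show ?thesis by simp
qed

lemma power_q_LIMSEQ: "(\<lambda>n. a * q ^ n) \<longlonglongrightarrow> 0"
  using LIMSEQ_power_zero[OF q_lt] tendsto_mult_right_zero by blast

end

subsection \<open>The Jackson integral\<close>

lemma local_bound_continuous:
  fixes f :: "'i \<Rightarrow> complex \<Rightarrow> complex"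
  assumes "finite J" "\<And>j. j \<in> J \<Longrightarrow> continuous_on S (f j)" "x \<in> S" "\<epsilon> > 0"
  shows "\<exists>d>0. \<forall>w\<in>S \<inter> ball x d. \<forall>j\<in>J. norm (f j w) \<le> norm (f j x) + \<epsilon>"
proof -
  have "eventually (\<lambda>w. norm (f j w) \<le> norm (f j x) + \<epsilon>) (at x within S)" if "j \<in> J" for j
  proof -
    have "((\<lambda>w. norm (f j w)) \<longlongrightarrow> norm (f j x)) (at x within S)"
      using assms(2)[OF that] assms(3) by (intro tendsto_norm) (auto simp: continuous_on_def)
    then have "eventually (\<lambda>w. norm (f j w) < norm (f j x) + \<epsilon>) (at x within S)"
      using assms(4) by (intro order_tendstoD(2)) auto
    then show ?thesis by (rule eventually_mono) auto
  qed
  then have "eventually (\<lambda>w. \<forall>j\<in>J. norm (f j w) \<le> norm (f j x) + \<epsilon>) (at x within S)"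
    using assms(1) by (intro eventually_ball_finite) auto
  then obtain d where "d > 0" "\<And>w. w \<in> S \<Longrightarrow> w \<noteq> x \<Longrightarrow> dist w x < d \<Longrightarrow> \<forall>j\<in>J. norm (f j w) \<le> norm (f j x) + \<epsilon>"
    unfolding eventually_at by blast
  then show ?thesis
    using assms(4) by (intro exI[of _ d]) (auto simp: dist_commute, metis add_increasing2 dist_commute less_eq_real_def order_refl)
qed

context q_disc
begin

text \<open>The integrand at \<open>t = c * q ^ n\<close> times \<open>q ^ n\<close> and times all
  \<open>P (b j * c)\<close>, which turns the denominators into finite products.
  \<open>\<alpha>\<close> is a separate argument because a shift of \<open>b j\<close> is studied
  first with \<open>\<alpha>\<close> fixed, and only then with the balanced value.\<close>

definition jterm ::
  "'i set \<Rightarrow> ('i \<Rightarrow> complex) \<Rightarrow> 'j set \<Rightarrow> ('j \<Rightarrow> complex) \<Rightarrow> complex \<Rightarrow> complex \<Rightarrow> complex \<Rightarrow> nat \<Rightarrow> complex"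
  where
  "jterm I x J b \<alpha> c c' n =
     q ^ n * P (q * q ^ n) * P (q * c / c' * q ^ n) * (\<Prod>i\<in>I. P (x i * c * q ^ n)) * P (\<alpha> * c * q ^ n)
     * (\<Prod>j\<in>J. R (b j * c) n)"

definition jhalf ::
  "'i set \<Rightarrow> ('i \<Rightarrow> complex) \<Rightarrow> 'j set \<Rightarrow> ('j \<Rightarrow> complex) \<Rightarrow> complex \<Rightarrow> complex \<Rightarrow> complex \<Rightarrow> complex"
  where "jhalf I x J b \<alpha> c c' = (\<Sum>\<^sub>\<infinity>n. jterm I x J b \<alpha> c c' n)"

definition jalpha ::
  "'i set \<Rightarrow> ('i \<Rightarrow> complex) \<Rightarrow> 'j set \<Rightarrow> ('j \<Rightarrow> complex) \<Rightarrow> complex \<Rightarrow> complex \<Rightarrow> complex"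
  where "jalpha I x J b c c' = c * c' * (\<Prod>j\<in>J. b j) / (\<Prod>i\<in>I. x i)"

text \<open>
  \<open>(1 - q) * jnorm I x J b c c'\<close> is the Jackson integral from \<open>c\<close> to \<open>c'\<close> of the balanced integrand
  with numerator parameters \<open>q / c\<close>, \<open>q / c'\<close>, \<open>x i\<close>, \<open>jalpha\<close> and denominator parameters \<open>b j\<close>,
  multiplied by all \<open>P (b j * c) * P (b j * c')\<close>; this makes it entire in the \<open>b j\<close>.
\<close>

definition jnorm ::
  "'i set \<Rightarrow> ('i \<Rightarrow> complex) \<Rightarrow> 'j set \<Rightarrow> ('j \<Rightarrow> complex) \<Rightarrow> complex \<Rightarrow> complex \<Rightarrow> complex"
  where
  "jnorm I x J b c c' =
     c' * (\<Prod>j\<in>J. P (b j * c)) * jhalf I x J b (jalpha I x J b c c') c' c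
     - c * (\<Prod>j\<in>J. P (b j * c')) * jhalf I x J b (jalpha I x J b c c') c c'"

lemma norm_jterm_le:
  assumes "finite I" "finite J" "norm \<alpha> \<le> A" "\<And>j. j \<in> J \<Longrightarrow> norm (b j) \<le> r j"
  shows "norm (jterm I x J b \<alpha> c c' n) \<le>
    (exp (norm q / (1 - norm q)) * exp (norm (q * c / c') / (1 - norm q))
      * (\<Prod>i\<in>I. exp (norm (x i * c) / (1 - norm q))) * exp (A * norm c / (1 - norm q))
      * (\<Prod>j\<in>J. exp (r j * norm c / (1 - norm q)))) * norm q ^ n"
proof -
  have "norm (jterm I x J b \<alpha> c c' n) = norm q ^ n *
    (norm (P (q * q ^ n)) * norm (P (q * c / c' * q ^ n)) * (\<Prod>i\<in>I. norm (P (x i * c * q ^ n)))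
     * norm (P (\<alpha> * c * q ^ n)) * (\<Prod>j\<in>J. norm (R (b j * c) n)))"
    by (simp add: jterm_def norm_mult norm_power prod_norm mult_ac)
  also have "\<dots> \<le> norm q ^ n * (exp (norm q / (1 - norm q)) * exp (norm (q * c / c') / (1 - norm q))
      * (\<Prod>i\<in>I. exp (norm (x i * c) / (1 - norm q))) * exp (A * norm c / (1 - norm q))
      * (\<Prod>j\<in>J. exp (r j * norm c / (1 - norm q))))"
    using assms
    by (intro mult_left_mono mult_mono norm_qpoch_inf_power_le norm_qpoch_le prod_mono conjI
          mult_nonneg_nonneg prod_nonneg)
       (auto simp: norm_mult norm_divide intro!: mult_right_mono)
  finally show ?thesis by (simp add: mult.commute)
qed

lemma summable_on_geometric_bound:
  fixes f :: "nat \<Rightarrow> complex"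
  assumes "\<And>n. norm (f n) \<le> C * norm q ^ n"
  shows "f summable_on UNIV"
proof (rule norm_summable_imp_summable_on, rule summable_comparison_test')
  show "summable (\<lambda>n. C * norm q ^ n)"
    using q_lt by (intro summable_mult summable_geometric) auto
qed (use assms in auto)

lemma jterm_bounded:
  assumes "finite I" "finite J"
  obtains C where "C \<ge> 0" "\<And>n. norm (jterm I x J b \<alpha> c c' n) \<le> C * norm q ^ n"
  by (rule that[OF _ norm_jterm_le[OF assms order_refl order_refl]])
     (auto intro!: mult_nonneg_nonneg prod_nonneg)

lemma jterm_summable:
  assumes "finite I" "finite J"
  shows "jterm I x J b \<alpha> c c' summable_on UNIV"
  using jterm_bounded[OF assms] summable_on_geometric_bound by metis

lemma jterm_power_summable:
  assumes "finite I" "finite J"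
  shows "(\<lambda>n. jterm I x J b \<alpha> c c' n * (c * q ^ n)) summable_on UNIV"
proof -
  obtain C where C: "C \<ge> 0" "\<And>n. norm (jterm I x J b \<alpha> c c' n) \<le> C * norm q ^ n"
    using jterm_bounded[OF assms] by metis
  show ?thesis
  proof (rule summable_on_geometric_bound)
    fix n
    have "norm (jterm I x J b \<alpha> c c' n * (c * q ^ n)) \<le> (C * norm q ^ n) * (norm c * 1)"
      unfolding norm_mult using C
      by (intro mult_mono norm_power_q_le_1 mult_nonneg_nonneg) auto
    then show "norm (jterm I x J b \<alpha> c c' n * (c * q ^ n)) \<le> (C * norm c) * norm q ^ n"
      by (simp add: mult_ac)
  qed
qed

lemma holomorphic_jhalf:
  assumes "finite I" "finite J" "open S"
    and \<beta>: "\<And>j. j \<in> J \<Longrightarrow> (\<lambda>w. \<beta> w j) holomorphic_on S" and \<alpha>: "\<alpha> holomorphic_on S"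
  shows "(\<lambda>w. jhalf I x J (\<beta> w) (\<alpha> w) c c') holomorphic_on S"
  unfolding jhalf_def
proof (rule holomorphic_infsum[OF \<open>open S\<close>])
  fix n show "(\<lambda>w. jterm I x J (\<beta> w) (\<alpha> w) c c' n) holomorphic_on S"
    unfolding jterm_def using \<beta> \<alpha> by (intro holomorphic_intros) auto
next
  fix z assume z: "z \<in> S"
  obtain d1 where d1: "d1 > 0" "\<And>w j. w \<in> S \<inter> ball z d1 \<Longrightarrow> j \<in> J \<Longrightarrow> norm (\<beta> w j) \<le> norm (\<beta> z j) + 1"
    using local_bound_continuous[of J S "\<lambda>j w. \<beta> w j" z 1] \<beta> z \<open>finite J\<close>
      holomorphic_on_imp_continuous_on by (metis zero_less_one)
  obtain d2 where d2: "d2 > 0" "\<And>w. w \<in> S \<inter> ball z d2 \<Longrightarrow> norm (\<alpha> w) \<le> norm (\<alpha> z) + 1"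
    using local_bound_continuous[of "{()}" S "\<lambda>j. \<alpha>" z 1] \<alpha> z holomorphic_on_imp_continuous_on by auto
  define C where "C = exp (norm q / (1 - norm q)) * exp (norm (q * c / c') / (1 - norm q))
      * (\<Prod>i\<in>I. exp (norm (x i * c) / (1 - norm q))) * exp ((norm (\<alpha> z) + 1) * norm c / (1 - norm q))
      * (\<Prod>j\<in>J. exp ((norm (\<beta> z j) + 1) * norm c / (1 - norm q)))"
  show "\<exists>d M. 0 < d \<and> M summable_on UNIV \<and>
      (\<forall>k\<in>UNIV. \<forall>w\<in>S \<inter> ball z d. norm (jterm I x J (\<beta> w) (\<alpha> w) c c' k) \<le> M k)"
  proof (intro exI conjI ballI)
    show "min d1 d2 > 0" using d1 d2 by simp
    fix k w assume w: "w \<in> S \<inter> ball z (min d1 d2)"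
    show "norm (jterm I x J (\<beta> w) (\<alpha> w) c c' k) \<le> C * norm q ^ k"
      unfolding C_def using w d1(2) d2(2) by (intro norm_jterm_le assms) auto
  next
    show "(\<lambda>k. C * norm q ^ k) summable_on UNIV"
      using q_lt by (intro norm_summable_imp_summable_on)
        (auto simp: abs_mult intro!: summable_mult summable_geometric)
  qed
qed

lemma holomorphic_jalpha:
  assumes "\<And>j. j \<in> J \<Longrightarrow> (\<lambda>w. \<beta> w j) holomorphic_on S" "\<And>i. i \<in> I \<Longrightarrow> x i \<noteq> 0" "finite I"
  shows "(\<lambda>w. jalpha I x J (\<beta> w) c c') holomorphic_on S"
  unfolding jalpha_def using assms by (intro holomorphic_intros) auto

lemma holomorphic_jnorm:
  assumes "finite I" "finite J" "open S" "\<And>j. j \<in> J \<Longrightarrow> (\<lambda>w. \<beta> w j) holomorphic_on S"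
    "\<And>i. i \<in> I \<Longrightarrow> x i \<noteq> 0"
  shows "(\<lambda>w. jnorm I x J (\<beta> w) c c') holomorphic_on S"
  unfolding jnorm_def
  by (intro holomorphic_intros holomorphic_jhalf holomorphic_jalpha assms)

lemma jalpha_shift:
  assumes "finite J" "j \<in> J"
  shows "jalpha I x J (b(j := q * b j)) c c' = q * jalpha I x J b c c'"
proof -
  have "(\<Prod>k\<in>J. (b(j := q * b j)) k) = q * (\<Prod>k\<in>J. b k)"
    using assms by (simp add: prod.remove[of J j])
  then show ?thesis unfolding jalpha_def by simp
qed

lemma prod_fun_upd:
  fixes f :: "complex \<Rightarrow> complex"
  assumes "finite J" "j \<in> J"
  shows "(\<Prod>k\<in>J. f ((b(j := y)) k)) = f y * (\<Prod>k\<in>J - {j}. f (b k))"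
proof -
  have "(\<Prod>k\<in>J. f ((b(j := y)) k)) = f ((b(j := y)) j) * (\<Prod>k\<in>J - {j}. f ((b(j := y)) k))"
    by (rule prod.remove[OF assms])
  moreover have "(\<Prod>k\<in>J - {j}. f ((b(j := y)) k)) = (\<Prod>k\<in>J - {j}. f (b k))"
    by (rule prod.cong) auto
  ultimately show ?thesis by simp
qed

text \<open>Up to a constant, the shift of \<open>b j\<close> multiplies the integrand by the linear
  factor \<open>1 - b j * t\<close> at \<open>t = c * q ^ n\<close>, because
  \<open>(1 - y) * R (y * q) n = R y n * (1 - y * q ^ n)\<close>.\<close>

lemma jterm_shift:
  assumes "finite J" "j \<in> J"
  shows "(1 - b j * c) * jterm I x J (b(j := q * b j)) \<alpha> c c' n
           = jterm I x J b \<alpha> c c' n * (1 - b j * c * q ^ n)"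
proof -
  define E where "E = (\<Prod>k\<in>J - {j}. R (b k * c) n)"
  have 1: "(\<Prod>k\<in>J. R ((b(j := q * b j)) k * c) n) = R (q * b j * c) n * E"
    unfolding E_def by (rule prod_fun_upd[OF assms, where f = "\<lambda>y. R (y * c) n"])
  have 2: "(\<Prod>k\<in>J. R (b k * c) n) = R (b j * c) n * E"
    unfolding E_def by (rule prod.remove[OF assms])
  have 3: "R (q * b j * c) n = R (b j * c * q) n" by (simp add: mult_ac)
  have 4: "(1 - b j * c) * R (b j * c * q) n = R (b j * c) n * (1 - b j * c * q ^ n)"
    using qpoch_Suc[of "b j * c" n] qpoch_Suc_left[of "b j * c" n] by simp
  have "(1 - b j * c) * (Z * (R (b j * c * q) n * E)) = Z * (R (b j * c) n * E) * (1 - b j * c * q ^ n)" for Z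
  proof -
    have "(1 - b j * c) * (Z * (R (b j * c * q) n * E)) = Z * E * ((1 - b j * c) * R (b j * c * q) n)"
      by (simp only: mult_ac)
    also have "\<dots> = Z * (R (b j * c) n * E) * (1 - b j * c * q ^ n)"
      unfolding 4 by (simp only: mult_ac)
    finally show ?thesis .
  qed
  then show ?thesis unfolding jterm_def 1 2 3 .
qed

text \<open>The factor \<open>1 - b j * c'\<close> stems from the normalizing product at the other
  end point. Apart from \<open>b j\<close> itself, the right side does not depend on which index is
  shifted.\<close>

lemma jhalf_shift:
  assumes "finite I" "finite J" "j \<in> J"
  shows "(1 - b j * c) * (1 - b j * c') * ((\<Prod>k\<in>J. P ((b(j := q * b j)) k * c'))
            * jhalf I x J (b(j := q * b j)) \<alpha> c c')
       = (\<Prod>k\<in>J. P (b k * c')) * (jhalf I x J b \<alpha> c c'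
            - b j * (\<Sum>\<^sub>\<infinity>n. jterm I x J b \<alpha> c c' n * (c * q ^ n)))"
proof -
  have "(\<Prod>k\<in>J. P (b k * c')) = P (b j * c') * (\<Prod>k\<in>J - {j}. P (b k * c'))"
    by (rule prod.remove[OF assms(2,3)])
  moreover have "P (b j * c') = (1 - b j * c') * P (q * b j * c')"
    using qpoch_inf_step[of "b j * c'"] by (simp add: mult_ac)
  ultimately have 1: "(1 - b j * c') * (\<Prod>k\<in>J. P ((b(j := q * b j)) k * c')) = (\<Prod>k\<in>J. P (b k * c'))"
    unfolding prod_fun_upd[OF assms(2,3), where f = "\<lambda>y. P (y * c')"] by simp
  have 2: "(1 - b j * c) * jhalf I x J (b(j := q * b j)) \<alpha> c c'
      = (\<Sum>\<^sub>\<infinity>n. jterm I x J b \<alpha> c c' n - b j * (jterm I x J b \<alpha> c c' n * (c * q ^ n)))"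
    unfolding jhalf_def infsum_cmult_right'[symmetric] jterm_shift[OF assms(2,3)]
    by (simp add: algebra_simps)
  have 3: "(\<Sum>\<^sub>\<infinity>n. jterm I x J b \<alpha> c c' n - b j * (jterm I x J b \<alpha> c c' n * (c * q ^ n)))
      = jhalf I x J b \<alpha> c c' - b j * (\<Sum>\<^sub>\<infinity>n. jterm I x J b \<alpha> c c' n * (c * q ^ n))"
    unfolding jhalf_def infsum_cmult_right'[symmetric]
    by (intro infsumI has_sum_diff has_sum_infsum jterm_summable summable_on_cmult_right
          jterm_power_summable assms)
  have "(1 - b j * c) * (1 - b j * c') * ((\<Prod>k\<in>J. P ((b(j := q * b j)) k * c'))
            * jhalf I x J (b(j := q * b j)) \<alpha> c c')
      = ((1 - b j * c') * (\<Prod>k\<in>J. P ((b(j := q * b j)) k * c')))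
        * ((1 - b j * c) * jhalf I x J (b(j := q * b j)) \<alpha> c c')"
    by (simp only: mult_ac)
  then show ?thesis unfolding 1 2 3 .
qed

text \<open>All three shifts turn \<open>jalpha\<close> into the same value \<open>A\<close>, so
  each of the three expressions is \<open>U - b j * V\<close> with common \<open>U\<close> and
  \<open>V\<close>, and the cyclic combination annihilates this.\<close>

lemma jnorm_three_term:
  assumes "finite I" "finite J" "j1 \<in> J" "j2 \<in> J" "j3 \<in> J"
  shows "(b j2 - b j3) * ((1 - b j1 * c) * (1 - b j1 * c') * jnorm I x J (b(j1 := q * b j1)) c c')
       + (b j3 - b j1) * ((1 - b j2 * c) * (1 - b j2 * c') * jnorm I x J (b(j2 := q * b j2)) c c')
       + (b j1 - b j2) * ((1 - b j3 * c) * (1 - b j3 * c') * jnorm I x J (b(j3 := q * b j3)) c c') = 0"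
proof -
  define A where "A = q * jalpha I x J b c c'"
  define S where "S = (\<lambda>c c'. \<Sum>\<^sub>\<infinity>n. jterm I x J b A c c' n * (c * q ^ n))"
  have "(1 - b j * c) * (1 - b j * c') * jnorm I x J (b(j := q * b j)) c c'
     = c' * ((\<Prod>k\<in>J. P (b k * c)) * (jhalf I x J b A c' c - b j * S c' c))
       - c * ((\<Prod>k\<in>J. P (b k * c')) * (jhalf I x J b A c c' - b j * S c c'))" if "j \<in> J" for j
    unfolding S_def jhalf_shift[OF assms(1,2) that, symmetric]
    unfolding jnorm_def jalpha_shift[OF assms(2) that] A_def[symmetric]
    by (simp add: algebra_simps)
  note * = this[OF assms(3)] this[OF assms(4)] this[OF assms(5)]
  show ?thesis unfolding * by (simp add: algebra_simps)
qed

section \<open>Dimension zero: the nonterminating q-Saalschuetz sum\<close>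

text \<open>In the bracket on the right the constant terms cancel, and by balancing so do the cubic
  ones. What remains is \<open>t\<close> times a linear polynomial, which is a combination of the
  two linear factors on the left. The two products in the bracket will belong to consecutive members
  of a telescoping sequence.\<close>

lemma base_telescoping_identity:
  fixes c c' :: complex
  assumes "c \<noteq> 0" "c' \<noteq> 0"
  shows "t * ((1 - b3 * c) * (1 - b3 * c') * (1 - c * c' * b1 * b2 * b3 * t)
            - (1 - c * c' * b1 * b3) * (1 - c * c' * b2 * b3) * (1 - b3 * t))
       = c * c' * b3 * ((1 - t / c) * (1 - t / c') * (1 - c * c' * b1 * b2 * b3 * t)
            - (1 - b1 * t) * (1 - b2 * t) * (1 - b3 * t))"
proof -
  have "c * c' * b3 * ((1 - u) * (1 - v) * X - Y) = b3 * ((c - c * u) * (c' - c' * v) * X - c * c' * Y)" for u v X Y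
    by (simp add: algebra_simps)
  from this[of "t / c" "t / c'"]
  have "c * c' * b3 * ((1 - t / c) * (1 - t / c') * X - Y) = b3 * ((c - t) * (c' - t) * X - c * c' * Y)" for X Y
    using assms by simp
  note * = this
  show ?thesis unfolding * by (simp add: algebra_simps)
qed

text \<open>The boundary terms of the two half integrals are \<open>c'\<close> and \<open>c\<close>
  times one symmetric product, so they cancel in the difference that defines
  \<open>jnorm\<close>.\<close>

lemma base_combination:
  fixes lam :: complex
  assumes "lam * (p' * H) - k * (lam * (s' * G)) = - c' * b * (p * p')"
    and "lam * (p * H') - k * (lam * (s * G')) = - c * b * (p' * p)"
  shows "lam * ((c' * p * H' - c * p' * H) - k * (c' * s * G' - c * s' * G)) = 0"
proof -
  have "lam * ((c' * p * H' - c * p' * H) - k * (c' * s * G' - c * s' * G))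
      = c' * (lam * (p * H') - k * (lam * (s * G'))) - c * (lam * (p' * H) - k * (lam * (s' * G)))"
    by (simp add: algebra_simps)
  then show ?thesis unfolding assms by simp
qed

text \<open>The combination of terms is a multiple of \<open>g (Suc n) - g n\<close>. Here
  \<open>g 0 = 0\<close> because of the factor \<open>P 1\<close>, and the limit of
  \<open>g\<close>, its value as \<open>t\<close> tends to \<open>0\<close>, gives the right
  side.\<close>

lemma jhalf_base_telescope:
  fixes b :: "'j \<Rightarrow> complex"
  assumes c: "c \<noteq> 0" "c' \<noteq> 0" and J: "J = {j1, j2, j3}" "j1 \<noteq> j2" "j1 \<noteq> j3" "j2 \<noteq> j3"
  defines "\<alpha> \<equiv> c * c' * b j1 * b j2 * b j3"
  shows "(1 - b j3 * c) * (1 - b j3 * c') * ((\<Prod>k\<in>J. P (b k * c')) * jhalf {} x J b \<alpha> c c')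
       - (1 - c * c' * b j1 * b j3) * (1 - c * c' * b j2 * b j3) *
           ((1 - b j3 * c) * (1 - b j3 * c') * ((\<Prod>k\<in>J. P ((b(j3 := q * b j3)) k * c'))
             * jhalf {} x J (b(j3 := q * b j3)) (q * \<alpha>) c c'))
       = - c' * b j3 * ((\<Prod>k\<in>J. P (b k * c)) * (\<Prod>k\<in>J. P (b k * c')))"
proof -
  have fin: "finite J" and j3: "j3 \<in> J" using J by auto
  define T where "T = jterm {} x J b (q * \<alpha>) c c'"
  define g where "g = (\<lambda>n. P (q ^ n) * P (q ^ n * c / c') * P (\<alpha> * c * q ^ n) * (\<Prod>j\<in>J. R (b j * c) n))"
  define kap where "kap = (1 - c * c' * b j1 * b j3) * (1 - c * c' * b j2 * b j3)"
  define lam where "lam = (1 - b j3 * c) * (1 - b j3 * c')"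
  have alpha: "jterm {} x J b \<alpha> c c' n = T n - \<alpha> * (T n * (c * q ^ n))" for n
  proof -
    have *: "P (\<alpha> * c * q ^ n) = (1 - \<alpha> * (c * q ^ n)) * P (q * \<alpha> * c * q ^ n)"
      using qpoch_inf_step[of "\<alpha> * c * q ^ n"] by (simp add: mult_ac)
    show ?thesis unfolding T_def jterm_def * by (simp add: algebra_simps)
  qed
  have T_sum: "T summable_on UNIV" "(\<lambda>n. T n * (c * q ^ n)) summable_on UNIV"
    unfolding T_def by (intro jterm_summable jterm_power_summable; use fin in simp)+
  have tele: "lam * (T n - \<alpha> * (T n * (c * q ^ n))) - kap * (T n - b j3 * (T n * (c * q ^ n)))
      = - (c' * b j3) * (g (Suc n) - g n)" for n
  proof -
    define t where "t = c * q ^ n"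
    define h where "h = P (q * q ^ n) * P (q * c / c' * q ^ n) * P (q * \<alpha> * c * q ^ n) * (\<Prod>j\<in>J. R (b j * c) n)"
    have T: "T n = t / c * h"
      using c by (simp add: T_def jterm_def h_def t_def)
    have gS: "g (Suc n) = h * ((1 - b j1 * t) * (1 - b j2 * t) * (1 - b j3 * t))"
      using J by (simp add: g_def h_def qpoch_Suc t_def mult_ac)
    have g: "g n = h * ((1 - t / c) * (1 - t / c') * (1 - \<alpha> * t))"
      unfolding g_def h_def t_def
      using c qpoch_inf_step[of "q ^ n"] qpoch_inf_step[of "q ^ n * c / c'"] qpoch_inf_step[of "\<alpha> * c * q ^ n"]
      by (simp add: mult_ac)
    have id: "t * (lam * (1 - \<alpha> * t) - kap * (1 - b j3 * t))
       = c * c' * b j3 * ((1 - t / c) * (1 - t / c') * (1 - \<alpha> * t) - (1 - b j1 * t) * (1 - b j2 * t) * (1 - b j3 * t))"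
      unfolding lam_def kap_def \<alpha>_def by (rule base_telescoping_identity[OF c])
    have aux: "h / c * (c * c' * b j3 * (X - Y)) = - (c' * b j3) * (h * Y - h * X)" for X Y
      using c(1) by (simp add: algebra_simps)
    have "lam * (T n - \<alpha> * (T n * t)) - kap * (T n - b j3 * (T n * t))
        = h / c * (t * (lam * (1 - \<alpha> * t) - kap * (1 - b j3 * t)))"
      unfolding T by (simp add: algebra_simps)
    also have "\<dots> = - (c' * b j3) * (g (Suc n) - g n)"
      unfolding id g gS by (rule aux)
    finally show ?thesis unfolding t_def .
  qed
  have lim: "g \<longlonglongrightarrow> 1 * 1 * 1 * (\<Prod>j\<in>J. P (b j * c))"
    unfolding g_def
    using power_q_LIMSEQ[of 1] power_q_LIMSEQ[of "c / c'"] power_q_LIMSEQ[of "\<alpha> * c"]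
    by (intro tendsto_mult tendsto_prod qpoch_LIMSEQ qpoch_inf_tendsto_1) (simp_all add: mult_ac)
  have g0: "g 0 = 0" by (simp add: g_def)
  have "(\<lambda>n. lam * (T n - \<alpha> * (T n * (c * q ^ n))) - kap * (T n - b j3 * (T n * (c * q ^ n))))
      sums (- (c' * b j3) * (\<Prod>j\<in>J. P (b j * c)))"
    unfolding tele using telescope_sums[OF lim] g0 by (intro sums_mult) simp
  moreover have "(\<lambda>n. lam * (T n - \<alpha> * (T n * (c * q ^ n))) - kap * (T n - b j3 * (T n * (c * q ^ n))))
      sums (lam * jhalf {} x J b \<alpha> c c'
        - kap * (infsum T UNIV - b j3 * (\<Sum>\<^sub>\<infinity>n. T n * (c * q ^ n))))"
    unfolding jhalf_def alpha[abs_def]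
    by (intro has_sum_imp_sums has_sum_diff has_sum_cmult_right)
       (simp_all add: alpha[symmetric] jterm_summable has_sum_infsum T_sum fin)
  ultimately have main: "lam * jhalf {} x J b \<alpha> c c'
        - kap * (infsum T UNIV - b j3 * (\<Sum>\<^sub>\<infinity>n. T n * (c * q ^ n)))
      = - (c' * b j3) * (\<Prod>j\<in>J. P (b j * c))"
    by (rule sums_unique2[symmetric])
  have shift: "lam * ((\<Prod>k\<in>J. P ((b(j3 := q * b j3)) k * c')) * jhalf {} x J (b(j3 := q * b j3)) (q * \<alpha>) c c')
     = (\<Prod>k\<in>J. P (b k * c')) * (infsum T UNIV - b j3 * (\<Sum>\<^sub>\<infinity>n. T n * (c * q ^ n)))"
    unfolding lam_def by (subst jhalf_shift[OF finite.emptyI fin j3]) (simp add: T_def jhalf_def)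
  have "lam * ((\<Prod>k\<in>J. P (b k * c')) * jhalf {} x J b \<alpha> c c')
       - kap * (lam * ((\<Prod>k\<in>J. P ((b(j3 := q * b j3)) k * c')) * jhalf {} x J (b(j3 := q * b j3)) (q * \<alpha>) c c'))
     = (\<Prod>k\<in>J. P (b k * c')) * (lam * jhalf {} x J b \<alpha> c c'
        - kap * (infsum T UNIV - b j3 * (\<Sum>\<^sub>\<infinity>n. T n * (c * q ^ n))))"
    unfolding shift by (simp add: algebra_simps)
  also have "\<dots> = - c' * b j3 * ((\<Prod>k\<in>J. P (b k * c)) * (\<Prod>k\<in>J. P (b k * c')))"
    unfolding main by simp
  finally show ?thesis unfolding lam_def kap_def .
qed

lemma jnorm_base_step:
  assumes c: "c \<noteq> 0" "c' \<noteq> 0" and J: "J = {j1, j2, j3}" "j1 \<noteq> j2" "j1 \<noteq> j3" "j2 \<noteq> j3"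
  shows "jnorm {} x J b c c'
       = (1 - c * c' * b j1 * b j3) * (1 - c * c' * b j2 * b j3) * jnorm {} x J (b(j3 := q * b j3)) c c'"
proof -
  define F where "F = (\<lambda>y. jnorm {} x J (b(j3 := y)) c c')"
  have hol: "(\<lambda>y. F (\<phi> y)) holomorphic_on UNIV" if "\<phi> holomorphic_on UNIV" for \<phi>
    unfolding F_def
  proof (rule holomorphic_jnorm)
    fix j show "(\<lambda>w. (b(j3 := \<phi> w)) j) holomorphic_on UNIV"
      using that by (cases "j = j3") simp_all
  qed (simp_all add: J(1))
  have F1: "F holomorphic_on UNIV"
    by (rule hol[OF holomorphic_on_ident])
  have F2: "(\<lambda>y. F (q * y)) holomorphic_on UNIV"
    by (rule hol[OF holomorphic_on_mult[OF holomorphic_on_const holomorphic_on_ident]])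
  define G where "G = (\<lambda>y. F y - (1 - c * c' * b j1 * y) * (1 - c * c' * b j2 * y) * F (q * y))"
  \<comment> \<open>The factor \<open>(1 - y * c) * (1 - y * c')\<close> left over by the
    telescoping can be cancelled except at \<open>1 / c\<close> and \<open>1 / c'\<close>;
    continuity in \<open>y\<close> covers these two points.\<close>
  have "G (b j3) = 0"
  proof (rule continuous_zero_off_countable[where f = G and w = "b j3" and S = UNIV and N = "{1 / c, 1 / c'}"])
    show "continuous_on UNIV G"
      unfolding G_def
      by (intro holomorphic_on_imp_continuous_on holomorphic_on_diff holomorphic_on_mult
            holomorphic_on_const holomorphic_on_ident F1 F2)
  next
    fix y assume "y \<in> UNIV - {1 / c, 1 / c'}"
    then have "y \<noteq> 1 / c" "y \<noteq> 1 / c'" by auto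
    then have y: "1 - y * c \<noteq> 0" "1 - y * c' \<noteq> 0"
      using c by (metis eq_divide_eq eq_iff_diff_eq_0)+
    define b' where "b' = b(j3 := y)"
    have b': "b' j1 = b j1" "b' j2 = b j2" "b' j3 = y" using J by (auto simp: b'_def)
    have J_in: "finite J" "j3 \<in> J" using J(1) by simp_all
    have alpha: "jalpha {} x J b' c c' = c * c' * b' j1 * b' j2 * b' j3"
      unfolding jalpha_def J(1) using J(2-4) by simp
    have alpha': "jalpha {} x J (b'(j3 := q * b' j3)) c c' = q * (c * c' * b' j1 * b' j2 * b' j3)"
      unfolding jalpha_shift[OF J_in] alpha ..
    have sw: "c' * c = c * c'" "(1 - b' j3 * c') * (1 - b' j3 * c) = (1 - b' j3 * c) * (1 - b' j3 * c')"
      by simp_all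
    note h1 = jhalf_base_telescope[OF c J, of b' x]
    note h2 = jhalf_base_telescope[OF c(2,1) J, of b' x, unfolded sw]
    have "(1 - b' j3 * c) * (1 - b' j3 * c') * (jnorm {} x J b' c c'
        - (1 - c * c' * b' j1 * b' j3) * (1 - c * c' * b' j2 * b' j3)
          * jnorm {} x J (b'(j3 := q * b' j3)) c c') = 0"
      unfolding jnorm_def alpha alpha' by (rule base_combination[OF h1 h2])
    then have "(1 - y * c) * (1 - y * c') * (jnorm {} x J b' c c'
        - (1 - c * c' * b j1 * y) * (1 - c * c' * b j2 * y) * jnorm {} x J (b'(j3 := q * b' j3)) c c') = 0"
      unfolding b' .
    then show "G y = 0"
      using y by (simp add: G_def F_def b'_def)
  qed auto
  then show ?thesis by (simp add: G_def F_def)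
qed

lemma jnorm_base_to_zero:
  assumes c: "c \<noteq> 0" "c' \<noteq> 0" and J: "J = {j1, j2, j3}" "j1 \<noteq> j2" "j1 \<noteq> j3" "j2 \<noteq> j3"
  shows "jnorm {} x J b c c'
       = P (c * c' * b j1 * b j3) * P (c * c' * b j2 * b j3) * jnorm {} x J (b(j3 := 0)) c c'"
proof -
  define F where "F = (\<lambda>y. jnorm {} x J (b(j3 := y)) c c')"
  have *: "F (b j3) = R (c * c' * b j1 * b j3) n * R (c * c' * b j2 * b j3) n * F (b j3 * q ^ n)" for n
  proof (induction n)
    case (Suc n)
    have "F (b j3 * q ^ n) = (1 - c * c' * b j1 * (b j3 * q ^ n)) * (1 - c * c' * b j2 * (b j3 * q ^ n))
        * F (b j3 * q ^ Suc n)"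
      unfolding F_def using jnorm_base_step[OF c J, of x "b(j3 := b j3 * q ^ n)"] J by (simp add: mult_ac)
    with Suc show ?case by (simp add: qpoch_Suc mult_ac)
  qed simp
  have "F holomorphic_on UNIV"
    unfolding F_def using J by (intro holomorphic_jnorm) (auto intro!: holomorphic_intros)
  then have "isCont F 0"
    using holomorphic_on_imp_continuous_on continuous_on_eq_continuous_at by blast
  then have "(\<lambda>n. F (b j3 * q ^ n)) \<longlonglongrightarrow> F 0"
    using power_q_LIMSEQ isCont_tendsto_compose by blast
  then have "(\<lambda>n. R (c * c' * b j1 * b j3) n * R (c * c' * b j2 * b j3) n * F (b j3 * q ^ n))
     \<longlonglongrightarrow> P (c * c' * b j1 * b j3) * P (c * c' * b j2 * b j3) * F 0"
    by (intro tendsto_mult qpoch_LIMSEQ)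
  then have "(\<lambda>n. F (b j3)) \<longlonglongrightarrow> P (c * c' * b j1 * b j3) * P (c * c' * b j2 * b j3) * F 0"
    unfolding *[symmetric] .
  then have "F (b j3) = P (c * c' * b j1 * b j3) * P (c * c' * b j2 * b j3) * F 0"
    using LIMSEQ_unique tendsto_const by blast
  then show ?thesis by (simp add: F_def)
qed

text \<open>The value of \<open>jnorm {} x J b c c'\<close> when all three \<open>b j\<close>
  vanish. Up to elementary factors it is a theta function of \<open>c / c'\<close>; like
  \<open>jnorm\<close> it changes sign when the end points are exchanged, which is
  \<open>jconst_alt\<close>.\<close>

definition jconst :: "complex \<Rightarrow> complex \<Rightarrow> complex" where
  "jconst c c' = c' * P q * P (q * c' / c) * P (c / c')"

lemma jconst_alt:
  assumes "c \<noteq> 0" "c' \<noteq> 0"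
  shows "jconst c c' = - c * P q * P (q * c / c') * P (c' / c)"
proof -
  have 1: "P (c' / c) = (1 - c' / c) * P (q * c' / c)" and 2: "P (c / c') = (1 - c / c') * P (q * c / c')"
    using qpoch_inf_step[of "c' / c"] qpoch_inf_step[of "c / c'"] by (simp_all add: mult_ac)
  have "c' * (1 - c / c') = - c * (1 - c' / c)" using assms by (simp add: field_simps)
  then have "c' * (1 - c / c') * (P q * P (q * c' / c) * P (q * c / c'))
      = - c * (1 - c' / c) * (P q * P (q * c' / c) * P (q * c / c'))" by simp
  then show ?thesis unfolding jconst_def 1 2 by (simp only: mult_ac)
qed

lemma nonterminating_q_Saalschuetz:
  assumes c: "c \<noteq> 0" "c' \<noteq> 0" and J: "J = {j1, j2, j3}" "j1 \<noteq> j2" "j1 \<noteq> j3" "j2 \<noteq> j3"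
  shows "jnorm {} x J b c c'
       = jconst c c' * P (c * c' * b j1 * b j2) * P (c * c' * b j1 * b j3) * P (c * c' * b j2 * b j3)"
proof -
  have J': "J = {j1, j3, j2}" "J = {j3, j2, j1}" using J by auto
  define b0 where "b0 = b(j3 := 0, j2 := 0)"
  \<comment> \<open>With two parameters equal to zero the integral does not depend on the third,
    which may thus be chosen as \<open>1 / c\<close>. Then the half integral at \<open>c\<close> has
    only its term \<open>n = 0\<close>, since \<open>R 1 n = 0\<close> for \<open>n > 0\<close>, and
    the other half carries the factor \<open>P 1 = 0\<close>.\<close>
  define b1 where "b1 = b(j3 := 0, j2 := 0, j1 := 1 / c)"
  have b0: "jnorm {} x J b0 c c' = jnorm {} x J (b0(j1 := 0)) c c'"
    using jnorm_base_to_zero[OF c J'(2), of x b0] J by (simp add: b0_def)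
  have b1: "jnorm {} x J b1 c c' = jnorm {} x J (b0(j1 := 0)) c c'"
    using jnorm_base_to_zero[OF c J'(2), of x b1] J by (simp add: b1_def b0_def)
  have z: "R 1 n = 0" if "n > 0" for n
    using that qpoch_Suc_left[of 1] by (cases n) auto
  have alpha: "jalpha {} x J b1 c c' = 0"
    using J by (simp add: jalpha_def b1_def)
  have prodR: "(\<Prod>j\<in>J. R (b1 j * c) n) = R 1 n" for n
    using J c by (simp add: b1_def qpoch_def)
  have "jhalf {} x J b1 0 c c' = jterm {} x J b1 0 c c' 0"
    unfolding jhalf_def
    by (subst infsum_cong_neutral[where T = "{0}" and g = "jterm {} x J b1 0 c c'"])
       (auto simp: jterm_def prodR z)
  also have "\<dots> = P q * P (q * c / c')"
    by (simp add: jterm_def)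
  finally have "jnorm {} x J b1 c c' = jconst c c'"
    unfolding jnorm_def alpha jconst_alt[OF c] using J c by (simp add: b1_def)
  with b0 b1 have "jnorm {} x J b0 c c' = jconst c c'" by simp
  moreover have "jnorm {} x J b c c' = P (c * c' * b j1 * b j3) * P (c * c' * b j2 * b j3) *
      (P (c * c' * b j1 * b j2) * jnorm {} x J b0 c c')"
    using jnorm_base_to_zero[OF c J, of x b] jnorm_base_to_zero[OF c J'(1), of x "b(j3 := 0)"] J
    by (simp add: b0_def)
  ultimately show ?thesis by (simp add: mult_ac)
qed

end

subsection \<open>The multiple series\<close>

text \<open>A finite set of multi-indices lies in a box, over which the sum factors into partial
  sums of geometric series.\<close>

lemma summable_power_sum_PiE:
  fixes \<rho> :: real
  assumes "finite I" "0 \<le> \<rho>" "\<rho> < 1"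
  shows "(\<lambda>l. \<rho> ^ sum l I) summable_on (I \<rightarrow>\<^sub>E (UNIV :: nat set))"
proof (rule nonneg_bdd_above_summable_on)
  show "bdd_above (sum (\<lambda>l. \<rho> ^ sum l I) ` {F. F \<subseteq> (I \<rightarrow>\<^sub>E UNIV) \<and> finite F})"
  proof (rule bdd_aboveI2)
    fix F assume F: "F \<in> {F. F \<subseteq> (I \<rightarrow>\<^sub>E (UNIV :: nat set)) \<and> finite F}"
    define N where "N = (\<Sum>l\<in>F. sum l I)"
    have "F \<subseteq> (I \<rightarrow>\<^sub>E {..N})"
    proof
      fix l assume l: "l \<in> F"
      have "l i \<le> N" if "i \<in> I" for i
        using member_le_sum[of i I l] member_le_sum[of l F "\<lambda>l. sum l I"] assms(1) F l that
        unfolding N_def by force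
      then show "l \<in> (I \<rightarrow>\<^sub>E {..N})" using F l by (auto simp: PiE_iff)
    qed
    then have "(\<Sum>l\<in>F. \<rho> ^ sum l I) \<le> (\<Sum>l\<in>I \<rightarrow>\<^sub>E {..N}. \<rho> ^ sum l I)"
      using assms by (intro sum_mono2 finite_PiE) auto
    also have "\<dots> = (\<Sum>l\<in>I \<rightarrow>\<^sub>E {..N}. \<Prod>i\<in>I. \<rho> ^ l i)"
      by (simp add: power_sum)
    also have "\<dots> = (\<Prod>i\<in>I. \<Sum>k\<le>N. \<rho> ^ k)"
      using prod_sum_PiE[of I "\<lambda>_. {..N}" "\<lambda>_ k. \<rho> ^ k"] assms by simp
    also have "\<dots> \<le> (\<Prod>i\<in>I. 1 / (1 - \<rho>))"
    proof (intro prod_mono conjI sum_nonneg)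
      have "(\<Sum>k\<le>N. \<rho> ^ k) \<le> (\<Sum>k. \<rho> ^ k)"
        using assms by (intro sum_le_suminf summable_geometric) auto
      also have "\<dots> = 1 / (1 - \<rho>)" using assms by (intro suminf_geometric) auto
      finally show "(\<Sum>k\<le>N. \<rho> ^ k) \<le> 1 / (1 - \<rho>)" .
    qed (use assms in auto)
    finally show "(\<Sum>l\<in>F. \<rho> ^ sum l I) \<le> (\<Prod>i\<in>I. 1 / (1 - \<rho>))" .
  qed
qed (use assms in auto)

lemma finite_level_PiE:
  assumes "finite I"
  shows "finite {l \<in> I \<rightarrow>\<^sub>E UNIV. sum l I \<le> (n::nat)}"
proof (rule finite_subset)
  show "{l \<in> I \<rightarrow>\<^sub>E UNIV. sum l I \<le> n} \<subseteq> (I \<rightarrow>\<^sub>E {..n})"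
  proof
    fix l assume l: "l \<in> {l \<in> I \<rightarrow>\<^sub>E UNIV. sum l I \<le> n}"
    have "l i \<le> n" if "i \<in> I" for i
      using member_le_sum[of i I l] assms that l by force
    then show "l \<in> (I \<rightarrow>\<^sub>E {..n})" using l by (auto simp: PiE_iff)
  qed
  show "finite (I \<rightarrow>\<^sub>E {..n})" using assms by (intro finite_PiE) auto
qed

text \<open>The finite sets of bounded degree exhaust \<open>A\<close>, so an unordered sum can be
  evaluated degree by degree, the order in which the series will telescope.\<close>

lemma has_sum_level_LIMSEQ:
  fixes deg :: "'a \<Rightarrow> nat"
  assumes "(f has_sum S) A" "\<And>n. finite {l \<in> A. deg l \<le> n}"
  shows "(\<lambda>n. sum f {l \<in> A. deg l \<le> n}) \<longlonglongrightarrow> S"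
proof -
  have "filterlim (\<lambda>n. {l \<in> A. deg l \<le> n}) (finite_subsets_at_top A) sequentially"
    unfolding filterlim_finite_subsets_at_top
  proof safe
    fix X assume X: "finite X" "X \<subseteq> A"
    then obtain N where N: "\<And>l. l \<in> X \<Longrightarrow> deg l \<le> N"
      by (meson finite_imageI finite_nat_set_iff_bounded_le image_eqI)
    show "eventually (\<lambda>n. finite {l \<in> A. deg l \<le> n} \<and> X \<subseteq> {l \<in> A. deg l \<le> n} \<and> {l \<in> A. deg l \<le> n} \<subseteq> A) sequentially"
      using eventually_ge_at_top[of N]
      by eventually_elim (use X N assms(2) order_trans in fastforce)
  qed
  then show ?thesis
    using assms(1) unfolding has_sum_def by (rule filterlim_compose[rotated])
qed

lemma summable_level_tendsto_0:
  fixes f :: "'a \<Rightarrow> complex" and deg :: "'a \<Rightarrow> nat"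
  assumes "f summable_on A" "\<And>n. finite {l \<in> A. deg l \<le> n}"
  shows "(\<lambda>n. sum f {l \<in> A. deg l = Suc n}) \<longlonglongrightarrow> 0"
proof -
  obtain S where S: "(f has_sum S) A" using assms(1) by (auto simp: summable_on_def)
  have L: "(\<lambda>n. sum f {l \<in> A. deg l \<le> n}) \<longlonglongrightarrow> S"
    by (rule has_sum_level_LIMSEQ[OF S assms(2)])
  have "sum f {l \<in> A. deg l = Suc n} = sum f {l \<in> A. deg l \<le> Suc n} - sum f {l \<in> A. deg l \<le> n}" for n
  proof -
    have "{l \<in> A. deg l = Suc n} = {l \<in> A. deg l \<le> Suc n} - {l \<in> A. deg l \<le> n}" by auto
    then show ?thesis using assms(2) by (simp only:) (intro sum_diff; auto)
  qed
  moreover have "(\<lambda>n. sum f {l \<in> A. deg l \<le> Suc n} - sum f {l \<in> A. deg l \<le> n}) \<longlonglongrightarrow> S - S"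
    by (intro tendsto_diff L LIMSEQ_Suc[OF L])
  ultimately show ?thesis by simp
qed

text \<open>Makes the Vandermonde product available for any index set: the induction deletes an
  index that need not be the last one.\<close>

definition pairs :: "nat set \<Rightarrow> (nat \<times> nat) set" where
  "pairs I = {(i, j). i \<in> I \<and> j \<in> I \<and> i < j}"

lemma finite_pairs: "finite I \<Longrightarrow> finite (pairs I)"
  by (rule finite_subset[of _ "I \<times> I"]) (auto simp: pairs_def)

lemma prod_pairs_remove:
  assumes "finite I" "m \<in> I" and sym: "\<And>i j. f i j = f j i"
  shows "(\<Prod>(i, j)\<in>pairs I. f i j) = (\<Prod>k\<in>I - {m}. f m k) * (\<Prod>(i, j)\<in>pairs (I - {m}). f i j)"
proof -
  define A where "A = (\<lambda>k. if k < m then (k, m) else (m, k)) ` (I - {m})"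
  have inj: "inj_on (\<lambda>k. if k < m then (k, m) else (m, k)) (I - {m})"
    by (auto simp: inj_on_def split: if_splits)
  have "pairs I = A \<union> pairs (I - {m})" "A \<inter> pairs (I - {m}) = {}"
    using assms(2) by (auto simp: pairs_def A_def image_iff split: if_splits)
  then have "(\<Prod>(i, j)\<in>pairs I. f i j) = (\<Prod>(i, j)\<in>A. f i j) * (\<Prod>(i, j)\<in>pairs (I - {m}). f i j)"
    using assms(1) by (simp add: prod.union_disjoint finite_pairs A_def)
  moreover have "(\<Prod>(i, j)\<in>A. f i j) = (\<Prod>k\<in>I - {m}. f m k)"
    unfolding A_def prod.reindex[OF inj] o_def
    by (rule prod.cong) (auto simp: sym)
  ultimately show ?thesis by simp
qed

context q_disc
begin

definition vdm_ratio :: "nat set \<Rightarrow> (nat \<Rightarrow> complex) \<Rightarrow> (nat \<Rightarrow> nat) \<Rightarrow> complex" where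
  "vdm_ratio I x l = (\<Prod>(i, j)\<in>pairs I. (x i * q ^ l i - x j * q ^ l j) / (x i - x j))"

lemma vdm_ratio_remove:
  assumes "finite I" "m \<in> I"
  shows "vdm_ratio I x l
    = (\<Prod>k\<in>I - {m}. (x m * q ^ l m - x k * q ^ l k) / (x m - x k)) * vdm_ratio (I - {m}) x l"
  unfolding vdm_ratio_def
proof (rule prod_pairs_remove[OF assms])
  fix i j
  show "(x i * q ^ l i - x j * q ^ l j) / (x i - x j) = (x j * q ^ l j - x i * q ^ l i) / (x j - x i)"
    by (metis minus_diff_eq minus_divide_divide)
qed

text \<open>For \<open>b \<noteq> 0\<close> this is \<open>b ^ l * R (y / b) l\<close>. Distributing
  the powers of the \<open>b j\<close> contained in \<open>z\<close> over these factors leaves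
  polynomials in \<open>b j\<close>, without a pole at \<open>b j = 0\<close>.\<close>

definition qmono :: "complex \<Rightarrow> complex \<Rightarrow> nat \<Rightarrow> complex" where
  "qmono b y l = (\<Prod>k<l. b - y * q ^ k)"

text \<open>\<open>e\<close> stands for \<open>a * q\<close>, \<open>s\<close> for the total degree
  and \<open>n\<close> for the component \<open>l i\<close>. The denominator
  \<open>1 - a * x i\<close> is left out, as it is cleared in \<open>kseries\<close>.\<close>

definition kfac :: "nat set \<Rightarrow> (nat \<Rightarrow> complex) \<Rightarrow> complex \<Rightarrow> complex \<Rightarrow> complex \<Rightarrow> nat \<Rightarrow> nat \<Rightarrow> nat \<Rightarrow> complex"
  where
  "kfac I x c c' e s i n =
     (1 - e * x i * q ^ (s + n) / q) * R (e * x i / q) s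
     / ((\<Prod>j\<in>I. R (q * x i / x j) n) * (R (c * x i) n * R (c' * x i) n))"

definition kterm ::
  "nat set \<Rightarrow> (nat \<Rightarrow> complex) \<Rightarrow> 'j set \<Rightarrow> ('j \<Rightarrow> complex) \<Rightarrow> complex \<Rightarrow> complex \<Rightarrow> complex
    \<Rightarrow> (nat \<Rightarrow> nat) \<Rightarrow> complex"
  where
  "kterm I x J b B c c' l =
     (c * c' / (\<Prod>i\<in>I. x i)) ^ sum l I * vdm_ratio I x l
     * (\<Prod>i\<in>I. kfac I x c c' (c * c' * B) (sum l I) i (l i))
     * (R (c * B) (sum l I) * R (c' * B) (sum l I))
     * (\<Prod>j\<in>J. P (c * c' * B * b j * q ^ sum l I) * (\<Prod>i\<in>I. qmono (b j) (x i) (l i)))"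

text \<open>
  \<open>kseries\<close> is Kajihara's series with \<open>x\<close>, \<open>a = c c' B / q\<close>, \<open>u j = 1 / b j\<close>, \<open>v1 = c B\<close>, \<open>v2 = c' B\<close>,
  multiplied by all \<open>1 - a x i\<close> and \<open>P (a q b j)\<close>, which makes it holomorphic in \<open>b\<close> and \<open>B\<close>.
\<close>

definition kseries ::
  "nat set \<Rightarrow> (nat \<Rightarrow> complex) \<Rightarrow> 'j set \<Rightarrow> ('j \<Rightarrow> complex) \<Rightarrow> complex \<Rightarrow> complex \<Rightarrow> complex \<Rightarrow> complex"
  where "kseries I x J b B c c' = (\<Sum>\<^sub>\<infinity>l\<in>I \<rightarrow>\<^sub>E UNIV. kterm I x J b B c c' l)"

text \<open>The last condition joins the distinctness of the \<open>x i\<close> with the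
  nonvanishing of the factors \<open>R (q * x i / x j) n\<close>: the nodes
  \<open>x i * q ^ l i\<close> never collide, for any multi-index.\<close>

definition generic_nodes :: "nat set \<Rightarrow> (nat \<Rightarrow> complex) \<Rightarrow> complex \<Rightarrow> complex \<Rightarrow> bool" where
  "generic_nodes I x c c' \<longleftrightarrow> finite I \<and> (\<forall>i\<in>I. x i \<noteq> 0 \<and> P (c * x i) \<noteq> 0 \<and> P (c' * x i) \<noteq> 0) \<and>
     (\<forall>i\<in>I. \<forall>k\<in>I. i \<noteq> k \<longrightarrow> (\<forall>m n. x i * q ^ m \<noteq> x k * q ^ n))"

lemma power_q_eq_iff [simp]: "q ^ m = q ^ n \<longleftrightarrow> m = n"
proof
  assume *: "q ^ m = q ^ n"
  have "norm q ^ m = norm q ^ n" using * by (metis norm_power)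
  then show "m = n"
    using q_nz q_lt power_strict_decreasing_iff[of "norm q" m n] power_strict_decreasing_iff[of "norm q" n m]
    by (metis less_irrefl linorder_neqE_nat zero_less_norm_iff)
qed simp

lemma generic_nodes_qpoch_inf:
  assumes "generic_nodes I x c c'" "i \<in> I" "j \<in> I"
  shows "P (q * x i / x j) \<noteq> 0"
  unfolding qpoch_inf_nonzero_iff
proof safe
  fix n assume *: "q * x i / x j * q ^ n = 1"
  have x: "x j \<noteq> 0" using assms by (auto simp: generic_nodes_def)
  then have "x i * q ^ Suc n = x j * q ^ 0" using * by (simp add: field_simps)
  then have "i = j" using assms unfolding generic_nodes_def by blast
  then have "q ^ Suc n = q ^ 0" using * x by (simp add: mult_ac)
  then show False unfolding power_q_eq_iff by simp
qed

section \<open>Convergence and holomorphy of the multiple series\<close>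

lemma norm_qmono_le:
  assumes "norm b \<le> r" "r > 0"
  shows "norm (qmono b y l) \<le> r ^ l * exp (norm y / r / (1 - norm q))"
proof -
  have "norm (qmono b y l) = (\<Prod>k<l. norm (b - y * q ^ k))"
    by (simp add: qmono_def prod_norm)
  also have "\<dots> \<le> (\<Prod>k<l. r * (1 + norm y / r * norm q ^ k))"
  proof (intro prod_mono conjI norm_ge_zero)
    fix k
    have "norm (b - y * q ^ k) \<le> norm b + norm (y * q ^ k)" by (rule norm_triangle_ineq4)
    also have "\<dots> \<le> r + norm y * norm q ^ k"
      using assms by (simp add: norm_mult norm_power)
    also have "\<dots> = r * (1 + norm y / r * norm q ^ k)" using assms by (simp add: field_simps)
    finally show "norm (b - y * q ^ k) \<le> r * (1 + norm y / r * norm q ^ k)" .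
  qed
  also have "\<dots> = r ^ l * (\<Prod>k<l. 1 + norm y / r * norm q ^ k)"
    by (simp add: prod.distrib)
  also have "\<dots> \<le> r ^ l * exp (norm y / r / (1 - norm q))"
    using assms by (intro mult_left_mono prod_le_exp_geometric) auto
  finally show ?thesis .
qed

lemma kfac_bounded:
  assumes "generic_nodes I x c c'" "i \<in> I"
  obtains C where "C \<ge> 0" "\<And>e s n. norm e \<le> E \<Longrightarrow> norm (kfac I x c c' e s i n) \<le> C"
proof -
  have fin: "finite I" using assms by (simp add: generic_nodes_def)
  have "\<exists>C. C > 0 \<and> (\<forall>n. norm (inverse (R (q * x i / x j) n)) \<le> C)" if "j \<in> I" for j
    using bounded_inverse_qpoch[OF generic_nodes_qpoch_inf[OF assms that]] by metis
  then obtain D where D: "\<And>j. j \<in> I \<Longrightarrow> D j > 0" "\<And>j n. j \<in> I \<Longrightarrow> norm (inverse (R (q * x i / x j) n)) \<le> D j"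
    by metis
  obtain D1 where D1: "D1 > 0" "\<And>n. norm (inverse (R (c * x i) n)) \<le> D1"
    using bounded_inverse_qpoch assms unfolding generic_nodes_def by metis
  obtain D2 where D2: "D2 > 0" "\<And>n. norm (inverse (R (c' * x i) n)) \<le> D2"
    using bounded_inverse_qpoch assms unfolding generic_nodes_def by metis
  define F where "F = \<bar>E\<bar> * norm (x i) / norm q"
  have F: "F \<ge> 0" by (simp add: F_def)
  show ?thesis
  proof (rule that)
    show "0 \<le> (1 + F) * exp (F / (1 - norm q)) * ((\<Prod>j\<in>I. D j) * (D1 * D2))"
      using D D1 D2 F by (intro mult_nonneg_nonneg prod_nonneg) (auto intro: less_imp_le)
    fix e :: complex and s n assume e: "norm e \<le> E"
    have e1: "norm (e * x i / q) \<le> F"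
      using e unfolding F_def by (auto simp: norm_mult norm_divide intro!: divide_right_mono mult_right_mono)
    have "norm (1 - e * x i * q ^ (s + n) / q) \<le> 1 + norm (e * x i * q ^ (s + n) / q)"
      using norm_triangle_ineq4[of 1 "e * x i * q ^ (s + n) / q"] by simp
    also have "norm (e * x i * q ^ (s + n) / q) = norm (e * x i / q) * norm (q ^ (s + n))"
      by (simp add: norm_mult norm_divide)
    also have "\<dots> \<le> F * 1" by (intro mult_mono e1 norm_power_q_le_1 F) auto
    finally have 1: "norm (1 - e * x i * q ^ (s + n) / q) \<le> 1 + F" by simp
    have "norm (kfac I x c c' e s i n) = norm (1 - e * x i * q ^ (s + n) / q) * norm (R (e * x i / q) s)
       * ((\<Prod>j\<in>I. norm (inverse (R (q * x i / x j) n)))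
         * (norm (inverse (R (c * x i) n)) * norm (inverse (R (c' * x i) n))))"
    proof -
      have "(\<Prod>j\<in>I. norm (inverse (R (q * x i / x j) n))) = inverse (norm (\<Prod>j\<in>I. R (q * x i / x j) n))"
        using prod_inversef[of "\<lambda>j. norm (R (q * x i / x j) n)" I] by (simp add: norm_inverse prod_norm o_def)
      then show ?thesis
        unfolding kfac_def by (simp add: norm_mult norm_divide norm_inverse divide_inverse)
    qed
    also have "\<dots> \<le> (1 + F) * exp (F / (1 - norm q)) * ((\<Prod>j\<in>I. D j) * (D1 * D2))"
      using D D1 D2 F 1 e1
      by (intro mult_mono prod_mono norm_qpoch_le conjI mult_nonneg_nonneg prod_nonneg)
         (auto intro: less_imp_le)
    finally show "norm (kfac I x c c' e s i n) \<le> (1 + F) * exp (F / (1 - norm q)) * ((\<Prod>j\<in>I. D j) * (D1 * D2))" .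
  qed
qed

lemma vdm_ratio_bounded:
  assumes "generic_nodes I x c c'"
  obtains C where "C \<ge> 0" "\<And>l. norm (vdm_ratio I x l) \<le> C"
proof (rule that)
  show "0 \<le> (\<Prod>(i, j)\<in>pairs I. (norm (x i) + norm (x j)) / norm (x i - x j))"
    by (intro prod_nonneg) auto
  fix l
  have "norm (vdm_ratio I x l) = (\<Prod>p\<in>pairs I. norm (x (fst p) * q ^ l (fst p) - x (snd p) * q ^ l (snd p)) / norm (x (fst p) - x (snd p)))"
    by (simp add: vdm_ratio_def prod_norm norm_divide case_prod_unfold flip: prod_norm)
  also have "\<dots> \<le> (\<Prod>p\<in>pairs I. (norm (x (fst p)) + norm (x (snd p))) / norm (x (fst p) - x (snd p)))"
  proof (intro prod_mono conjI divide_right_mono)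
    fix p
    have "norm (x (fst p) * q ^ l (fst p) - x (snd p) * q ^ l (snd p))
      \<le> norm (x (fst p) * q ^ l (fst p)) + norm (x (snd p) * q ^ l (snd p))"
      by (rule norm_triangle_ineq4)
    also have "\<dots> \<le> norm (x (fst p)) * 1 + norm (x (snd p)) * 1"
      unfolding norm_mult by (intro add_mono mult_left_mono norm_power_q_le_1) auto
    finally show "norm (x (fst p) * q ^ l (fst p) - x (snd p) * q ^ l (snd p)) \<le> norm (x (fst p)) + norm (x (snd p))"
      by simp
  qed auto
  finally show "norm (vdm_ratio I x l) \<le> (\<Prod>(i, j)\<in>pairs I. (norm (x i) + norm (x j)) / norm (x i - x j))"
    by (simp add: case_prod_unfold)
qed

text \<open>All factors are uniformly bounded except the power of
  \<open>c * c' / (\<Prod>i\<in>I. x i)\<close> and the \<open>qmono\<close>, which contribute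
  \<open>r j ^ l i\<close>. One constant serves a whole polydisc of \<open>b\<close> and
  \<open>B\<close>.\<close>

lemma kterm_bounded:
  assumes gen: "generic_nodes I x c c'" and J: "finite J" and r: "\<And>j. j \<in> J \<Longrightarrow> r j > 0"
  obtains C where "C \<ge> 0" "\<And>b B l. norm B \<le> rB \<Longrightarrow> (\<And>j. j \<in> J \<Longrightarrow> norm (b j) \<le> r j) \<Longrightarrow>
     norm (kterm I x J b B c c' l) \<le> C * (norm (c * c' / (\<Prod>i\<in>I. x i)) * (\<Prod>j\<in>J. r j)) ^ sum l I"
proof -
  have fin: "finite I" using gen by (simp add: generic_nodes_def)
  define E where "E = norm (c * c') * rB"
  have "\<exists>C. C \<ge> 0 \<and> (\<forall>e s n. norm e \<le> E \<longrightarrow> norm (kfac I x c c' e s i n) \<le> C)" if "i \<in> I" for i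
    using kfac_bounded[OF gen that, of E] by metis
  then obtain D where D: "\<And>i. i \<in> I \<Longrightarrow> D i \<ge> 0"
    "\<And>i e s n. i \<in> I \<Longrightarrow> norm e \<le> E \<Longrightarrow> norm (kfac I x c c' e s i n) \<le> D i"
    by metis
  obtain V where V: "V \<ge> 0" "\<And>l. norm (vdm_ratio I x l) \<le> V"
    using vdm_ratio_bounded[OF gen] by metis
  define K where "K = (\<lambda>j. exp (E * r j / (1 - norm q)) * (\<Prod>i\<in>I. exp (norm (x i) / r j / (1 - norm q))))"
  define C where "C = V * (\<Prod>i\<in>I. D i)
     * (exp (norm c * rB / (1 - norm q)) * exp (norm c' * rB / (1 - norm q))) * (\<Prod>j\<in>J. K j)"
  have K: "K j \<ge> 0" for j unfolding K_def by (intro mult_nonneg_nonneg prod_nonneg) auto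
  show ?thesis
  proof (rule that)
    show "C \<ge> 0" unfolding C_def using V D K by (intro mult_nonneg_nonneg prod_nonneg) auto
    fix b :: "_ \<Rightarrow> complex" and B :: complex and l :: "nat \<Rightarrow> nat" assume B: "norm B \<le> rB" and b: "\<And>j. j \<in> J \<Longrightarrow> norm (b j) \<le> r j"
    define s where "s = sum l I"
    have e: "norm (c * c' * B) \<le> E" unfolding E_def norm_mult using B by (intro mult_left_mono) auto
    have E0: "E \<ge> 0" using e norm_ge_zero order_trans by blast
    have Jb: "norm (P (c * c' * B * b j * q ^ s) * (\<Prod>i\<in>I. qmono (b j) (x i) (l i))) \<le> K j * r j ^ s"
      if j: "j \<in> J" for j
    proof -
      have "norm (c * c' * B * b j) \<le> E * r j"
        unfolding norm_mult[of _ "b j"] using e b[OF j] E0 by (intro mult_mono) auto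
      then have 1: "norm (P (c * c' * B * b j * q ^ s)) \<le> exp (E * r j / (1 - norm q))"
        by (rule norm_qpoch_inf_power_le)
      have "norm (\<Prod>i\<in>I. qmono (b j) (x i) (l i)) = (\<Prod>i\<in>I. norm (qmono (b j) (x i) (l i)))"
        by (simp add: prod_norm)
      also have "\<dots> \<le> (\<Prod>i\<in>I. r j ^ l i * exp (norm (x i) / r j / (1 - norm q)))"
        using r[OF j] b[OF j] by (intro prod_mono conjI norm_qmono_le) auto
      also have "\<dots> = r j ^ s * (\<Prod>i\<in>I. exp (norm (x i) / r j / (1 - norm q)))"
        by (simp add: prod.distrib power_sum s_def)
      finally have 2: "norm (\<Prod>i\<in>I. qmono (b j) (x i) (l i)) \<le> \<dots>" .
      show ?thesis
        unfolding norm_mult K_def using mult_mono[OF 1 2] by (simp add: mult_ac)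
    qed
    have B1: "norm (R (c * B) s) \<le> exp (norm c * rB / (1 - norm q))"
         and B2: "norm (R (c' * B) s) \<le> exp (norm c' * rB / (1 - norm q))"
      by (intro norm_qpoch_le; simp add: norm_mult mult_left_mono B)+
    have "norm (kterm I x J b B c c' l) = norm (c * c' / (\<Prod>i\<in>I. x i)) ^ s * norm (vdm_ratio I x l)
       * (\<Prod>i\<in>I. norm (kfac I x c c' (c * c' * B) s i (l i)))
       * (norm (R (c * B) s) * norm (R (c' * B) s))
       * (\<Prod>j\<in>J. norm (P (c * c' * B * b j * q ^ s) * (\<Prod>i\<in>I. qmono (b j) (x i) (l i))))"
      unfolding kterm_def s_def[symmetric] prod_norm by (simp only: norm_mult norm_power)
    also have "\<dots> \<le> norm (c * c' / (\<Prod>i\<in>I. x i)) ^ s * V * (\<Prod>i\<in>I. D i)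
       * (exp (norm c * rB / (1 - norm q)) * exp (norm c' * rB / (1 - norm q))) * (\<Prod>j\<in>J. K j * r j ^ s)"
      using V D B1 B2 Jb e
      by (intro mult_mono prod_mono conjI mult_nonneg_nonneg prod_nonneg mult_left_mono) auto
    also have "\<dots> = C * (norm (c * c' / (\<Prod>i\<in>I. x i)) * (\<Prod>j\<in>J. r j)) ^ s"
      by (simp add: C_def prod.distrib power_mult_distrib prod_power_distrib mult_ac)
    finally show "norm (kterm I x J b B c c' l) \<le> C * (norm (c * c' / (\<Prod>i\<in>I. x i)) * (\<Prod>j\<in>J. r j)) ^ sum l I"
      unfolding s_def .
  qed
qed

text \<open>The bound for \<open>qmono\<close> needs a positive radius even where
  \<open>b j = 0\<close>, and holomorphy needs a neighbourhood. Both are gained by enlarging all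
  radii slightly while the geometric ratio stays below 1.\<close>

lemma radius_enlarge:
  fixes z :: complex and b :: "'j \<Rightarrow> complex"
  assumes "finite J" "norm (z * (\<Prod>j\<in>J. b j)) < 1"
  obtains \<epsilon> where "\<epsilon> > 0" "norm z * (\<Prod>j\<in>J. norm (b j) + \<epsilon>) < 1"
proof -
  have lt: "norm z * (\<Prod>j\<in>J. norm (b j) + 0) < 1"
    using assms(2) by (simp add: norm_mult flip: prod_norm)
  have "((\<lambda>t. norm z * (\<Prod>j\<in>J. norm (b j) + t)) \<longlongrightarrow> norm z * (\<Prod>j\<in>J. norm (b j) + 0)) (at_right 0)"
    by (intro tendsto_intros)
  then have "eventually (\<lambda>t. norm z * (\<Prod>j\<in>J. norm (b j) + t) < 1) (at_right 0)"
    using lt by (rule order_tendstoD(2))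
  moreover have "eventually (\<lambda>t::real. t > 0) (at_right 0)" by (rule eventually_at_right_less)
  ultimately have "eventually (\<lambda>t. t > 0 \<and> norm z * (\<Prod>j\<in>J. norm (b j) + t) < 1) (at_right 0)"
    by (rule eventually_conj[rotated])
  then show ?thesis using that eventually_happens'[of "at_right (0::real)"] by force
qed

lemma kterm_abs_summable:
  assumes gen: "generic_nodes I x c c'" and J: "finite J"
    and lt: "norm (c * c' / (\<Prod>i\<in>I. x i) * (\<Prod>j\<in>J. b j)) < 1"
  shows "(\<lambda>l. norm (kterm I x J b B c c' l)) summable_on (I \<rightarrow>\<^sub>E UNIV)"
proof -
  have fin: "finite I" using gen by (simp add: generic_nodes_def)
  obtain \<epsilon> where eps: "\<epsilon> > 0" "norm (c * c' / (\<Prod>i\<in>I. x i)) * (\<Prod>j\<in>J. norm (b j) + \<epsilon>) < 1"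
    using radius_enlarge[OF J lt] by metis
  obtain C where "\<And>l. norm (kterm I x J b B c c' l)
      \<le> C * (norm (c * c' / (\<Prod>i\<in>I. x i)) * (\<Prod>j\<in>J. norm (b j) + \<epsilon>)) ^ sum l I"
    using kterm_bounded[OF gen J, of "\<lambda>j. norm (b j) + \<epsilon>" "norm B"] eps
    by (metis add_nonneg_pos less_add_same_cancel1 less_imp_le norm_ge_zero order_refl)
  then show ?thesis
    using eps by (intro Infinite_Sum.abs_summable_on_comparison_test'[OF summable_on_cmult_right[OF summable_power_sum_PiE[OF fin]]])
      (auto intro!: mult_nonneg_nonneg prod_nonneg)
qed

lemma holomorphic_kfac:
  "f holomorphic_on S \<Longrightarrow> (\<lambda>w. kfac I x c c' (f w) s i n) holomorphic_on S"
  unfolding kfac_def divide_inverse by (intro holomorphic_intros)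

lemma holomorphic_kterm:
  assumes "\<And>j. j \<in> J \<Longrightarrow> (\<lambda>w. \<beta> w j) holomorphic_on S" "f holomorphic_on S"
  shows "(\<lambda>w. kterm I x J (\<beta> w) (f w) c c' l) holomorphic_on S"
  unfolding kterm_def qmono_def using assms
  by (intro holomorphic_on_mult holomorphic_on_const holomorphic_on_prod holomorphic_kfac
        holomorphic_qpoch holomorphic_qpoch_inf holomorphic_on_diff) auto

lemma holomorphic_kseries:
  assumes gen: "generic_nodes I x c c'" and J: "finite J" and S: "open S"
    and \<beta>: "\<And>j. j \<in> J \<Longrightarrow> (\<lambda>w. \<beta> w j) holomorphic_on S" and f: "f holomorphic_on S"
    and lt: "\<And>w. w \<in> S \<Longrightarrow> norm (c * c' / (\<Prod>i\<in>I. x i) * (\<Prod>j\<in>J. \<beta> w j)) < 1"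
  shows "(\<lambda>w. kseries I x J (\<beta> w) (f w) c c') holomorphic_on S"
  unfolding kseries_def
proof (rule holomorphic_infsum[OF S])
  fix l show "(\<lambda>w. kterm I x J (\<beta> w) (f w) c c' l) holomorphic_on S"
    by (rule holomorphic_kterm[OF \<beta> f])
next
  fix z assume z: "z \<in> S"
  have fin: "finite I" using gen by (simp add: generic_nodes_def)
  obtain \<epsilon> where eps: "\<epsilon> > 0" "norm (c * c' / (\<Prod>i\<in>I. x i)) * (\<Prod>j\<in>J. norm (\<beta> z j) + \<epsilon>) < 1"
    using radius_enlarge[OF J lt[OF z]] by metis
  obtain d1 where d1: "d1 > 0" "\<And>w j. w \<in> S \<inter> ball z d1 \<Longrightarrow> j \<in> J \<Longrightarrow> norm (\<beta> w j) \<le> norm (\<beta> z j) + \<epsilon>"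
    using local_bound_continuous[of J S "\<lambda>j w. \<beta> w j" z \<epsilon>] \<beta> z J eps(1)
      holomorphic_on_imp_continuous_on by metis
  obtain d2 where d2: "d2 > 0" "\<And>w. w \<in> S \<inter> ball z d2 \<Longrightarrow> norm (f w) \<le> norm (f z) + 1"
    using local_bound_continuous[of "{()}" S "\<lambda>j. f" z 1] f z holomorphic_on_imp_continuous_on by auto
  have pos: "norm (\<beta> z j) + \<epsilon> > 0" for j using eps(1) by (simp add: add_nonneg_pos)
  obtain C where C: "\<And>b B l. norm B \<le> norm (f z) + 1 \<Longrightarrow> (\<And>j. j \<in> J \<Longrightarrow> norm (b j) \<le> norm (\<beta> z j) + \<epsilon>) \<Longrightarrow>
     norm (kterm I x J b B c c' l)
      \<le> C * (norm (c * c' / (\<Prod>i\<in>I. x i)) * (\<Prod>j\<in>J. norm (\<beta> z j) + \<epsilon>)) ^ sum l I"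
    using kterm_bounded[OF gen J, of "\<lambda>j. norm (\<beta> z j) + \<epsilon>" "norm (f z) + 1"] pos by metis
  show "\<exists>d M. 0 < d \<and> M summable_on (I \<rightarrow>\<^sub>E UNIV) \<and>
      (\<forall>l\<in>I \<rightarrow>\<^sub>E UNIV. \<forall>w\<in>S \<inter> ball z d. norm (kterm I x J (\<beta> w) (f w) c c' l) \<le> M l)"
  proof (intro exI conjI ballI)
    show "min d1 d2 > 0" using d1 d2 by simp
    fix l w assume "w \<in> S \<inter> ball z (min d1 d2)"
    then show "norm (kterm I x J (\<beta> w) (f w) c c' l)
       \<le> C * (norm (c * c' / (\<Prod>i\<in>I. x i)) * (\<Prod>j\<in>J. norm (\<beta> z j) + \<epsilon>)) ^ sum l I"
      using d1(2) d2(2) by (intro C) auto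
  next
    show "(\<lambda>l. C * (norm (c * c' / (\<Prod>i\<in>I. x i)) * (\<Prod>j\<in>J. norm (\<beta> z j) + \<epsilon>)) ^ sum l I)
        summable_on (I \<rightarrow>\<^sub>E UNIV)"
    proof (intro summable_on_cmult_right summable_power_sum_PiE fin)
      show "0 \<le> norm (c * c' / (\<Prod>i\<in>I. x i)) * (\<Prod>j\<in>J. norm (\<beta> z j) + \<epsilon>)"
        using pos by (intro mult_nonneg_nonneg prod_nonneg) (auto intro: less_imp_le)
    qed (rule eps(2))
  qed
qed

end

subsection \<open>The contiguous relation\<close>

lemma sum_fun_upd_Suc:
  assumes "finite I" "i \<in> I"
  shows "sum (m(i := Suc (m i))) I = Suc (sum m I)"
proof -
  have "sum (m(i := Suc (m i))) I = Suc (m i) + sum (m(i := Suc (m i))) (I - {i})"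
    using sum.remove[OF assms, of "m(i := Suc (m i))"] by simp
  also have "sum (m(i := Suc (m i))) (I - {i}) = sum m (I - {i})" by (rule sum.cong) auto
  also have "Suc (m i) + sum m (I - {i}) = Suc (m i + sum m (I - {i}))" by simp
  also have "m i + sum m (I - {i}) = sum m I" by (rule sum.remove[OF assms, symmetric])
  finally show ?thesis .
qed

text \<open>\<open>y\<close> lists the nodes that move with the multi-index, \<open>S\<close> the
  few others; the two groups acquire different meanings in the telescoping.\<close>

lemma sum_Lagrange_zero_split:
  fixes p :: "'a :: field poly"
  assumes "finite S" "finite I" "inj_on y I" "S \<inter> y ` I = {}" "degree p + 2 \<le> card S + card I"
  shows "(\<Sum>t\<in>S. poly p t / ((\<Prod>u\<in>S - {t}. t - u) * (\<Prod>i\<in>I. t - y i)))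
       + (\<Sum>i\<in>I. poly p (y i) / ((\<Prod>u\<in>S. y i - u) * (\<Prod>k\<in>I - {i}. y i - y k))) = 0"
proof -
  have "(\<Sum>t\<in>S \<union> y ` I. poly p t / (\<Prod>u\<in>(S \<union> y ` I) - {t}. t - u)) = 0"
    using assms by (intro sum_Lagrange_zero) (auto simp: card_Un_disjoint card_image)
  also have "(\<Sum>t\<in>S \<union> y ` I. poly p t / (\<Prod>u\<in>(S \<union> y ` I) - {t}. t - u))
     = (\<Sum>t\<in>S. poly p t / (\<Prod>u\<in>(S \<union> y ` I) - {t}. t - u))
       + (\<Sum>t\<in>y ` I. poly p t / (\<Prod>u\<in>(S \<union> y ` I) - {t}. t - u))"
    using assms by (intro sum.union_disjoint) auto
  also have "(\<Sum>t\<in>S. poly p t / (\<Prod>u\<in>(S \<union> y ` I) - {t}. t - u))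
     = (\<Sum>t\<in>S. poly p t / ((\<Prod>u\<in>S - {t}. t - u) * (\<Prod>i\<in>I. t - y i)))"
  proof (rule sum.cong[OF refl])
    fix t assume t: "t \<in> S"
    then have "(S \<union> y ` I) - {t} = (S - {t}) \<union> y ` I" using assms(4) by auto
    moreover have "(\<Prod>u\<in>(S - {t}) \<union> y ` I. t - u) = (\<Prod>u\<in>S - {t}. t - u) * (\<Prod>u\<in>y ` I. t - u)"
      using assms by (intro prod.union_disjoint) auto
    moreover have "(\<Prod>u\<in>y ` I. t - u) = (\<Prod>i\<in>I. t - y i)"
      by (simp add: prod.reindex[OF assms(3)])
    ultimately show "poly p t / (\<Prod>u\<in>(S \<union> y ` I) - {t}. t - u)
      = poly p t / ((\<Prod>u\<in>S - {t}. t - u) * (\<Prod>i\<in>I. t - y i))" by simp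
  qed
  also have "(\<Sum>t\<in>y ` I. poly p t / (\<Prod>u\<in>(S \<union> y ` I) - {t}. t - u))
     = (\<Sum>i\<in>I. poly p (y i) / (\<Prod>u\<in>(S \<union> y ` I) - {y i}. y i - u))"
    by (simp add: sum.reindex[OF assms(3)])
  also have "\<dots> = (\<Sum>i\<in>I. poly p (y i) / ((\<Prod>u\<in>S. y i - u) * (\<Prod>k\<in>I - {i}. y i - y k)))"
  proof (rule sum.cong[OF refl])
    fix i assume i: "i \<in> I"
    have "(S \<union> y ` I) - {y i} = S \<union> y ` (I - {i})"
      using assms(3,4) i by (auto simp: inj_on_def)
    moreover have "(\<Prod>u\<in>S \<union> y ` (I - {i}). y i - u) = (\<Prod>u\<in>S. y i - u) * (\<Prod>u\<in>y ` (I - {i}). y i - u)"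
      using assms by (intro prod.union_disjoint) auto
    moreover have "(\<Prod>u\<in>y ` (I - {i}). y i - u) = (\<Prod>k\<in>I - {i}. y i - y k)"
      by (subst prod.reindex) (auto intro: inj_on_subset[OF assms(3)])
    ultimately show "poly p (y i) / (\<Prod>u\<in>(S \<union> y ` I) - {y i}. y i - u)
      = poly p (y i) / ((\<Prod>u\<in>S. y i - u) * (\<Prod>k\<in>I - {i}. y i - y k))" by simp
  qed
  finally show ?thesis .
qed

section \<open>Ratios of neighbouring terms\<close>

context q_disc
begin

text \<open>Up to a power of \<open>q\<close>, replacing \<open>b\<close> by \<open>q * b\<close>
  moves the product by one place, so that only the two end factors differ.\<close>

lemma qmono_shift: "(b - y * q ^ l / q) * qmono (q * b) y l = q ^ l * ((b - y / q) * qmono b y l)"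
proof -
  have "qmono (q * b) y l = (\<Prod>k<l. q * (b - y * q ^ k / q))"
    unfolding qmono_def using q_nz by (intro prod.cong) (auto simp: field_simps)
  then have 1: "qmono (q * b) y l = q ^ l * (\<Prod>k<l. b - y * q ^ k / q)"
    by (simp add: prod.distrib)
  have "(\<Prod>k<l. b - y * q ^ k / q) * (b - y * q ^ l / q) = (\<Prod>k<Suc l. b - y * q ^ k / q)"
    by simp
  also have "\<dots> = (b - y / q) * qmono b y l"
    unfolding qmono_def using q_nz by (subst prod.lessThan_Suc_shift) simp
  finally show ?thesis unfolding 1 by (metis (no_types, lifting) mult.assoc mult.commute)
qed

lemma prod_fun_upd_mult:
  fixes f :: "complex \<Rightarrow> complex"
  assumes "finite J" "j \<in> J" "f y = f (b j) * r"
  shows "(\<Prod>k\<in>J. f ((b(j := y)) k)) = (\<Prod>k\<in>J. f (b k)) * r"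
proof -
  have "(\<Prod>k\<in>J. f ((b(j := y)) k)) = f y * (\<Prod>k\<in>J - {j}. f (b k))"
    by (rule prod_fun_upd[OF assms(1,2)])
  also have "\<dots> = (f (b j) * (\<Prod>k\<in>J - {j}. f (b k))) * r"
    unfolding assms(3) by (simp only: mult_ac)
  also have "f (b j) * (\<Prod>k\<in>J - {j}. f (b k)) = (\<Prod>k\<in>J. f (b k))"
    by (rule prod.remove[OF assms(1,2), symmetric])
  finally show ?thesis .
qed

text \<open>As a function of \<open>b j\<close> the ratio is rational with poles at the points
  \<open>x i * q ^ l i / q\<close> and at the zero of
  \<open>1 - c * c' * B * b j * q ^ sum l I\<close>: these factors will be read as differences of
  interpolation nodes.\<close>

lemma kterm_shift:
  assumes J: "finite J" "j \<in> J"
    and nz: "1 - c * c' * B * b j * q ^ sum l I \<noteq> 0" "\<And>i. i \<in> I \<Longrightarrow> b j - x i * q ^ l i / q \<noteq> 0"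
  shows "kterm I x J (b(j := q * b j)) B c c' l
    = q ^ sum l I * kterm I x J b B c c' l
      * ((\<Prod>i\<in>I. (b j - x i / q) / (b j - x i * q ^ l i / q)) / (1 - c * c' * B * b j * q ^ sum l I))"
proof -
  define s where "s = sum l I"
  define f where "f = (\<lambda>y. P (c * c' * B * y * q ^ s) * (\<Prod>i\<in>I. qmono y (x i) (l i)))"
  define r where "r = q ^ s * ((\<Prod>i\<in>I. (b j - x i / q) / (b j - x i * q ^ l i / q)) / (1 - c * c' * B * b j * q ^ s))"
  have 1: "P (c * c' * B * (q * b j) * q ^ s) = P (c * c' * B * b j * q ^ s) / (1 - c * c' * B * b j * q ^ s)"
    using qpoch_inf_step[of "c * c' * B * b j * q ^ s"] nz(1) unfolding s_def by (simp add: mult_ac)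
  have "(\<Prod>i\<in>I. qmono (q * b j) (x i) (l i))
     = (\<Prod>i\<in>I. q ^ l i * qmono (b j) (x i) (l i) * ((b j - x i / q) / (b j - x i * q ^ l i / q)))"
  proof (rule prod.cong[OF refl])
    fix i assume "i \<in> I"
    then have "b j - x i * q ^ l i / q \<noteq> 0" by (rule nz(2))
    then show "qmono (q * b j) (x i) (l i)
      = q ^ l i * qmono (b j) (x i) (l i) * ((b j - x i / q) / (b j - x i * q ^ l i / q))"
      using qmono_shift[of "b j" "x i" "l i"] by (simp add: nonzero_eq_divide_eq mult_ac)
  qed
  also have "\<dots> = q ^ s * (\<Prod>i\<in>I. qmono (b j) (x i) (l i)) * (\<Prod>i\<in>I. (b j - x i / q) / (b j - x i * q ^ l i / q))"
    by (simp only: prod.distrib power_sum s_def)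
  finally have 2: "(\<Prod>i\<in>I. qmono (q * b j) (x i) (l i)) = \<dots>" .
  have "f (q * b j) = f (b j) * r"
    unfolding f_def r_def 1 2 by simp
  then have "(\<Prod>k\<in>J. f ((b(j := q * b j)) k)) = (\<Prod>k\<in>J. f (b k)) * r"
    by (rule prod_fun_upd_mult[OF J])
  then show ?thesis
    unfolding kterm_def s_def[symmetric] f_def r_def by simp
qed

lemma kfac_Suc_degree:
  assumes "1 - e * x i * q ^ (s + n) / q \<noteq> 0"
  shows "kfac I x c c' e (Suc s) i n
    = kfac I x c c' e s i n * ((1 - e * x i * q ^ s / q) / (1 - e * (x i * q ^ n) * q ^ s / q) * (1 - e * (x i * q ^ n) * q ^ s))"
proof -
  have 1: "e * x i * q ^ (Suc s + n) / q = e * (x i * q ^ n) * q ^ s" using q_nz by (simp add: power_add mult_ac)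
  have 2: "e * x i * q ^ (s + n) / q = e * (x i * q ^ n) * q ^ s / q" by (simp add: power_add mult_ac)
  have 3: "R (e * x i / q) (Suc s) = R (e * x i / q) s * (1 - e * x i * q ^ s / q)"
    by (simp add: qpoch_Suc)
  have nz: "1 - e * (x i * q ^ n) * q ^ s / q \<noteq> 0" using assms unfolding 2 .
  have "A * (Rs * h) / D = (h' * Rs / D) * (h / h' * A)" if "h' \<noteq> 0" for A Rs h D h' :: complex
    using that by simp
  from this[OF nz] show ?thesis unfolding kfac_def 1 2 3 .
qed

lemma kfac_Suc_arg:
  "kfac I x c c' e s i (Suc n) = (1 - e * x i * q ^ (s + Suc n) / q) * R (e * x i / q) s
     / ((\<Prod>j\<in>I. R (q * x i / x j) n) * (R (c * x i) n * R (c' * x i) n))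
     / ((\<Prod>j\<in>I. 1 - q * (x i * q ^ n) / x j) * ((1 - c * (x i * q ^ n)) * (1 - c' * (x i * q ^ n))))"
proof -
  have "(\<Prod>j\<in>I. R (q * x i / x j) (Suc n)) = (\<Prod>j\<in>I. R (q * x i / x j) n) * (\<Prod>j\<in>I. 1 - q * (x i * q ^ n) / x j)"
    by (simp add: qpoch_Suc prod.distrib mult_ac)
  then show ?thesis unfolding kfac_def by (simp add: qpoch_Suc mult_ac)
qed

lemma kfac_Suc_Suc:
  assumes "1 - e * x i * q ^ (s + n) / q \<noteq> 0"
  shows "kfac I x c c' e (Suc s) i (Suc n)
    = kfac I x c c' e s i n * ((1 - e * x i * q ^ s / q) / (1 - e * (x i * q ^ n) * q ^ s / q)
       * (1 - e * (x i * q ^ n) * q ^ Suc s)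
       / ((\<Prod>j\<in>I. 1 - q * (x i * q ^ n) / x j) * ((1 - c * (x i * q ^ n)) * (1 - c' * (x i * q ^ n)))))"
proof -
  have 1: "e * x i * q ^ (Suc s + Suc n) / q = e * (x i * q ^ n) * q ^ Suc s" using q_nz by (simp add: power_add mult_ac)
  have 2: "e * x i * q ^ (s + n) / q = e * (x i * q ^ n) * q ^ s / q" by (simp add: power_add mult_ac)
  have 3: "R (e * x i / q) (Suc s) = R (e * x i / q) s * (1 - e * x i * q ^ s / q)"
    by (simp add: qpoch_Suc)
  have nz: "1 - e * (x i * q ^ n) * q ^ s / q \<noteq> 0" using assms unfolding 2 .
  have "A * (Rs * h) / D / D' = (h' * Rs / D) * (h / h' * A / D')" if "h' \<noteq> 0" for A Rs h D h' D' :: complex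
    using that by simp
  from this[OF nz] show ?thesis unfolding kfac_Suc_arg 1 3 unfolding kfac_def 2 .
qed

lemma generic_nodes_neq:
  assumes "generic_nodes I x c c'" "i \<in> I" "k \<in> I" "i \<noteq> k"
  shows "x i * q ^ m \<noteq> x k * q ^ n"
  using assms unfolding generic_nodes_def by blast

lemma vdm_ratio_Suc:
  assumes gen: "generic_nodes I x c c'" and i: "i \<in> I"
  shows "vdm_ratio I x (m(i := Suc (m i)))
    = vdm_ratio I x m * (\<Prod>k\<in>I - {i}. (q * (x i * q ^ m i) - x k * q ^ m k) / (x i * q ^ m i - x k * q ^ m k))"
proof -
  have fin: "finite I" using gen by (simp add: generic_nodes_def)
  define m' where "m' = m(i := Suc (m i))"
  have "vdm_ratio (I - {i}) x m' = vdm_ratio (I - {i}) x m"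
    unfolding vdm_ratio_def by (rule prod.cong) (auto simp: pairs_def m'_def)
  moreover have "(\<Prod>k\<in>I - {i}. (x i * q ^ m' i - x k * q ^ m' k) / (x i - x k))
    = (\<Prod>k\<in>I - {i}. (x i * q ^ m i - x k * q ^ m k) / (x i - x k))
      * (\<Prod>k\<in>I - {i}. (q * (x i * q ^ m i) - x k * q ^ m k) / (x i * q ^ m i - x k * q ^ m k))"
    unfolding prod.distrib[symmetric]
  proof (rule prod.cong[OF refl])
    fix k assume k: "k \<in> I - {i}"
    then have nz: "x i * q ^ m i - x k * q ^ m k \<noteq> 0"
      using generic_nodes_neq[OF gen i, of k] by auto
    have "(x i * q ^ m' i - x k * q ^ m' k) = q * (x i * q ^ m i) - x k * q ^ m k"
      using k by (simp add: m'_def)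
    then show "(x i * q ^ m' i - x k * q ^ m' k) / (x i - x k)
      = (x i * q ^ m i - x k * q ^ m k) / (x i - x k)
        * ((q * (x i * q ^ m i) - x k * q ^ m k) / (x i * q ^ m i - x k * q ^ m k))"
      using nz by simp
  qed
  ultimately show ?thesis
    unfolding vdm_ratio_remove[OF fin i] m'_def by (simp add: mult_ac)
qed

lemma qmono_Suc: "qmono b y (Suc n) = qmono b y n * (b - y * q ^ n)"
  by (simp add: qmono_def)

text \<open>Raising \<open>m i\<close> also raises the total degree, so the factors of every
  \<open>k \<in> I\<close> change; the component \<open>i\<close> itself is special in moving by two
  powers of \<open>q\<close>, hence \<open>q ^ Suc s\<close>.\<close>

lemma kterm_Suc:
  assumes gen: "generic_nodes I x c c'" and i: "i \<in> I" and J: "finite J"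
    and nx: "\<And>k n. k \<in> I \<Longrightarrow> 1 - c * c' * B * x k * q ^ n / q \<noteq> 0"
    and nb: "\<And>j. j \<in> J \<Longrightarrow> 1 - c * c' * B * b j * q ^ sum m I \<noteq> 0"
  defines "e \<equiv> c * c' * B" and "X \<equiv> \<lambda>k. x k * q ^ m k" and "s \<equiv> sum m I"
  shows "kterm I x J b B c c' (m(i := Suc (m i))) = kterm I x J b B c c' m *
    (c * c' / (\<Prod>i\<in>I. x i)
     * (\<Prod>k\<in>I - {i}. (q * X i - X k) / (X i - X k))
     * ((\<Prod>k\<in>I. (1 - e * x k * q ^ s / q) / (1 - e * X k * q ^ s / q))
        * (\<Prod>k\<in>I - {i}. 1 - e * X k * q ^ s) * (1 - e * X i * q ^ Suc s)
        / ((\<Prod>k\<in>I. 1 - q * X i / x k) * ((1 - c * X i) * (1 - c' * X i))))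
     * ((1 - c * B * q ^ s) * (1 - c' * B * q ^ s))
     * (\<Prod>j\<in>J. (b j - X i) / (1 - e * b j * q ^ s)))"
proof -
  have fin: "finite I" using gen by (simp add: generic_nodes_def)
  define m' where "m' = m(i := Suc (m i))"
  have s': "sum m' I = Suc s"
    unfolding m'_def s_def by (rule sum_fun_upd_Suc[OF fin i])
  define h where "h = (\<lambda>k. (1 - e * x k * q ^ s / q) / (1 - e * X k * q ^ s / q))"
  define D where "D = (\<Prod>k\<in>I. 1 - q * X i / x k) * ((1 - c * X i) * (1 - c' * X i))"
  have V: "vdm_ratio I x m' = vdm_ratio I x m * (\<Prod>k\<in>I - {i}. (q * X i - X k) / (X i - X k))"
    unfolding m'_def X_def by (rule vdm_ratio_Suc[OF gen i])
  have N: "(\<Prod>k\<in>I. kfac I x c c' e (Suc s) k (m' k))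
     = (\<Prod>k\<in>I. kfac I x c c' e s k (m k)) * ((\<Prod>k\<in>I. h k) * (\<Prod>k\<in>I - {i}. 1 - e * X k * q ^ s) * (1 - e * X i * q ^ Suc s) / D)"
  proof -
    have "(\<Prod>k\<in>I. kfac I x c c' e (Suc s) k (m' k))
       = kfac I x c c' e (Suc s) i (Suc (m i)) * (\<Prod>k\<in>I - {i}. kfac I x c c' e (Suc s) k (m' k))"
      using prod.remove[OF fin i, of "\<lambda>k. kfac I x c c' e (Suc s) k (m' k)"] by (simp add: m'_def)
    also have "(\<Prod>k\<in>I - {i}. kfac I x c c' e (Suc s) k (m' k))
       = (\<Prod>k\<in>I - {i}. kfac I x c c' e s k (m k) * (h k * (1 - e * X k * q ^ s)))"
      unfolding h_def X_def
    proof (rule prod.cong[OF refl])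
      fix k assume k: "k \<in> I - {i}"
      then have "m' k = m k" by (simp add: m'_def)
      then show "kfac I x c c' e (Suc s) k (m' k) = kfac I x c c' e s k (m k)
          * ((1 - e * x k * q ^ s / q) / (1 - e * (x k * q ^ m k) * q ^ s / q) * (1 - e * (x k * q ^ m k) * q ^ s))"
        using kfac_Suc_degree[of e x k s "m k" I c c'] nx[of k "s + m k"] k by (simp add: e_def)
    qed
    also have "kfac I x c c' e (Suc s) i (Suc (m i)) = kfac I x c c' e s i (m i) * (h i * (1 - e * X i * q ^ Suc s) / D)"
      unfolding h_def D_def X_def using nx[of i "s + m i"] i by (intro kfac_Suc_Suc) (simp add: e_def)
    finally have "(\<Prod>k\<in>I. kfac I x c c' e (Suc s) k (m' k))
       = (kfac I x c c' e s i (m i) * (\<Prod>k\<in>I - {i}. kfac I x c c' e s k (m k)))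
         * ((h i * (\<Prod>k\<in>I - {i}. h k)) * (\<Prod>k\<in>I - {i}. 1 - e * X k * q ^ s) * (1 - e * X i * q ^ Suc s) / D)"
      unfolding prod.distrib by simp
    then show ?thesis
      unfolding prod.remove[OF fin i, of h] prod.remove[OF fin i, of "\<lambda>k. kfac I x c c' e s k (m k)"] .
  qed
  have BB: "R (c * B) (Suc s) * R (c' * B) (Suc s)
     = (R (c * B) s * R (c' * B) s) * ((1 - c * B * q ^ s) * (1 - c' * B * q ^ s))"
    by (simp add: qpoch_Suc)
  have Jp: "(\<Prod>j\<in>J. P (e * b j * q ^ Suc s) * (\<Prod>k\<in>I. qmono (b j) (x k) (m' k)))
     = (\<Prod>j\<in>J. P (e * b j * q ^ s) * (\<Prod>k\<in>I. qmono (b j) (x k) (m k)))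
       * (\<Prod>j\<in>J. (b j - X i) / (1 - e * b j * q ^ s))"
    unfolding prod.distrib[symmetric]
  proof (rule prod.cong[OF refl])
    fix j assume j: "j \<in> J"
    have 1: "P (e * b j * q ^ Suc s) = P (e * b j * q ^ s) / (1 - e * b j * q ^ s)"
      using qpoch_inf_step[of "e * b j * q ^ s"] nb[OF j] unfolding e_def s_def by (simp add: mult_ac)
    have "(\<Prod>k\<in>I. qmono (b j) (x k) (m' k)) = qmono (b j) (x i) (m' i) * (\<Prod>k\<in>I - {i}. qmono (b j) (x k) (m' k))"
      by (rule prod.remove[OF fin i])
    also have "(\<Prod>k\<in>I - {i}. qmono (b j) (x k) (m' k)) = (\<Prod>k\<in>I - {i}. qmono (b j) (x k) (m k))"
      by (rule prod.cong) (auto simp: m'_def)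
    also have "qmono (b j) (x i) (m' i) = qmono (b j) (x i) (m i) * (b j - X i)"
      by (simp add: m'_def qmono_Suc X_def)
    finally have 2: "(\<Prod>k\<in>I. qmono (b j) (x k) (m' k)) = (\<Prod>k\<in>I. qmono (b j) (x k) (m k)) * (b j - X i)"
      unfolding prod.remove[OF fin i, of "\<lambda>k. qmono (b j) (x k) (m k)"] by simp
    show "P (e * b j * q ^ Suc s) * (\<Prod>k\<in>I. qmono (b j) (x k) (m' k))
      = P (e * b j * q ^ s) * (\<Prod>k\<in>I. qmono (b j) (x k) (m k)) * ((b j - X i) / (1 - e * b j * q ^ s))"
      unfolding 1 2 by simp
  qed
  show ?thesis
    unfolding kterm_def m'_def[symmetric] s' e_def[symmetric] s_def[symmetric] V N BB Jp
    unfolding h_def D_def by simp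
qed

end

section \<open>Interpolation and telescoping for generic parameters\<close>

context q_disc
begin

text \<open>The two linear factors are the coefficients
  \<open>(1 - b j * c) * (1 - b j * c')\<close> of the contiguous relation, the others the
  numerators of \<open>kterm_shift\<close>. The degree is at most \<open>card I + 2\<close>, just
  small enough for the \<open>card I + 4\<close> nodes used.\<close>

definition kpoly :: "nat set \<Rightarrow> (nat \<Rightarrow> complex) \<Rightarrow> complex \<Rightarrow> complex \<Rightarrow> complex poly" where
  "kpoly I x c c' = [:1, - c:] * [:1, - c':] * (\<Prod>i\<in>I. [:- (x i / q), 1:])"

lemma poly_kpoly: "poly (kpoly I x c c') t = (1 - c * t) * (1 - c' * t) * (\<Prod>i\<in>I. t - x i / q)"
  unfolding kpoly_def poly_mult poly_prod by (simp add: mult_ac)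

lemma degree_kpoly:
  assumes "finite I"
  shows "degree (kpoly I x c c') \<le> card I + 2"
proof -
  have "degree (\<Prod>i\<in>I. [:- (x i / q), 1:]) \<le> (\<Sum>i\<in>I. degree [:- (x i / q), 1:])"
    using degree_prod_sum_le[OF assms, of "\<lambda>i. [:- (x i / q), 1:]"] by (simp add: o_def)
  then have 1: "degree (\<Prod>i\<in>I. [:- (x i / q), 1:]) \<le> card I" by simp
  have 2: "degree [:1, - c:] \<le> 1" "degree [:1, - c':] \<le> 1" by simp_all
  show ?thesis unfolding kpoly_def
    by (intro order.trans[OF degree_mult_le] order.trans[OF add_mono[OF order.trans[OF degree_mult_le add_mono[OF 2]] 1]]) simp
qed

lemma bounded_inverse_one_minus:
  assumes "\<And>n. 1 - u * q ^ n \<noteq> 0"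
  obtains C where "C > 0" "\<And>n. norm (inverse (1 - u * q ^ n)) \<le> C"
proof -
  have "(\<lambda>n. inverse (1 - u * q ^ n)) \<longlonglongrightarrow> inverse (1 - 0)"
    by (intro tendsto_intros power_q_LIMSEQ) simp
  then have "Bseq (\<lambda>n. inverse (1 - u * q ^ n))"
    by (intro convergent_imp_Bseq) (auto simp: convergent_def)
  then show ?thesis using that unfolding Bseq_def by blast
qed

end

text \<open>The distinctness of the three \<open>b j\<close> and the last three assumptions keep all
  interpolation nodes apart and the term ratios finite; \<open>B \<noteq> 0\<close> makes the node
  \<open>eta\<close> finite. Convergence is not part of the locale, since the pointwise identities
  hold without it.\<close>

locale generic_series = q_disc +
  fixes I :: "nat set" and x :: "nat \<Rightarrow> complex" and J :: "'j set" and b :: "'j \<Rightarrow> complex"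
    and B c c' :: complex and j1 j2 j3 :: 'j
  assumes gen: "generic_nodes I x c c'" and J: "finite J" "card J = card I + 2"
    and j: "j1 \<in> J" "j2 \<in> J" "j3 \<in> J" "j1 \<noteq> j2" "j2 \<noteq> j3" "j3 \<noteq> j1"
    and b_distinct: "b j1 \<noteq> b j2" "b j2 \<noteq> b j3" "b j3 \<noteq> b j1"
    and c: "c \<noteq> 0" "c' \<noteq> 0" and B: "B \<noteq> 0"
    and nx: "\<And>k n. k \<in> I \<Longrightarrow> 1 - c * c' * B * x k * q ^ n / q \<noteq> 0"
    and nb: "\<And>j n. j \<in> J \<Longrightarrow> 1 - c * c' * B * b j * q ^ n \<noteq> 0"
    and nbx: "\<And>j k n. j \<in> {j1, j2, j3} \<Longrightarrow> k \<in> I \<Longrightarrow> b j - x k * q ^ n / q \<noteq> 0"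
begin

definition e :: complex where "e = c * c' * B"
definition T :: "(nat \<Rightarrow> nat) \<Rightarrow> complex" where "T l = kterm I x J b B c c' l"
text \<open>The zero in \<open>t\<close> of \<open>1 - e * t * q ^ s\<close>, that is, the pole of
  the ratio in \<open>kterm_shift\<close> that depends on the degree only.\<close>

definition eta :: "nat \<Rightarrow> complex" where "eta s = 1 / (e * q ^ s)"

text \<open>
  The terms of the Lagrange interpolation formula for \<open>kpoly\<close> with nodes \<open>b j1\<close>, \<open>b j2\<close>, \<open>b j3\<close>,
  \<open>eta\<close> and \<open>x i * q ^ l i / q\<close>: the first three nodes give the \<open>l\<close>-th terms of the three shifted
  series, the remaining ones give \<open>YT\<close> and \<open>XT i\<close>.  Raising \<open>l i\<close> by one turns the \<open>XT i\<close> into the terms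
  of an interpolation formula for \<open>rpoly\<close> whose remaining node contributes \<open>- YT\<close>, so the sum telescopes.
\<close>

definition XT :: "nat \<Rightarrow> (nat \<Rightarrow> nat) \<Rightarrow> complex" where
  "XT i l = T l * poly (kpoly I x c c') (x i * q ^ l i / q)
     / ((x i * q ^ l i / q - b j1) * (x i * q ^ l i / q - b j2) * (x i * q ^ l i / q - b j3)
        * (x i * q ^ l i / q - eta (sum l I))
        * (\<Prod>k\<in>I - {i}. x i * q ^ l i / q - x k * q ^ l k / q))"

definition YT :: "(nat \<Rightarrow> nat) \<Rightarrow> complex" where
  "YT l = T l * poly (kpoly I x c c') (eta (sum l I))
     / ((eta (sum l I) - b j1) * (eta (sum l I) - b j2) * (eta (sum l I) - b j3)
        * (\<Prod>k\<in>I. eta (sum l I) - x k * q ^ l k / q))"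

lemma fin: "finite I"
  using gen by (simp add: generic_nodes_def)

lemma e_nz: "e \<noteq> 0"
  using c B by (simp add: e_def)

lemma eta_nz: "eta s \<noteq> 0"
  using e_nz q_nz by (simp add: eta_def)

lemma e_eta: "e * q ^ s = 1 / eta s"
  using e_nz q_nz by (simp add: eta_def)

lemma one_minus_eta: "1 - e * t * q ^ s = - (e * q ^ s) * (t - eta s)"
  using e_nz q_nz by (simp add: eta_def field_simps)

lemma eta_neq_node: "x k * q ^ n / q \<noteq> eta s" if "k \<in> I"
proof -
  have "1 - e * (x k * q ^ n / q) * q ^ s \<noteq> 0"
    using nx[OF that, of "n + s"] by (simp add: e_def power_add mult_ac)
  then show ?thesis unfolding one_minus_eta by auto
qed

lemma eta_neq_node': "x k * q ^ n \<noteq> eta s" if "k \<in> I"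
  using eta_neq_node[OF that, of "Suc n" s] q_nz by (simp add: mult_ac)

lemma eta_neq_b: "b j \<noteq> eta s" if "j \<in> J"
  using nb[OF that, of s] one_minus_eta[of "b j" s] by (auto simp: e_def)

lemma J_split: "J = insert j1 (insert j2 (insert j3 (J - {j1, j2, j3})))"
  using j by auto

lemma prod_J_split: "(\<Prod>j\<in>J. f j) = f j1 * f j2 * f j3 * (\<Prod>j\<in>J - {j1, j2, j3}. f j)" for f :: "'j \<Rightarrow> complex"
  by (subst J_split) (use j J in \<open>simp add: mult_ac\<close>)

lemma card_I_pos: "card I \<ge> 1"
proof -
  have "card {j1, j2, j3} \<le> card J" using j J by (intro card_mono) auto
  then show ?thesis using j J by simp
qed

text \<open>Its degree is \<open>card J - 3 = card I - 1\<close>, the largest for which Lagrange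
  interpolation at the \<open>card I + 1\<close> nodes \<open>X i\<close> and \<open>eta s\<close>
  still gives zero. This is where \<open>card J = card I + 2\<close> is decisive.\<close>

definition rpoly :: "complex poly" where "rpoly = (\<Prod>j\<in>J - {j1, j2, j3}. [:b j, - 1:])"

lemma poly_rpoly: "poly rpoly t = (\<Prod>j\<in>J - {j1, j2, j3}. b j - t)"
  by (simp add: rpoly_def poly_prod)

lemma degree_rpoly: "degree rpoly + 2 \<le> card I + 1"
proof -
  have "degree rpoly \<le> (\<Sum>j\<in>J - {j1, j2, j3}. degree [:b j, - 1:])"
    unfolding rpoly_def using degree_prod_sum_le[of "J - {j1, j2, j3}" "\<lambda>j. [:b j, - 1:]"] J by (simp add: o_def)
  also have "\<dots> = card (J - {j1, j2, j3})" by simp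
  also have "\<dots> = card I + 2 - 3"
    using j J by (subst card_Diff_subset) auto
  finally show ?thesis using card_I_pos by simp
qed

text \<open>\<open>H\<close>, \<open>U\<close>, \<open>BB\<close> and \<open>W\<close> do not depend
  on which component of \<open>m\<close> is raised, so they can be taken out of the sum over
  \<open>i\<close>.\<close>

context
  fixes m :: "nat \<Rightarrow> nat" and s :: nat and X :: "nat \<Rightarrow> complex" and H U BB W :: complex
  defines "s \<equiv> sum m I" and "X \<equiv> \<lambda>k. x k * q ^ m k"
    and "H \<equiv> \<Prod>k\<in>I. (1 - e * x k * q ^ sum m I / q) / (1 - e * (x k * q ^ m k) * q ^ sum m I / q)"
    and "U \<equiv> \<Prod>k\<in>I. 1 - e * (x k * q ^ m k) * q ^ sum m I"
    and "BB \<equiv> (1 - c * B * q ^ sum m I) * (1 - c' * B * q ^ sum m I)"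
    and "W \<equiv> \<Prod>j\<in>J. 1 - e * b j * q ^ sum m I"
begin

text \<open>At the raised index the node of \<open>i\<close> is \<open>X i\<close>, without the
  division by \<open>q\<close>. There \<open>kpoly\<close> cancels the new denominators of
  \<open>kfac\<close>, three of the factors \<open>b j - X i\<close> cancel and leave
  \<open>rpoly\<close>, and the factor \<open>1 - e * X i * q ^ Suc s\<close> removes the node
  \<open>eta (Suc s)\<close>. Completing the product over \<open>I - {i}\<close> to \<open>U\<close>
  brings in \<open>eta s\<close> instead.\<close>

lemma XT_Suc:
  assumes i: "i \<in> I"
  shows "XT i (m(i := Suc (m i))) = T m * (c * c' * (-1) ^ Suc (card I) * H * U * BB / W)
     * (poly rpoly (X i) / ((\<Prod>u\<in>{eta s}. X i - u) * (\<Prod>k\<in>I - {i}. X i - X k)))"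
proof -
  define m' where "m' = m(i := Suc (m i))"
  have s': "sum m' I = Suc s"
    unfolding m'_def s_def by (rule sum_fun_upd_Suc[OF fin i])
  have yi: "x i * q ^ m' i / q = X i" using q_nz by (simp add: m'_def X_def)
  define Z where "Z = (\<Prod>k\<in>I - {i}. X i - x k * q ^ m' k / q)"
  define Z' where "Z' = (\<Prod>k\<in>I - {i}. X i - X k)"
  define VV where "VV = (\<Prod>k\<in>I - {i}. (q * X i - X k) / (X i - X k))"
  define U' where "U' = (\<Prod>k\<in>I - {i}. 1 - e * X k * q ^ s)"
  define DD where "DD = (\<Prod>k\<in>I. 1 - q * X i / x k)"
  define PJ where "PJ = (\<Prod>j\<in>J. (b j - X i) / (1 - e * b j * q ^ s))"
  define xx where "xx = (\<Prod>k\<in>I. - (x k / q))"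
  define u where "u = (1 - c * X i) * (1 - c' * X i)"
  define z where "z = c * c' / (\<Prod>i\<in>I. x i)"
  define bb where "bb = (X i - b j1) * (X i - b j2) * (X i - b j3)"
  have xk: "x k \<noteq> 0" if "k \<in> I" for k using gen that by (simp add: generic_nodes_def)
  have Tm': "T m' = T m * (z * VV * (H * U' * (1 - e * X i * q ^ Suc s) / (DD * u)) * BB * PJ)"
    unfolding T_def m'_def z_def VV_def U'_def DD_def PJ_def u_def H_def BB_def X_def s_def e_def
    by (rule kterm_Suc[OF gen i J(1) nx nb])
  have kp: "poly (kpoly I x c c') (X i) = u * (DD * xx)"
  proof -
    have "(\<Prod>k\<in>I. X i - x k / q) = (\<Prod>k\<in>I. (1 - q * X i / x k) * - (x k / q))"
      using xk q_nz by (intro prod.cong) (auto simp: field_simps)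
    then show ?thesis unfolding poly_kpoly u_def DD_def xx_def prod.distrib[symmetric] by simp
  qed
  have u_nz: "u \<noteq> 0"
  proof -
    have "P (c * x i) \<noteq> 0" "P (c' * x i) \<noteq> 0" using gen i by (auto simp: generic_nodes_def)
    then have "c * x i * q ^ m i \<noteq> 1" "c' * x i * q ^ m i \<noteq> 1"
      unfolding qpoch_inf_nonzero_iff by blast+
    then show ?thesis by (simp add: u_def X_def mult_ac)
  qed
  have DD_nz: "DD \<noteq> 0"
  proof -
    have "1 - q * X i / x k \<noteq> 0" if k: "k \<in> I" for k
    proof -
      have "q * x i / x k * q ^ m i \<noteq> 1"
        using generic_nodes_qpoch_inf[OF gen i k] unfolding qpoch_inf_nonzero_iff by blast
      then show ?thesis by (simp add: X_def mult_ac)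
    qed
    then show ?thesis using fin by (simp add: DD_def)
  qed
  have XT1: "XT i m' = T m * (z * xx) * (VV / Z) * H * (U' * (1 - e * X i * q ^ Suc s) / (X i - eta (Suc s)))
      * BB * (PJ / bb)"
    unfolding XT_def s' yi Tm' kp Z_def[symmetric] bb_def[symmetric] using u_nz DD_nz by (simp add: mult_ac)
  have zxx: "z * xx = c * c' * (-1) ^ card I / q ^ card I"
  proof -
    have "xx = (-1) ^ card I * ((\<Prod>k\<in>I. x k) / q ^ card I)"
      unfolding xx_def using prod_uminus[of "\<lambda>k. x k / q" I] by (simp add: prod_dividef)
    then show ?thesis unfolding z_def using xk fin by simp
  qed
  have VVZ: "VV / Z = q ^ (card I - 1) / Z'"
  proof -
    have "VV / Z = (\<Prod>k\<in>I - {i}. q / (X i - X k))"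
      unfolding VV_def Z_def prod_dividef[symmetric]
    proof (rule prod.cong[OF refl])
      fix k assume k: "k \<in> I - {i}"
      have "q * X i \<noteq> X k"
        using generic_nodes_neq[OF gen i, of k "Suc (m i)" "m k"] k by (auto simp: X_def mult_ac)
      moreover have "x k * q ^ m' k / q = X k / q" using k by (simp add: m'_def X_def)
      moreover have "X i - X k / q = (q * X i - X k) / q" using q_nz by (simp add: field_simps)
      ultimately show "(q * X i - X k) / (X i - X k) / (X i - x k * q ^ m' k / q) = q / (X i - X k)"
        using q_nz by simp
    qed
    then show ?thesis
      unfolding prod_dividef Z'_def using i fin by simp
  qed
  have UU: "U' * (1 - e * X i * q ^ Suc s) / (X i - eta (Suc s)) = U * q / (X i - eta s)"
  proof -
    have n1: "X i - eta (Suc s) \<noteq> 0" "X i - eta s \<noteq> 0" using eta_neq_node'[OF i] by (auto simp: X_def)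
    have "U = (1 - e * X i * q ^ s) * U'"
      unfolding U_def U'_def X_def s_def by (rule prod.remove[OF fin i])
    then have U: "U = - (e * q ^ s) * (X i - eta s) * U'" unfolding one_minus_eta .
    have S: "1 - e * X i * q ^ Suc s = - (e * q ^ s * q) * (X i - eta (Suc s))"
      unfolding one_minus_eta[of "X i" "Suc s"] by simp
    have "u' * (- (f * q) * A') / A' = (- f * A * u') * q / A" if "A \<noteq> 0" "A' \<noteq> 0" for u' f A A'
      using that by simp
    from this[OF n1(2,1)] show ?thesis unfolding S U .
  qed
  have PJb: "PJ / bb = - poly rpoly (X i) / W"
  proof -
    have bb_nz: "bb \<noteq> 0"
    proof -
      have "X i \<noteq> b j" if "j \<in> {j1, j2, j3}" for j
        using nbx[OF that i, of "Suc (m i)"] q_nz by (auto simp: X_def)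
      then show ?thesis by (simp add: bb_def)
    qed
    have "PJ = (b j1 - X i) * (b j2 - X i) * (b j3 - X i) * poly rpoly (X i) / W"
      unfolding PJ_def prod_dividef prod_J_split[of "\<lambda>j. b j - X i"] poly_rpoly W_def s_def ..
    also have "(b j1 - X i) * (b j2 - X i) * (b j3 - X i) = - bb"
      unfolding bb_def by (simp add: algebra_simps)
    finally show ?thesis using bb_nz by simp
  qed
  have "XT i m' = T m * (c * c' * (-1) ^ card I / q ^ card I) * (q ^ (card I - 1) / Z') * H
      * (U * q / (X i - eta s)) * BB * (- poly rpoly (X i) / W)"
    unfolding XT1 zxx VVZ UU PJb ..
  also have "\<dots> = T m * (c * c' * (-1) ^ Suc (card I) * H * U * BB / W)
     * (poly rpoly (X i) / ((X i - eta s) * Z')) * ((q ^ (card I - 1) * q) / q ^ card I)"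
    by (simp add: mult_ac)
  \<comment> \<open>The powers of \<open>q\<close> balance: \<open>zxx\<close> divides by
    \<open>card I\<close> of them, \<open>VVZ\<close> contributes \<open>card I - 1\<close> and
    \<open>UU\<close> one. The subtraction is harmless because \<open>I\<close> is nonempty.\<close>
  also have "q ^ (card I - 1) * q = q ^ card I"
    using card_I_pos by (metis One_nat_def Suc_diff_le diff_Suc_Suc diff_zero power_Suc2)
  finally show ?thesis
    unfolding m'_def[symmetric] Z'_def[symmetric] using q_nz by simp
qed

lemma sum_XT_Suc: "(\<Sum>i\<in>I. XT i (m(i := Suc (m i)))) + YT m = 0"
proof -
  define K where "K = c * c' * (-1) ^ Suc (card I) * H * U * BB / W"
  define E where "E = eta s"
  define b3 where "b3 = (b j1 - E) * (b j2 - E) * (b j3 - E)"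
  have inj: "inj_on X I"
    unfolding inj_on_def X_def using generic_nodes_neq[OF gen] by blast
  have disj: "{eta s} \<inter> X ` I = {}"
  proof -
    have "eta s \<notin> X ` I"
    proof
      assume "eta s \<in> X ` I"
      then obtain k where "k \<in> I" "eta s = X k" by blast
      then show False using eta_neq_node'[of k "m k" s] by (simp add: X_def)
    qed
    then show ?thesis by blast
  qed
  have "(\<Sum>i\<in>I. XT i (m(i := Suc (m i))))
      = T m * K * (\<Sum>i\<in>I. poly rpoly (X i) / ((\<Prod>u\<in>{eta s}. X i - u) * (\<Prod>k\<in>I - {i}. X i - X k)))"
    unfolding sum_distrib_left K_def by (intro sum.cong refl XT_Suc)
  also have "(\<Sum>i\<in>I. poly rpoly (X i) / ((\<Prod>u\<in>{eta s}. X i - u) * (\<Prod>k\<in>I - {i}. X i - X k)))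
     = - (poly rpoly E / (\<Prod>k\<in>I. E - X k))"
    using sum_Lagrange_zero_split[OF _ fin inj disj, of rpoly] degree_rpoly
    by (simp add: E_def eq_neg_iff_add_eq_0 add.commute)
  finally have X_sum: "(\<Sum>i\<in>I. XT i (m(i := Suc (m i)))) = T m * K * (- (poly rpoly E / (\<Prod>k\<in>I. E - X k)))" .
  have E_nz: "E \<noteq> 0" unfolding E_def by (rule eta_nz)
  have eqs: "e * q ^ s = 1 / E" unfolding E_def by (rule e_eta)
  have one: "E * (1 - e * t * q ^ s) = E - t" for t
  proof -
    have "E * (1 - e * t * q ^ s) = E - t * (E * (e * q ^ s))" by (simp add: algebra_simps)
    then show ?thesis unfolding eqs using E_nz by simp
  qed
  have p1: "(\<Prod>k\<in>I. E - X k) = E ^ card I * U"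
    unfolding U_def one[symmetric] prod.distrib X_def s_def by simp
  have U_nz: "U \<noteq> 0"
  proof -
    have "E - X k \<noteq> 0" if "k \<in> I" for k
      using eta_neq_node'[OF that, of "m k" s] by (simp add: E_def X_def)
    then have "(\<Prod>k\<in>I. E - X k) \<noteq> 0" using fin by simp
    then show ?thesis unfolding p1 by simp
  qed
  have W_nz: "W \<noteq> 0" unfolding W_def using nb J by (simp add: e_def)
  have b3_nz: "b3 \<noteq> 0"
    using eta_neq_b[OF j(1), of s] eta_neq_b[OF j(2), of s] eta_neq_b[OF j(3), of s]
    by (simp add: b3_def E_def)
  have p2: "b3 * poly rpoly E = (- E) ^ (card I + 2) * W"
  proof -
    have "b3 * poly rpoly E = (\<Prod>j\<in>J. b j - E)"
      unfolding prod_J_split[of "\<lambda>j. b j - E"] b3_def poly_rpoly ..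
    also have "\<dots> = (\<Prod>j\<in>J. (- E) * (1 - e * b j * q ^ s))"
    proof (rule prod.cong[OF refl])
      fix j show "b j - E = (- E) * (1 - e * b j * q ^ s)" using one[of "b j"] by simp
    qed
    also have "\<dots> = (- E) ^ (card I + 2) * W"
      unfolding prod.distrib W_def s_def using J by simp
    finally show ?thesis .
  qed
  have p3: "(\<Prod>k\<in>I. E - x k / q) = H * (\<Prod>k\<in>I. E - x k * q ^ m k / q)"
    unfolding H_def prod.distrib[symmetric]
  proof (rule prod.cong[OF refl])
    fix k assume k: "k \<in> I"
    have 1: "1 - e * x k * q ^ s / q = (E - x k / q) / E"
      unfolding one[of "x k / q", symmetric] using E_nz by simp
    have 2: "1 - e * (x k * q ^ m k) * q ^ s / q = (E - x k * q ^ m k / q) / E"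
      unfolding one[of "x k * q ^ m k / q", symmetric] using E_nz by simp
    have "E - x k * q ^ m k / q \<noteq> 0" using eta_neq_node[OF k, of "m k" s] by (simp add: E_def)
    then show "E - x k / q = (1 - e * x k * q ^ sum m I / q) / (1 - e * (x k * q ^ m k) * q ^ sum m I / q)
        * (E - x k * q ^ m k / q)"
      unfolding s_def[symmetric] 1 2 using E_nz by simp
  qed
  \<comment> \<open>Here \<open>e = c * c' * B\<close> is essential: it gives
    \<open>c' * B * q ^ s = 1 / (c * E)\<close>, so reversing the factor \<open>1 - c * E\<close>
    produces one factor of \<open>BB\<close>, and \<open>1 - c' * E\<close> the other.\<close>
  have p4: "(1 - c * E) * (1 - c' * E) = c * c' * E^2 * BB"
  proof -
    have 1: "c' * B * q ^ s = 1 / (c * E)" "c * B * q ^ s = 1 / (c' * E)"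
    proof -
      have "c' * B * q ^ s = e * q ^ s / c" "c * B * q ^ s = e * q ^ s / c'" using c by (simp_all add: e_def)
      then show "c' * B * q ^ s = 1 / (c * E)" "c * B * q ^ s = 1 / (c' * E)"
        unfolding eqs by (simp_all add: mult_ac)
    qed
    show ?thesis unfolding BB_def s_def[symmetric] 1 using c E_nz by (simp add: field_simps power2_eq_square)
  qed
  have nz: "(\<Prod>k\<in>I. E - x k * q ^ m k / q) \<noteq> 0"
  proof -
    have "E - x k * q ^ m k / q \<noteq> 0" if "k \<in> I" for k
      using eta_neq_node[OF that, of "m k" s] by (simp add: E_def)
    then show ?thesis using fin by simp
  qed
  have "YT m = T m * (c * c' * E^2 * BB * (H * (\<Prod>k\<in>I. E - x k * q ^ m k / q)))
      / ((E - b j1) * (E - b j2) * (E - b j3) * (\<Prod>k\<in>I. E - x k * q ^ m k / q))"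
    unfolding YT_def s_def[symmetric] E_def[symmetric] poly_kpoly p4 p3 ..
  also have "(E - b j1) * (E - b j2) * (E - b j3) = - b3"
    unfolding b3_def by (simp add: algebra_simps)
  finally have Y: "YT m = - (T m * (c * c' * E^2 * BB * H) / b3)"
    using nz by simp
  have r: "poly rpoly E = (- E) ^ (card I + 2) * W / b3"
    using p2 b3_nz by (simp add: field_simps)
  have sg: "(-1) ^ Suc n * (- E) ^ (n + 2) = - (E ^ n * E^2)" for n
    by (induction n) (auto simp: power2_eq_square)
  have "K * (poly rpoly E / (\<Prod>k\<in>I. E - X k))
     = c * c' * H * BB * ((-1) ^ Suc (card I) * (- E) ^ (card I + 2)) / (b3 * E ^ card I)"
    unfolding K_def r p1 using U_nz W_nz by simp
  also have "\<dots> = - (c * c' * E^2 * BB * H / b3)"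
    unfolding sg using E_nz by simp
  finally have F: "K * (poly rpoly E / (\<Prod>k\<in>I. E - X k)) = - (c * c' * E^2 * BB * H / b3)" .
  have "T m * K * (- (poly rpoly E / (\<Prod>k\<in>I. E - X k))) = - T m * (K * (poly rpoly E / (\<Prod>k\<in>I. E - X k)))"
    by simp
  then show ?thesis unfolding X_sum F Y by simp
qed

end

end

section \<open>Summation of the pointwise relation over all multi-indices\<close>

context generic_series
begin

lemma kterm_shift_node:
  assumes jj: "j \<in> {j1, j2, j3}"
  shows "(1 - b j * c) * (1 - b j * c') * kterm I x J (b(j := q * b j)) B c c' l
    = - (T l / e) * (poly (kpoly I x c c') (b j) / ((b j - eta (sum l I)) * (\<Prod>i\<in>I. b j - x i * q ^ l i / q)))"
proof -
  define s where "s = sum l I"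
  have jJ: "j \<in> J" using jj j by auto
  have nz: "b j - eta s \<noteq> 0" "e * q ^ s \<noteq> 0" using eta_neq_b[OF jJ, of s] e_nz q_nz by auto
  have "kterm I x J (b(j := q * b j)) B c c' l = q ^ s * T l
      * ((\<Prod>i\<in>I. (b j - x i / q) / (b j - x i * q ^ l i / q)) / (1 - e * b j * q ^ s))"
    unfolding T_def s_def e_def
  proof (rule kterm_shift[OF J(1) jJ])
    show "1 - c * c' * B * b j * q ^ sum l I \<noteq> 0" by (rule nb[OF jJ])
    show "b j - x i * q ^ l i / q \<noteq> 0" if "i \<in> I" for i by (rule nbx[OF jj that])
  qed
  also have "1 - e * b j * q ^ s = - (e * q ^ s) * (b j - eta s)" by (rule one_minus_eta)
  also have "(\<Prod>i\<in>I. (b j - x i / q) / (b j - x i * q ^ l i / q))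
     = (\<Prod>i\<in>I. b j - x i / q) / (\<Prod>i\<in>I. b j - x i * q ^ l i / q)" by (rule prod_dividef)
  finally have k: "kterm I x J (b(j := q * b j)) B c c' l = q ^ s * T l
      * ((\<Prod>i\<in>I. b j - x i / q) / (\<Prod>i\<in>I. b j - x i * q ^ l i / q) / (- (e * q ^ s) * (b j - eta s)))" .
  show ?thesis
    unfolding k poly_kpoly s_def[symmetric] using nz q_nz by (simp add: mult_ac)
qed

text \<open>\<open>u2 - u3\<close> is minus the product of all three differences divided by
  \<open>(u1 - u2) * (u1 - u3)\<close>, and so on cyclically: the weights of the contiguous relation
  are Lagrange denominators.\<close>

lemma three_term_algebra:
  fixes p1 p2 p3 :: complex
  assumes "u1 \<noteq> u2" "u2 \<noteq> u3" "u3 \<noteq> u1"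
    and "p1 / ((u1 - u2) * (u1 - u3)) + p2 / ((u2 - u1) * (u2 - u3)) + p3 / ((u3 - u1) * (u3 - u2)) = r"
  shows "(u2 - u3) * (- t * p1) + (u3 - u1) * (- t * p2) + (u1 - u2) * (- t * p3)
    = t * ((u1 - u2) * (u2 - u3) * (u3 - u1)) * r"
proof -
  define a1 a2 a3 where "a1 = p1 / ((u1 - u2) * (u1 - u3))" and "a2 = p2 / ((u2 - u1) * (u2 - u3))"
    and "a3 = p3 / ((u3 - u1) * (u3 - u2))"
  have "p1 = a1 * ((u1 - u2) * (u1 - u3))" "p2 = a2 * ((u2 - u1) * (u2 - u3))" "p3 = a3 * ((u3 - u1) * (u3 - u2))"
    using assms(1-3) by (simp_all add: a1_def a2_def a3_def)
  moreover have "r = a1 + a2 + a3" using assms(4) by (simp add: a1_def a2_def a3_def)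
  ultimately show ?thesis by (simp only:) (simp add: algebra_simps)
qed

lemma three_term_pointwise:
  "(b j2 - b j3) * ((1 - b j1 * c) * (1 - b j1 * c') * kterm I x J (b(j1 := q * b j1)) B c c' l)
   + (b j3 - b j1) * ((1 - b j2 * c) * (1 - b j2 * c') * kterm I x J (b(j2 := q * b j2)) B c c' l)
   + (b j1 - b j2) * ((1 - b j3 * c) * (1 - b j3 * c') * kterm I x J (b(j3 := q * b j3)) B c c' l)
   = - ((b j1 - b j2) * (b j2 - b j3) * (b j3 - b j1) / e) * ((\<Sum>i\<in>I. XT i l) + YT l)"
proof -
  define E where "E = eta (sum l I)"
  define y where "y = (\<lambda>i. x i * q ^ l i / q)"
  define p where "p = poly (kpoly I x c c')"
  define A where "A = (\<lambda>t. \<Prod>i\<in>I. t - y i)"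
  have neq: "b j1 \<noteq> E" "b j2 \<noteq> E" "b j3 \<noteq> E"
    unfolding E_def by (rule eta_neq_b[OF j(1)], rule eta_neq_b[OF j(2)], rule eta_neq_b[OF j(3)])
  define S where "S = {b j1, b j2, b j3, E}"
  have inj: "inj_on y I"
  proof (rule inj_onI)
    fix i k assume ik: "i \<in> I" "k \<in> I" "y i = y k"
    then have "x i * q ^ l i = x k * q ^ l k" using q_nz by (simp add: y_def)
    then show "i = k" using generic_nodes_neq[OF gen ik(1,2)] by blast
  qed
  have yS: "y i \<notin> S" if i: "i \<in> I" for i
  proof -
    have "y i \<noteq> b j" if "j \<in> {j1, j2, j3}" for j using nbx[OF that i, of "l i"] by (auto simp: y_def)
    moreover have "y i \<noteq> E" unfolding y_def E_def by (rule eta_neq_node[OF i])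
    ultimately show ?thesis by (simp add: S_def)
  qed
  have "card S = 4" unfolding S_def using neq b_distinct by auto
  then have deg: "degree (kpoly I x c c') + 2 \<le> card S + card I"
    using degree_kpoly[OF fin, of x c c'] by simp
  have disj: "S \<inter> y ` I = {}" using yS by blast
  have finS: "finite S" by (simp add: S_def)
  have L1: "(\<Sum>t\<in>S. p t / ((\<Prod>u\<in>S - {t}. t - u) * A t))
     + (\<Sum>i\<in>I. p (y i) / ((\<Prod>u\<in>S. y i - u) * (\<Prod>k\<in>I - {i}. y i - y k))) = 0"
    unfolding p_def A_def by (rule sum_Lagrange_zero_split[OF finS fin inj disj deg])
  have L2: "(\<Sum>t\<in>S. p t / ((\<Prod>u\<in>S - {t}. t - u) * A t))
    = (p (b j1) / ((b j1 - E) * A (b j1))) / ((b j1 - b j2) * (b j1 - b j3))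
    + (p (b j2) / ((b j2 - E) * A (b j2))) / ((b j2 - b j1) * (b j2 - b j3))
    + (p (b j3) / ((b j3 - E) * A (b j3))) / ((b j3 - b j1) * (b j3 - b j2))
    + p E / ((E - b j1) * (E - b j2) * (E - b j3) * A E)"
  proof -
    have "S - {b j1} = {b j2, b j3, E}" "S - {b j2} = {b j1, b j3, E}" "S - {b j3} = {b j1, b j2, E}"
      "S - {E} = {b j1, b j2, b j3}"
      using neq b_distinct unfolding S_def by auto
    then have P: "(\<Prod>u\<in>S - {b j1}. b j1 - u) = (b j1 - b j2) * ((b j1 - b j3) * (b j1 - E))"
      "(\<Prod>u\<in>S - {b j2}. b j2 - u) = (b j2 - b j1) * ((b j2 - b j3) * (b j2 - E))"
      "(\<Prod>u\<in>S - {b j3}. b j3 - u) = (b j3 - b j1) * ((b j3 - b j2) * (b j3 - E))"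
      "(\<Prod>u\<in>S - {E}. E - u) = (E - b j1) * ((E - b j2) * (E - b j3))"
      using neq b_distinct by simp_all
    have S4: "(\<Sum>t\<in>S. f t) = f (b j1) + f (b j2) + f (b j3) + f E" for f :: "complex \<Rightarrow> complex"
      unfolding S_def using neq b_distinct by auto
    show ?thesis unfolding S4 P by (simp only: divide_divide_eq_left mult_ac)
  qed
  have L: "(p (b j1) / ((b j1 - E) * A (b j1))) / ((b j1 - b j2) * (b j1 - b j3))
    + (p (b j2) / ((b j2 - E) * A (b j2))) / ((b j2 - b j1) * (b j2 - b j3))
    + (p (b j3) / ((b j3 - E) * A (b j3))) / ((b j3 - b j1) * (b j3 - b j2))
    = - ((\<Sum>i\<in>I. p (y i) / ((\<Prod>u\<in>S. y i - u) * (\<Prod>k\<in>I - {i}. y i - y k)))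
        + p E / ((E - b j1) * (E - b j2) * (E - b j3) * A E))"
  proof -
    have "u = - (z + y)" if "s' + z = 0" "s' = u + y" for s' u y z :: complex
    proof -
      have "u + (z + y) = s' + z" unfolding that(2) by (simp only: add_ac)
      then show ?thesis using that(1) by (simp only: eq_neg_iff_add_eq_0)
    qed
    from this[OF L1 L2] show ?thesis .
  qed
  have XY: "(\<Sum>i\<in>I. XT i l) + YT l = T l * ((\<Sum>i\<in>I. p (y i) / ((\<Prod>u\<in>S. y i - u) * (\<Prod>k\<in>I - {i}. y i - y k)))
        + p E / ((E - b j1) * (E - b j2) * (E - b j3) * A E))"
  proof -
    have "XT i l = T l * (p (y i) / ((\<Prod>u\<in>S. y i - u) * (\<Prod>k\<in>I - {i}. y i - y k)))" for i
    proof -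
      have pS: "(\<Prod>u\<in>S. y i - u) = (y i - b j1) * (y i - b j2) * (y i - b j3) * (y i - E)"
        unfolding S_def using neq b_distinct by auto
      show ?thesis unfolding pS XT_def p_def unfolding y_def E_def by simp
    qed
    moreover have "YT l = T l * (p E / ((E - b j1) * (E - b j2) * (E - b j3) * A E))"
      unfolding YT_def E_def p_def A_def y_def by simp
    ultimately show ?thesis by (simp add: sum_distrib_left distrib_left)
  qed
  have sh: "(1 - b j * c) * (1 - b j * c') * kterm I x J (b(j := q * b j)) B c c' l
      = - (T l / e) * (p (b j) / ((b j - E) * A (b j)))" if "j \<in> {j1, j2, j3}" for j
    unfolding p_def E_def A_def y_def by (rule kterm_shift_node[OF that])
  have m: "j1 \<in> {j1, j2, j3}" "j2 \<in> {j1, j2, j3}" "j3 \<in> {j1, j2, j3}" by simp_all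
  have "t / e * V * (- Z) = - (V / e) * (t * Z)" for t V Z by simp
  then show ?thesis
    unfolding sh[OF m(1)] sh[OF m(2)] sh[OF m(3)] XY three_term_algebra[OF b_distinct L, of "T l / e"] .
qed

definition level :: "nat \<Rightarrow> (nat \<Rightarrow> nat) set" where "level n = {l \<in> I \<rightarrow>\<^sub>E UNIV. sum l I \<le> n}"

text \<open>Since \<open>x i / q\<close> is a root of \<open>kpoly\<close>, the terms with
  \<open>l i = 0\<close> vanish; every other index arises by raising the component \<open>i\<close>,
  from one level lower.\<close>

lemma sum_level_XT: 
  assumes i: "i \<in> I"
  shows "(\<Sum>l\<in>level (Suc n). XT i l) = (\<Sum>m\<in>level n. XT i (m(i := Suc (m i))))"
proof -
  have "(\<Sum>l\<in>level (Suc n). XT i l) = (\<Sum>l\<in>{l \<in> level (Suc n). l i > 0}. XT i l)"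
  proof (rule sum.mono_neutral_right)
    show "finite (level (Suc n))" unfolding level_def by (rule finite_level_PiE[OF fin])
    show "\<forall>l\<in>level (Suc n) - {l \<in> level (Suc n). 0 < l i}. XT i l = 0"
    proof
      fix l assume "l \<in> level (Suc n) - {l \<in> level (Suc n). 0 < l i}"
      then have "l i = 0" by auto
      then have "poly (kpoly I x c c') (x i * q ^ l i / q) = 0"
        unfolding poly_kpoly using i fin by (auto intro!: bexI[of _ i])
      then show "XT i l = 0" by (simp add: XT_def)
    qed
  qed auto
  also have "\<dots> = (\<Sum>m\<in>level n. XT i (m(i := Suc (m i))))"
  proof (rule sum.reindex_bij_witness[where j = "\<lambda>l. l(i := l i - 1)" and i = "\<lambda>m. m(i := Suc (m i))"])
    fix l assume l: "l \<in> {l \<in> level (Suc n). 0 < l i}"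
    show eq: "(l(i := l i - 1))(i := Suc ((l(i := l i - 1)) i)) = l" using l by auto
    have "sum l I = Suc (sum (l(i := l i - 1)) I)"
      using sum_fun_upd_Suc[OF fin i, of "l(i := l i - 1)"] unfolding eq .
    then show "l(i := l i - 1) \<in> level n" using l i by (auto simp: level_def PiE_iff extensional_def)
    show "XT i ((l(i := l i - 1))(i := Suc ((l(i := l i - 1)) i))) = XT i l" unfolding eq ..
  next
    fix m assume m: "m \<in> level n"
    show "(m(i := Suc (m i)))(i := (m(i := Suc (m i))) i - 1) = m" by auto
    show "m(i := Suc (m i)) \<in> {l \<in> level (Suc n). 0 < l i}"
      using m sum_fun_upd_Suc[OF fin i, of m] i by (auto simp: level_def PiE_iff extensional_def)
  qed
  finally show ?thesis .
qed

text \<open>The raised \<open>XT\<close> over \<open>level n\<close> cancel the \<open>YT\<close>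
  over \<open>level n\<close>, and only the outermost shell survives.\<close>

lemma sum_level_telescope:
  "(\<Sum>l\<in>level (Suc n). (\<Sum>i\<in>I. XT i l) + YT l) = (\<Sum>l\<in>{l \<in> I \<rightarrow>\<^sub>E UNIV. sum l I = Suc n}. YT l)"
proof -
  have fl: "finite (level k)" for k unfolding level_def by (rule finite_level_PiE[OF fin])
  have "(\<Sum>l\<in>level (Suc n). \<Sum>i\<in>I. XT i l) = (\<Sum>i\<in>I. \<Sum>m\<in>level n. XT i (m(i := Suc (m i))))"
    by (subst sum.swap) (rule sum.cong[OF refl sum_level_XT])
  also have "\<dots> = (\<Sum>m\<in>level n. \<Sum>i\<in>I. XT i (m(i := Suc (m i))))" by (rule sum.swap)
  also have "\<dots> = (\<Sum>m\<in>level n. - YT m)"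
    by (intro sum.cong refl) (metis sum_XT_Suc eq_neg_iff_add_eq_0)
  finally have 1: "(\<Sum>l\<in>level (Suc n). \<Sum>i\<in>I. XT i l) = - (\<Sum>m\<in>level n. YT m)"
    by (simp add: sum_negf)
  have "level (Suc n) = level n \<union> {l \<in> I \<rightarrow>\<^sub>E UNIV. sum l I = Suc n}"
    "level n \<inter> {l \<in> I \<rightarrow>\<^sub>E UNIV. sum l I = Suc n} = {}"
    by (auto simp: level_def)
  then have 2: "(\<Sum>l\<in>level (Suc n). YT l) = (\<Sum>m\<in>level n. YT m) + (\<Sum>l\<in>{l \<in> I \<rightarrow>\<^sub>E UNIV. sum l I = Suc n}. YT l)"
    using sum.union_disjoint[of "level n" "{l \<in> I \<rightarrow>\<^sub>E UNIV. sum l I = Suc n}" YT] fl[of n] fl[of "Suc n"]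
    by (simp add: finite_Un)
  show ?thesis unfolding sum.distrib 1 2 by simp
qed

text \<open>\<open>T\<close> need not be summable when only the shifted argument is less than 1 in
  modulus. Written through the term with \<open>b j1\<close> shifted, which is summable then,
  \<open>YT\<close> carries a factor that is bounded in \<open>l\<close>.\<close>

lemma YT_eq:
  "YT l = kterm I x J (b(j1 := q * b j1)) B c c' l *
     (e * ((\<Prod>i\<in>I. b j1 - x i * q ^ l i / q) * (\<Prod>i\<in>I. inverse (b j1 - x i / q)))
      * ((e * q ^ sum l I - c) * (e * q ^ sum l I - c') * (\<Prod>i\<in>I. 1 - e * x i / q * q ^ sum l I))
      * (inverse (1 - e * b j2 * q ^ sum l I) * inverse (1 - e * b j3 * q ^ sum l I)
         * (\<Prod>i\<in>I. inverse (1 - e * x i / q * q ^ (sum l I + l i)))))"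
proof -
  define s where "s = sum l I"
  define E where "E = eta s"
  define f where "f = e * q ^ s"
  have f: "f \<noteq> 0" "E = 1 / f" using e_nz q_nz by (auto simp: f_def E_def eta_def)
  have nb': "1 - f * b j \<noteq> 0" if "j \<in> J" for j using nb[OF that, of s] by (simp add: f_def e_def mult_ac)
  have nx': "1 - f * (x i * q ^ l i / q) \<noteq> 0" if "i \<in> I" for i
    using nx[OF that, of "s + l i"] by (simp add: f_def e_def power_add mult_ac)
  define A0 where "A0 = (\<Prod>i\<in>I. b j1 - x i / q)"
  define A1 where "A1 = (\<Prod>i\<in>I. b j1 - x i * q ^ l i / q)"
  define N where "N = (\<Prod>i\<in>I. 1 - f * (x i / q))"
  define D where "D = (\<Prod>i\<in>I. 1 - f * (x i * q ^ l i / q))"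
  have nz: "A0 \<noteq> 0" "A1 \<noteq> 0" "D \<noteq> 0"
    using fin nbx[of j1 _ 0] nbx[of j1] nx' by (auto simp: A0_def A1_def D_def)
  have m: "E - t = (1 - f * t) / f" for t using f by (simp add: field_simps)
  have kt: "kterm I x J (b(j1 := q * b j1)) B c c' l = q ^ s * T l * (A0 / A1 / (1 - f * b j1))"
  proof -
    have "kterm I x J (b(j1 := q * b j1)) B c c' l = q ^ s * T l
      * ((\<Prod>i\<in>I. (b j1 - x i / q) / (b j1 - x i * q ^ l i / q)) / (1 - c * c' * B * b j1 * q ^ s))"
      unfolding T_def s_def
    proof (rule kterm_shift[OF J(1) j(1)])
      show "1 - c * c' * B * b j1 * q ^ sum l I \<noteq> 0" by (rule nb[OF j(1)])
      show "b j1 - x i * q ^ l i / q \<noteq> 0" if "i \<in> I" for i by (rule nbx[OF _ that]) simp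
    qed
    also have "1 - c * c' * B * b j1 * q ^ s = 1 - f * b j1" by (simp add: f_def e_def mult_ac)
    finally show ?thesis unfolding prod_dividef A0_def A1_def .
  qed
  have kp: "poly (kpoly I x c c') E = ((f - c) * (f - c') * N) / f ^ (card I + 2)"
  proof -
    have "1 - c * E = (f - c) / f" "1 - c' * E = (f - c') / f" using f by (simp_all add: field_simps)
    moreover have "(\<Prod>i\<in>I. E - x i / q) = N / f ^ card I" unfolding m prod_dividef N_def by simp
    ultimately show ?thesis unfolding poly_kpoly by (simp add: power2_eq_square)
  qed
  have den: "(E - b j1) * (E - b j2) * (E - b j3) * (\<Prod>k\<in>I. E - x k * q ^ l k / q)
     = (1 - f * b j1) * (1 - f * b j2) * (1 - f * b j3) * D / f ^ (card I + 3)"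
    unfolding m prod_dividef D_def by (simp add: power3_eq_cube power_add)
  have "YT l = T l * (((f - c) * (f - c') * N) / f ^ (card I + 2))
     / ((1 - f * b j1) * (1 - f * b j2) * (1 - f * b j3) * D / f ^ (card I + 3))"
    unfolding YT_def s_def[symmetric] E_def[symmetric] kp den ..
  also have "\<dots> = T l * ((f - c) * (f - c') * N) * f / ((1 - f * b j1) * (1 - f * b j2) * (1 - f * b j3) * D)"
    using f by (simp add: power_add power3_eq_cube power2_eq_square)
  also have "\<dots> = q ^ s * T l * (A0 / A1 / (1 - f * b j1)) * (e * (A1 * inverse A0) * ((f - c) * (f - c') * N)
     * (inverse (1 - f * b j2) * inverse (1 - f * b j3) * inverse D))"
  proof -
    have "u * v * f / (h1 * h2 * h3 * D)
        = q ^ s * u * (A0 / A1 / h1) * (e * (A1 * inverse A0) * v * (inverse h2 * inverse h3 * inverse D))" for u v h1 h2 h3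
    proof -
      have "u * v * f / (h1 * h2 * h3 * D) = (A0 / A1 * (A1 * inverse A0)) * (u * v * f / (h1 * h2 * h3 * D))"
        using nz by simp
      also have "\<dots> = q ^ s * u * (A0 / A1 / h1) * (e * (A1 * inverse A0) * v * (inverse h2 * inverse h3 * inverse D))"
        by (simp only: f_def divide_inverse inverse_mult_distrib mult_ac)
      finally show ?thesis .
    qed
    then show ?thesis .
  qed
  finally have Y: "YT l = \<dots>" .
  have i0: "(\<Prod>i\<in>I. inverse (b j1 - x i / q)) = inverse A0"
    unfolding A0_def using prod_inversef[of "\<lambda>i. b j1 - x i / q" I] by (simp add: o_def)
  have iD: "(\<Prod>i\<in>I. inverse (1 - e * x i / q * q ^ (s + l i))) = inverse D"
  proof -
    have "D = (\<Prod>i\<in>I. 1 - e * x i / q * q ^ (s + l i))"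
      unfolding D_def f_def by (rule prod.cong) (simp_all add: power_add mult_ac)
    then show ?thesis using prod_inversef[of "\<lambda>i. 1 - e * x i / q * q ^ (s + l i)" I] by (simp add: o_def)
  qed
  have iN: "(\<Prod>i\<in>I. 1 - e * x i / q * q ^ s) = N"
    unfolding N_def f_def by (rule prod.cong) (simp_all add: mult_ac)
  have ff: "e * b j * q ^ s = f * b j" for j by (simp add: f_def mult_ac)
  show ?thesis
    unfolding s_def[symmetric] i0 iD iN ff A1_def[symmetric] f_def[symmetric] kt using Y by simp
qed

lemma YT_summable:
  assumes "norm (q * (c * c' / (\<Prod>i\<in>I. x i) * (\<Prod>j\<in>J. b j))) < 1"
  shows "YT summable_on (I \<rightarrow>\<^sub>E UNIV)"
proof -
  have pr: "(\<Prod>j\<in>J. (b(j1 := q * b j1)) j) = (\<Prod>j\<in>J. b j) * q"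
    using prod_fun_upd_mult[OF J(1) j(1), of "\<lambda>y. y" "q * b j1" b q] by simp
  have ks: "(\<lambda>l. norm (kterm I x J (b(j1 := q * b j1)) B c c' l)) summable_on (I \<rightarrow>\<^sub>E UNIV)"
    by (rule kterm_abs_summable[OF gen J(1)]) (use assms in \<open>simp only: pr mult_ac\<close>)
  obtain C2 where C2: "C2 > 0" "\<And>n. norm (inverse (1 - e * b j2 * q ^ n)) \<le> C2"
    using bounded_inverse_one_minus[of "e * b j2"] nb[OF j(2)] unfolding e_def by metis
  obtain C3 where C3: "C3 > 0" "\<And>n. norm (inverse (1 - e * b j3 * q ^ n)) \<le> C3"
    using bounded_inverse_one_minus[of "e * b j3"] nb[OF j(3)] unfolding e_def by metis
  have "\<exists>C. C > 0 \<and> (\<forall>n. norm (inverse (1 - e * x i / q * q ^ n)) \<le> C)" if "i \<in> I" for i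
    using bounded_inverse_one_minus[of "e * x i / q"] nx[OF that] unfolding e_def
    by (metis times_divide_eq_left)
  then obtain F where F: "\<And>i. i \<in> I \<Longrightarrow> F i > 0"
    "\<And>i n. i \<in> I \<Longrightarrow> norm (inverse (1 - e * x i / q * q ^ n)) \<le> F i" by metis
  define A where "A = norm e * ((\<Prod>i\<in>I. norm (b j1) + norm (x i / q)) * (\<Prod>i\<in>I. norm (inverse (b j1 - x i / q))))"
  define M where "M = A * ((norm e + norm c) * (norm e + norm c') * (\<Prod>i\<in>I. 1 + norm (e * x i / q)))
    * (C2 * C3 * (\<Prod>i\<in>I. F i))"
  have tri: "norm (u - v * q ^ n) \<le> norm u + norm v" for u v n
  proof -
    have "norm (u - v * q ^ n) \<le> norm u + norm (v * q ^ n)" by (rule norm_triangle_ineq4)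
    also have "norm (v * q ^ n) \<le> norm v * 1"
      unfolding norm_mult by (intro mult_left_mono norm_power_q_le_1) auto
    finally show ?thesis by simp
  qed
  have tri1: "norm (1 - v * q ^ n) \<le> 1 + norm v" for v n
    using tri[of 1 v n] by simp
  have tri2: "norm (e * q ^ n - u) \<le> norm e + norm u" for u n
    using tri[of u e n] by (simp add: norm_minus_commute add.commute)
  have bound: "norm (YT l) \<le> M * norm (kterm I x J (b(j1 := q * b j1)) B c c' l)" for l
  proof -
    have "norm (YT l) = norm (kterm I x J (b(j1 := q * b j1)) B c c' l) *
     (norm e * ((\<Prod>i\<in>I. norm (b j1 - x i / q * q ^ l i)) * (\<Prod>i\<in>I. norm (inverse (b j1 - x i / q))))
      * (norm (e * q ^ sum l I - c) * norm (e * q ^ sum l I - c') * (\<Prod>i\<in>I. norm (1 - e * x i / q * q ^ sum l I)))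
      * (norm (inverse (1 - e * b j2 * q ^ sum l I)) * norm (inverse (1 - e * b j3 * q ^ sum l I))
         * (\<Prod>i\<in>I. norm (inverse (1 - e * x i / q * q ^ (sum l I + l i))))))"
      unfolding YT_eq prod_norm by (simp only: norm_mult times_divide_eq_left)
    also have "\<dots> \<le> norm (kterm I x J (b(j1 := q * b j1)) B c c' l) * M"
      unfolding M_def A_def using C2 C3 F
      by (intro mult_left_mono mult_mono prod_mono conjI mult_nonneg_nonneg prod_nonneg tri tri1 tri2)
         (auto intro: less_imp_le add_nonneg_nonneg)
    finally show ?thesis by (simp add: mult.commute)
  qed
  show ?thesis
    by (rule abs_summable_summable,
        rule Infinite_Sum.abs_summable_on_comparison_test'[OF summable_on_cmult_right[OF ks] bound])
qed

lemma three_term_generic: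
  assumes "norm (q * (c * c' / (\<Prod>i\<in>I. x i) * (\<Prod>j\<in>J. b j))) < 1"
  shows "(b j2 - b j3) * ((1 - b j1 * c) * (1 - b j1 * c') * kseries I x J (b(j1 := q * b j1)) B c c')
   + (b j3 - b j1) * ((1 - b j2 * c) * (1 - b j2 * c') * kseries I x J (b(j2 := q * b j2)) B c c')
   + (b j1 - b j2) * ((1 - b j3 * c) * (1 - b j3 * c') * kseries I x J (b(j3 := q * b j3)) B c c') = 0"
    (is "?Q = 0")
proof -
  define V where "V = - ((b j1 - b j2) * (b j2 - b j3) * (b j3 - b j1) / e)"
  have ks: "(kterm I x J (b(j := q * b j)) B c c' has_sum kseries I x J (b(j := q * b j)) B c c') (I \<rightarrow>\<^sub>E UNIV)"
    if jJ: "j \<in> J" for j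
  proof -
    have pr: "(\<Prod>k\<in>J. (b(j := q * b j)) k) = (\<Prod>k\<in>J. b k) * q"
      using prod_fun_upd_mult[OF J(1) jJ, of "\<lambda>y. y" "q * b j" b q] by simp
    have "(\<lambda>l. norm (kterm I x J (b(j := q * b j)) B c c' l)) summable_on (I \<rightarrow>\<^sub>E UNIV)"
      by (rule kterm_abs_summable[OF gen J(1)]) (use assms in \<open>simp only: pr mult_ac\<close>)
    from has_sum_infsum[OF abs_summable_summable[OF this]] show ?thesis
      unfolding kseries_def .
  qed
  have "((\<lambda>l. V * ((\<Sum>i\<in>I. XT i l) + YT l)) has_sum ?Q) (I \<rightarrow>\<^sub>E UNIV)"
    unfolding V_def three_term_pointwise[symmetric]
    by (rule has_sum_add[OF has_sum_add[OF has_sum_cmult_right[OF has_sum_cmult_right[OF ks[OF j(1)]]]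
          has_sum_cmult_right[OF has_sum_cmult_right[OF ks[OF j(2)]]]]
          has_sum_cmult_right[OF has_sum_cmult_right[OF ks[OF j(3)]]]])
  from has_sum_level_LIMSEQ[OF this, of "\<lambda>l. sum l I", OF finite_level_PiE[OF fin]]
  have "(\<lambda>n. \<Sum>l\<in>level n. V * ((\<Sum>i\<in>I. XT i l) + YT l)) \<longlonglongrightarrow> ?Q"
    unfolding level_def .
  then have "(\<lambda>n. \<Sum>l\<in>level (Suc n). V * ((\<Sum>i\<in>I. XT i l) + YT l)) \<longlonglongrightarrow> ?Q"
    by (rule LIMSEQ_Suc)
  then have 1: "(\<lambda>n. V * (\<Sum>l\<in>{l \<in> I \<rightarrow>\<^sub>E UNIV. sum l I = Suc n}. YT l)) \<longlonglongrightarrow> ?Q"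
    unfolding sum_distrib_left[symmetric] sum_level_telescope .
  have "(\<lambda>n. V * (\<Sum>l\<in>{l \<in> I \<rightarrow>\<^sub>E UNIV. sum l I = Suc n}. YT l)) \<longlonglongrightarrow> V * 0"
    by (intro tendsto_mult_left summable_level_tendsto_0 YT_summable[OF assms] finite_level_PiE[OF fin])
  from LIMSEQ_unique[OF 1 this] show ?thesis by simp
qed

end

section \<open>Removal of the genericity assumptions\<close>

context q_disc
begin

lemma finite_affine_zero: "s \<noteq> 0 \<Longrightarrow> finite {w :: complex. a + s * w = r}"
  by (rule finite_subset[of _ "{(r - a) / s}"]) (auto simp: field_simps)

text \<open>Below, \<open>B\<close> and \<open>b j\<close> move simultaneously along a line, so the
  conditions on \<open>B * b j\<close> become quadratic equations.\<close>

lemma finite_quadratic_zero: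
  assumes "s \<noteq> 0"
  shows "finite {w :: complex. (B + w) * (a + s * w) = r}"
proof -
  have "finite {w. poly [:B * a - r, B * s + a, s:] w = 0}"
    using assms by (intro poly_roots_finite) simp
  moreover have "poly [:B * a - r, B * s + a, s:] w = (B + w) * (a + s * w) - r" for w
    by (simp add: algebra_simps)
  ultimately show ?thesis by (simp only: right_minus_eq)
qed

text \<open>\<open>B\<close> is perturbed along with \<open>b\<close>, because \<open>B = 0\<close>
  is exceptional too. The perturbation stays in the open set where the shifted series converge, and
  there the left side is continuous.\<close>

lemma kseries_three_term:
  fixes J :: "nat set"
  assumes gen: "generic_nodes I x c c'" and J: "finite J" "card J = card I + 2"
    and j: "j1 \<in> J" "j2 \<in> J" "j3 \<in> J" "j1 \<noteq> j2" "j2 \<noteq> j3" "j3 \<noteq> j1"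
    and c: "c \<noteq> 0" "c' \<noteq> 0"
    and lt: "norm (q * (c * c' / (\<Prod>i\<in>I. x i) * (\<Prod>j\<in>J. b j))) < 1"
  shows "(b j2 - b j3) * ((1 - b j1 * c) * (1 - b j1 * c') * kseries I x J (b(j1 := q * b j1)) B c c')
   + (b j3 - b j1) * ((1 - b j2 * c) * (1 - b j2 * c') * kseries I x J (b(j2 := q * b j2)) B c c')
   + (b j1 - b j2) * ((1 - b j3 * c) * (1 - b j3 * c') * kseries I x J (b(j3 := q * b j3)) B c c') = 0"
proof -
  have fin: "finite I" using gen by (simp add: generic_nodes_def)
  have xk: "x k \<noteq> 0" if "k \<in> I" for k using gen that by (simp add: generic_nodes_def)
  \<comment> \<open>The slopes \<open>Suc j\<close> are nonzero and distinct, so only countably many \<open>w\<close> violate the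
    assumptions of \<open>generic_series\<close>.\<close>
  define \<beta> where "\<beta> = (\<lambda>w j. b j + of_nat (Suc j) * w)"
  define S where "S = {w. norm (q * (c * c' / (\<Prod>i\<in>I. x i) * (\<Prod>j\<in>J. \<beta> w j))) < 1}"
  define K where "K = (\<lambda>j w. kseries I x J ((\<beta> w)(j := q * \<beta> w j)) (B + w) c c')"
  define G where "G = (\<lambda>w. (\<beta> w j2 - \<beta> w j3) * ((1 - \<beta> w j1 * c) * (1 - \<beta> w j1 * c') * K j1 w)
   + (\<beta> w j3 - \<beta> w j1) * ((1 - \<beta> w j2 * c) * (1 - \<beta> w j2 * c') * K j2 w)
   + (\<beta> w j1 - \<beta> w j2) * ((1 - \<beta> w j3 * c) * (1 - \<beta> w j3 * c') * K j3 w))"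
  define N where "N = {w. \<beta> w j1 = \<beta> w j2} \<union> {w. \<beta> w j2 = \<beta> w j3} \<union> {w. \<beta> w j3 = \<beta> w j1}
     \<union> {w. B + w = 0}
     \<union> (\<Union>k\<in>I. \<Union>n. {w. 1 - c * c' * (B + w) * x k * q ^ n / q = 0})
     \<union> (\<Union>j\<in>J. \<Union>n. {w. 1 - c * c' * (B + w) * \<beta> w j * q ^ n = 0})
     \<union> (\<Union>j\<in>J. \<Union>k\<in>I. \<Union>n. {w. \<beta> w j - x k * q ^ n / q = 0})"
  have hol\<beta>: "(\<lambda>w. \<beta> w j) holomorphic_on A" for j A
    unfolding \<beta>_def by (intro holomorphic_on_add holomorphic_on_mult holomorphic_on_const holomorphic_on_ident)
  have openS: "open S"
    unfolding S_def \<beta>_def by (intro open_Collect_less continuous_intros)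
  have cN: "countable N"
  proof -
    have 1: "finite {w. \<beta> w i = \<beta> w j}" if "i \<noteq> j" for i j
    proof (rule finite_subset[OF _ finite_affine_zero[of "of_nat (Suc i) - of_nat (Suc j)" "b i" "b j"]])
      show "(of_nat (Suc i) - of_nat (Suc j) :: complex) \<noteq> 0"
        using that by (metis eq_iff_diff_eq_0 nat.inject of_nat_eq_iff)
    qed (auto simp: \<beta>_def algebra_simps)
    have 2: "finite {w. 1 - c * c' * (B + w) * x k * q ^ n / q = 0}" if k: "k \<in> I" for k n
    proof (rule finite_subset[OF _ finite_affine_zero[of "c * c' * x k * q ^ n / q" "c * c' * B * x k * q ^ n / q" 1]])
      show "c * c' * x k * q ^ n / q \<noteq> 0" using c xk[OF k] q_nz by simp
    qed (auto simp: algebra_simps add_divide_distrib)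
    have 3: "finite {w. 1 - c * c' * (B + w) * \<beta> w j * q ^ n = 0}" for j n
    proof (rule finite_subset[OF _ finite_quadratic_zero[of "of_nat (Suc j)" B "b j" "1 / (c * c' * q ^ n)"]])
      show "{w. 1 - c * c' * (B + w) * \<beta> w j * q ^ n = 0} \<subseteq> {w. (B + w) * (b j + of_nat (Suc j) * w) = 1 / (c * c' * q ^ n)}"
      proof
        fix w assume "w \<in> {w. 1 - c * c' * (B + w) * \<beta> w j * q ^ n = 0}"
        then have "(c * c' * q ^ n) * ((B + w) * \<beta> w j) = 1" by (simp add: mult_ac)
        then show "w \<in> {w. (B + w) * (b j + of_nat (Suc j) * w) = 1 / (c * c' * q ^ n)}"
          using c q_nz by (simp add: \<beta>_def eq_divide_eq mult_ac)
      qed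
      show "of_nat (Suc j) \<noteq> (0 :: complex)" by (rule of_nat_neq_0)
    qed
    have 4: "finite {w. \<beta> w j - x k * q ^ n / q = 0}" for j k n
    proof (rule finite_subset[OF _ finite_affine_zero[of "of_nat (Suc j)" "b j" "x k * q ^ n / q"]])
      show "of_nat (Suc j) \<noteq> (0 :: complex)" by (rule of_nat_neq_0)
    qed (auto simp: \<beta>_def)
    have 5: "finite {w. B + w = 0}" using finite_affine_zero[of 1 B 0] by simp
    have 6: "countable (\<Union>k\<in>I. \<Union>n. {w. 1 - c * c' * (B + w) * x k * q ^ n / q = 0})"
      by (rule countable_UN[OF countable_finite[OF fin]], rule countable_UN)
        (simp_all only: countable_finite 2 countableI_type)
    have 7: "countable (\<Union>j\<in>J. \<Union>n. {w. 1 - c * c' * (B + w) * \<beta> w j * q ^ n = 0})"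
      by (rule countable_UN[OF countable_finite[OF J(1)]], rule countable_UN)
        (simp_all only: countable_finite 3 countableI_type)
    have 8: "countable (\<Union>j\<in>J. \<Union>k\<in>I. \<Union>n. {w. \<beta> w j - x k * q ^ n / q = 0})"
      by (rule countable_UN[OF countable_finite[OF J(1)]], rule countable_UN[OF countable_finite[OF fin]], rule countable_UN)
        (simp_all only: countable_finite 4 countableI_type)
    show ?thesis
      unfolding N_def countable_Un_iff
      using 6 7 8 countable_finite[OF 5] countable_finite[OF 1[OF j(4)]] countable_finite[OF 1[OF j(5)]]
        countable_finite[OF 1[OF j(6)]] by blast
  qed
  have pr: "(\<Prod>k\<in>J. ((\<beta> w)(j := q * \<beta> w j)) k) = (\<Prod>k\<in>J. \<beta> w k) * q" if "j \<in> J" for j w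
    using prod_fun_upd_mult[OF J(1) that, of "\<lambda>y. y" "q * \<beta> w j" "\<beta> w" q] by simp
  have K: "K j holomorphic_on S" if jJ: "j \<in> J" for j
    unfolding K_def
  proof (rule holomorphic_kseries[OF gen J(1) openS])
    fix k show "(\<lambda>w. ((\<beta> w)(j := q * \<beta> w j)) k) holomorphic_on S"
      using hol\<beta> by (cases "k = j") (auto intro!: holomorphic_on_mult)
    show "(\<lambda>w. B + w) holomorphic_on S" by (intro holomorphic_on_add holomorphic_on_const holomorphic_on_ident)
    fix w assume "w \<in> S"
    then show "norm (c * c' / (\<Prod>i\<in>I. x i) * (\<Prod>k\<in>J. ((\<beta> w)(j := q * \<beta> w j)) k)) < 1"
      unfolding S_def pr[OF jJ] by (simp only: mem_Collect_eq mult_ac)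
  qed
  have "G 0 = 0"
  proof (rule continuous_zero_off_countable[where f = G and w = 0 and S = S and N = N])
    show "continuous_on S G" unfolding G_def
      by (intro holomorphic_on_imp_continuous_on holomorphic_on_add holomorphic_on_mult holomorphic_on_diff
            holomorphic_on_const hol\<beta> K j)
    show "(0 :: complex) \<in> S" using lt by (simp add: S_def \<beta>_def)
    fix w assume w: "w \<in> S - N"
    interpret generic_series q I x J "\<beta> w" "B + w" c c' j1 j2 j3
    proof
      show "\<beta> w j1 \<noteq> \<beta> w j2" "\<beta> w j2 \<noteq> \<beta> w j3" "\<beta> w j3 \<noteq> \<beta> w j1" "B + w \<noteq> 0"
        using w unfolding N_def by blast+
      show "1 - c * c' * (B + w) * x k * q ^ n / q \<noteq> 0" if "k \<in> I" for k n
        using w that unfolding N_def by blast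
      show "1 - c * c' * (B + w) * \<beta> w j * q ^ n \<noteq> 0" if "j \<in> J" for j n
        using w that unfolding N_def by blast
      show "\<beta> w j - x k * q ^ n / q \<noteq> 0" if "j \<in> {j1, j2, j3}" "k \<in> I" for j k n
      proof -
        have "j \<in> J" using that(1) j by blast
        show ?thesis
        proof
          assume "\<beta> w j - x k * q ^ n / q = 0"
          then have "w \<in> (\<Union>j\<in>J. \<Union>k\<in>I. \<Union>n. {w. \<beta> w j - x k * q ^ n / q = 0})"
            using \<open>j \<in> J\<close> that(2) by blast
          then have "w \<in> N" unfolding N_def by (rule UnI2)
          then show False using w by blast
        qed
      qed
    qed (fact gen J j c)+
    show "G w = 0"
      unfolding G_def K_def using three_term_generic w by (auto simp: S_def)
  qed (use openS cN in auto)
  then show ?thesis by (simp add: G_def K_def \<beta>_def)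
qed

subsection \<open>Induction on the dimension\<close>

lemma qmono_0 [simp]: "qmono b y 0 = 1"
  by (simp add: qmono_def)

lemma qmono_self: "n > 0 \<Longrightarrow> qmono y y n = 0"
  by (auto simp: qmono_def intro!: bexI[of _ 0])

lemma qmono_eq_qpoch:
  assumes "b \<noteq> 0"
  shows "qmono b y n = b ^ n * R (y / b) n"
proof -
  have "qmono b y n = (\<Prod>k<n. b * (1 - y / b * q ^ k))"
    unfolding qmono_def using assms by (intro prod.cong) (auto simp: field_simps)
  then show ?thesis by (simp add: prod.distrib qpoch_def)
qed

lemma kterm_zero:
  assumes "finite I" "finite J" "i \<in> I" "j \<in> J" "b j = x i" "l i > 0"
  shows "kterm I x J b B c c' l = 0"
proof -
  have "(\<Prod>k\<in>I. qmono (b j) (x k) (l k)) = 0"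
    using assms qmono_self[of "l i" "x i"] by (auto intro!: bexI[of _ i])
  then have "(\<Prod>j\<in>J. P (c * c' * B * b j * q ^ sum l I) * (\<Prod>i\<in>I. qmono (b j) (x i) (l i))) = 0"
    using assms by (auto intro!: bexI[of _ j])
  then show ?thesis by (simp add: kterm_def)
qed

lemma kterm_cong:
  assumes "\<And>i. i \<in> I \<Longrightarrow> l i = l' i"
  shows "kterm I x J b B c c' l = kterm I x J b B c c' l'"
proof -
  have 1: "sum l I = sum l' I" by (rule sum.cong[OF refl assms])
  have 2: "vdm_ratio I x l = vdm_ratio I x l'"
    unfolding vdm_ratio_def by (rule prod.cong) (auto simp: pairs_def assms)
  have 3: "(\<Prod>i\<in>I. kfac I x c c' e s i (l i)) = (\<Prod>i\<in>I. kfac I x c c' e s i (l' i))" for e s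
    by (rule prod.cong) (auto simp: assms)
  have 4: "(\<Prod>i\<in>I. qmono y (x i) (l i)) = (\<Prod>i\<in>I. qmono y (x i) (l' i))" for y
    by (rule prod.cong) (auto simp: assms)
  show ?thesis unfolding kterm_def 1 2 3 4 ..
qed

text \<open>The three factors that couple the node \<open>m\<close> with the node \<open>k\<close>
  when \<open>b j = x m\<close> and \<open>l m = 0\<close>: one from the Vandermonde product, one
  from the numerator of \<open>b j\<close>, one from the denominator of \<open>kfac\<close>.\<close>

lemma kterm_remove_factor:
  assumes gen: "generic_nodes I x c c'" and m: "m \<in> I" "k \<in> I" "k \<noteq> m"
  shows "(x m - x k * q ^ n) / (x m - x k) * qmono (x m) (x k) n / R (q * x k / x m) n = x m ^ n"
proof -
  have xm: "x m \<noteq> 0" using gen m by (simp add: generic_nodes_def)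
  have ne: "x m \<noteq> x k" "x m \<noteq> x k * q ^ n"
    using generic_nodes_neq[OF gen m(1,2), of 0 0] generic_nodes_neq[OF gen m(1,2), of 0 n] m(3) by auto
  have R_nz: "R (q * x k / x m) n \<noteq> 0"
    by (rule qpoch_nonzero[OF generic_nodes_qpoch_inf[OF gen m(2,1)]])
  have eq: "R (x k / x m) n * (1 - x k / x m * q ^ n) = (1 - x k / x m) * R (q * x k / x m) n"
    using qpoch_Suc[of "x k / x m" n] qpoch_Suc_left[of "x k / x m" n] by (simp add: mult_ac)
  have a: "x m - x k * q ^ n = x m * (1 - x k / x m * q ^ n)" "x m - x k = x m * (1 - x k / x m)"
    using xm by (simp_all add: right_diff_distrib)
  have nz: "1 - x k / x m \<noteq> 0" using ne xm by simp
  have "(x m - x k * q ^ n) / (x m - x k) * qmono (x m) (x k) n / R (q * x k / x m) n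
      = x m ^ n * (R (x k / x m) n * (1 - x k / x m * q ^ n)) / ((1 - x k / x m) * R (q * x k / x m) n)"
    unfolding qmono_eq_qpoch[OF xm] a using xm by (simp add: mult_ac)
  also have "\<dots> = x m ^ n" unfolding eq using nz R_nz by simp
  finally show ?thesis .
qed

text \<open>The powers \<open>x m ^ l k\<close> combine to \<open>x m ^ s\<close> and cancel
  \<open>x m\<close> in the argument of the series. The factors that involve only \<open>m\<close>
  join with the product of \<open>b j\<close> to an infinite product that does not depend on
  \<open>l\<close>.\<close>

lemma kterm_remove:
  assumes gen: "generic_nodes I x c c'" and J: "finite J" "j \<in> J" and m: "m \<in> I"
    and b: "b j = x m" and l: "l m = 0"
  shows "kterm I x J b B c c' l = P (c * c' * B * x m / q) * kterm (I - {m}) x (J - {j}) b B c c' l"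
proof -
  have fin: "finite I" and xm: "x m \<noteq> 0" using gen m by (auto simp: generic_nodes_def)
  define e where "e = c * c' * B"
  define I' where "I' = I - {m}"
  define s where "s = sum l I'"
  have s: "sum l I = s" unfolding s_def I'_def using sum.remove[OF fin m, of l] l by simp
  define X where "X = (\<Prod>i\<in>I'. x i)"
  define V where "V = (\<Prod>k\<in>I'. (x m - x k * q ^ l k) / (x m - x k))"
  define Q where "Q = (\<Prod>k\<in>I'. qmono (x m) (x k) (l k))"
  define D where "D = (\<Prod>k\<in>I'. R (q * x k / x m) (l k))"
  have X: "(\<Prod>i\<in>I. x i) = x m * X" unfolding X_def I'_def by (rule prod.remove[OF fin m])
  have vdm: "vdm_ratio I x l = V * vdm_ratio I' x l"
    unfolding vdm_ratio_remove[OF fin m] V_def I'_def using l by simp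
  have kf: "kfac I x c c' e s k n = kfac I' x c c' e s k n / R (q * x k / x m) n" if "k \<in> I" for k n
    unfolding kfac_def I'_def prod.remove[OF fin m, of "\<lambda>j. R (q * x k / x j) n"] by simp
  have N: "(\<Prod>k\<in>I. kfac I x c c' e s k (l k))
      = (1 - e * x m * q ^ s / q) * R (e * x m / q) s * ((\<Prod>k\<in>I'. kfac I' x c c' e s k (l k)) / D)"
  proof -
    have "(\<Prod>k\<in>I. kfac I x c c' e s k (l k)) = kfac I x c c' e s m (l m) * (\<Prod>k\<in>I'. kfac I x c c' e s k (l k))"
      unfolding I'_def by (rule prod.remove[OF fin m])
    also have "(\<Prod>k\<in>I'. kfac I x c c' e s k (l k)) = (\<Prod>k\<in>I'. kfac I' x c c' e s k (l k) / R (q * x k / x m) (l k))"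
      by (rule prod.cong[OF refl kf]) (simp add: I'_def)
    also have "\<dots> = (\<Prod>k\<in>I'. kfac I' x c c' e s k (l k)) / D" unfolding prod_dividef D_def ..
    also have "kfac I x c c' e s m (l m) = (1 - e * x m * q ^ s / q) * R (e * x m / q) s"
      by (simp add: kfac_def l)
    finally show ?thesis .
  qed
  have qm: "(\<Prod>i\<in>I. qmono y (x i) (l i)) = (\<Prod>i\<in>I'. qmono y (x i) (l i))" for y
    unfolding I'_def prod.remove[OF fin m, of "\<lambda>i. qmono y (x i) (l i)"] using l by simp
  have Jp: "(\<Prod>j\<in>J. P (e * b j * q ^ s) * (\<Prod>i\<in>I. qmono (b j) (x i) (l i)))
      = P (e * x m * q ^ s) * Q * (\<Prod>j\<in>J - {j}. P (e * b j * q ^ s) * (\<Prod>i\<in>I'. qmono (b j) (x i) (l i)))"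
    unfolding qm Q_def prod.remove[OF J, of "\<lambda>j. P (e * b j * q ^ s) * (\<Prod>i\<in>I'. qmono (b j) (x i) (l i))"] b ..
  have VQD: "V * Q / D = x m ^ s"
  proof -
    have "V * Q / D = (\<Prod>k\<in>I'. (x m - x k * q ^ l k) / (x m - x k) * qmono (x m) (x k) (l k) / R (q * x k / x m) (l k))"
      unfolding V_def Q_def D_def by (simp only: prod_dividef prod.distrib)
    also have "\<dots> = (\<Prod>k\<in>I'. x m ^ l k)"
      by (rule prod.cong[OF refl kterm_remove_factor[OF gen m]]) (auto simp: I'_def)
    finally show ?thesis by (simp add: power_sum s_def I'_def)
  qed
  have Pe: "(1 - e * x m * q ^ s / q) * R (e * x m / q) s * P (e * x m * q ^ s) = P (e * x m / q)"
    using qpoch_inf_shift[of "e * x m / q" "Suc s"] q_nz by (simp add: qpoch_Suc mult_ac)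
  have z: "(c * c' / (x m * X)) ^ s * x m ^ s = (c * c' / X) ^ s"
    using xm by (simp flip: power_mult_distrib)
  have alg: "Z * (V * v) * (h * r * (k / D)) * BB * (p * Q * w) = (h * r * p) * ((Z * (V * Q / D)) * v * k * BB * w)"
    for Z v h r k BB p w
    by simp
  show ?thesis
    unfolding kterm_def s I'_def[symmetric] s_def[symmetric] e_def[symmetric] X X_def[symmetric] vdm N Jp
    unfolding alg VQD z Pe ..
qed

lemma kseries_remove:
  assumes gen: "generic_nodes I x c c'" and J: "finite J" "j \<in> J" and m: "m \<in> I" and b: "b j = x m"
  shows "kseries I x J b B c c' = P (c * c' * B * x m / q) * kseries (I - {m}) x (J - {j}) b B c c'"
proof -
  have fin: "finite I" using gen by (auto simp: generic_nodes_def)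
  define f where "f = kterm (I - {m}) x (J - {j}) b B c c'"
  have "kseries I x J b B c c' = (\<Sum>\<^sub>\<infinity>l\<in>{l \<in> I \<rightarrow>\<^sub>E UNIV. l m = 0}. P (c * c' * B * x m / q) * f l)"
    unfolding kseries_def
  proof (rule infsum_cong_neutral)
    fix l :: "nat \<Rightarrow> nat" assume "l \<in> (I \<rightarrow>\<^sub>E UNIV) - {l \<in> I \<rightarrow>\<^sub>E UNIV. l m = 0}"
    then show "kterm I x J b B c c' l = 0"
      by (intro kterm_zero[where i = m and j = j]) (use fin J m b in auto)
  next
    fix l :: "nat \<Rightarrow> nat" assume "l \<in> (I \<rightarrow>\<^sub>E UNIV) \<inter> {l \<in> I \<rightarrow>\<^sub>E UNIV. l m = 0}"
    then have "l m = 0" by blast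
    then show "kterm I x J b B c c' l = P (c * c' * B * x m / q) * f l"
      unfolding f_def by (rule kterm_remove[where b = b and x = x and m = m and j = j, OF gen J m b])
  qed auto
  also have "\<dots> = P (c * c' * B * x m / q) * (\<Sum>\<^sub>\<infinity>l\<in>{l \<in> I \<rightarrow>\<^sub>E UNIV. l m = 0}. f l)"
    by (rule infsum_cmult_right')
  also have "(\<Sum>\<^sub>\<infinity>l\<in>{l \<in> I \<rightarrow>\<^sub>E UNIV. l m = 0}. f l) = (\<Sum>\<^sub>\<infinity>l\<in>(I - {m}) \<rightarrow>\<^sub>E UNIV. f l)"
  \<comment> \<open>Extensional functions on \<open>I - {m}\<close> have the value
    \<open>undefined\<close> at \<open>m\<close>, whereas the surviving indices on \<open>I\<close>
    have the value \<open>0\<close> there.\<close>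
  proof (rule infsum_reindex_bij_witness[where i = "\<lambda>l. l(m := 0)" and j = "\<lambda>l. l(m := undefined)"])
    fix l :: "nat \<Rightarrow> nat" assume "l \<in> {l \<in> I \<rightarrow>\<^sub>E (UNIV :: nat set). l m = 0}"
    then show "(l(m := undefined))(m := 0) = l" "l(m := undefined) \<in> (I - {m}) \<rightarrow>\<^sub>E UNIV"
      by (auto simp: PiE_iff extensional_def)
    show "f (l(m := undefined)) = f l"
      unfolding f_def by (rule kterm_cong) auto
  next
    fix l :: "nat \<Rightarrow> nat" assume l: "l \<in> (I - {m}) \<rightarrow>\<^sub>E (UNIV :: nat set)"
    then show "(l(m := 0))(m := undefined) = l"
      by (auto simp: PiE_iff extensional_def)
    show "l(m := 0) \<in> {l \<in> I \<rightarrow>\<^sub>E UNIV. l m = 0}"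
      using l m by (auto simp: PiE_iff extensional_def)
  qed
  finally show ?thesis unfolding kseries_def f_def .
qed

text \<open>In the integrand the numerator factor of \<open>x m\<close> cancels the denominator
  factor of \<open>b j\<close>, and \<open>jalpha\<close> is unchanged; only the two normalizing
  factors of \<open>b j\<close> remain.\<close>

lemma jnorm_remove:
  assumes "finite I" "finite J" "m \<in> I" "j \<in> J" "b j = x m" "x m \<noteq> 0"
  shows "jnorm I x J b c c' = P (c * x m) * P (c' * x m) * jnorm (I - {m}) x (J - {j}) b c c'"
proof -
  have al: "jalpha I x J b c c' = jalpha (I - {m}) x (J - {j}) b c c'"
    unfolding jalpha_def prod.remove[OF assms(1,3), of x] prod.remove[OF assms(2,4), of b]
    using assms by simp
  have jt: "jterm I x J b \<alpha> u v n = P (u * x m) * jterm (I - {m}) x (J - {j}) b \<alpha> u v n" for \<alpha> u v n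
  proof -
    have "P (u * x m) = R (b j * u) n * P (x m * u * q ^ n)"
      using qpoch_inf_shift[of "x m * u" n] assms(5) by (simp add: mult_ac)
    then show ?thesis
      unfolding jterm_def prod.remove[OF assms(1,3), of "\<lambda>i. P (x i * u * q ^ n)"]
        prod.remove[OF assms(2,4), of "\<lambda>j. R (b j * u) n"] by simp
  qed
  have jh: "jhalf I x J b \<alpha> u v = P (u * x m) * jhalf (I - {m}) x (J - {j}) b \<alpha> u v" for \<alpha> u v
    unfolding jhalf_def jt by (rule infsum_cmult_right')
  have pr: "(\<Prod>k\<in>J. P (b k * u)) = P (u * x m) * (\<Prod>k\<in>J - {j}. P (b k * u))" for u
    unfolding prod.remove[OF assms(2,4), of "\<lambda>k. P (b k * u)"] assms(5) by (simp add: mult.commute)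
  show ?thesis unfolding jnorm_def al jh pr by (simp add: algebra_simps)
qed

text \<open>The defect of the identity to be proved; the index \<open>j0\<close> plays the role of \<open>M + 3\<close> in part (ii).\<close>

definition mdiff :: "nat set \<Rightarrow> (nat \<Rightarrow> complex) \<Rightarrow> nat set \<Rightarrow> nat \<Rightarrow> complex \<Rightarrow> complex \<Rightarrow> (nat \<Rightarrow> complex) \<Rightarrow> complex"
  where
  "mdiff I x J j0 c c' b = (\<Prod>i\<in>I. P (c * c' * b j0 * x i / q)) * jnorm I x (insert j0 J) b c c'
     - jconst c c' * P (c * c' / (\<Prod>i\<in>I. x i) * (\<Prod>j\<in>J. b j)) * (\<Prod>i\<in>I. P (c * x i) * P (c' * x i))
       * kseries I x J b (b j0) c c'"

lemma three_term_combine: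
  fixes A :: complex
  assumes "d1 * (u1 * J1) + d2 * (u2 * J2) + d3 * (u3 * J3) = 0"
    and "d1 * (u1 * K1) + d2 * (u2 * K2) + d3 * (u3 * K3) = 0"
  shows "d1 * (u1 * (A * J1 - C * K1)) + d2 * (u2 * (A * J2 - C * K2)) + d3 * (u3 * (A * J3 - C * K3)) = 0"
proof -
  have "d1 * (u1 * (A * J1 - C * K1)) + d2 * (u2 * (A * J2 - C * K2)) + d3 * (u3 * (A * J3 - C * K3))
    = A * (d1 * (u1 * J1) + d2 * (u2 * J2) + d3 * (u3 * J3)) - C * (d1 * (u1 * K1) + d2 * (u2 * K2) + d3 * (u3 * K3))"
    by (simp add: algebra_simps)
  then show ?thesis unfolding assms by simp
qed

lemma mdiff_three_term:
  assumes gen: "generic_nodes I x c c'" and J: "finite J" "card J = card I + 2" and j0: "j0 \<notin> J"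
    and j: "j1 \<in> J" "j2 \<in> J" "j3 \<in> J" "j1 \<noteq> j2" "j2 \<noteq> j3" "j3 \<noteq> j1"
    and c: "c \<noteq> 0" "c' \<noteq> 0"
    and lt: "norm (q * (c * c' / (\<Prod>i\<in>I. x i) * (\<Prod>j\<in>J. b j))) < 1"
  shows "(b j2 - b j3) * ((1 - b j1 * c) * (1 - b j1 * c') * mdiff I x J j0 c c' (b(j1 := q * b j1)))
   + (b j3 - b j1) * ((1 - b j2 * c) * (1 - b j2 * c') * mdiff I x J j0 c c' (b(j2 := q * b j2)))
   + (b j1 - b j2) * ((1 - b j3 * c) * (1 - b j3 * c') * mdiff I x J j0 c c' (b(j3 := q * b j3))) = 0"
proof -
  have fin: "finite I" using gen by (auto simp: generic_nodes_def)
  define A where "A = (\<Prod>i\<in>I. P (c * c' * b j0 * x i / q))"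
  define C where "C = jconst c c' * P (q * (c * c' / (\<Prod>i\<in>I. x i) * (\<Prod>j\<in>J. b j))) * (\<Prod>i\<in>I. P (c * x i) * P (c' * x i))"
  have md: "mdiff I x J j0 c c' (b(j := q * b j))
      = A * jnorm I x (insert j0 J) (b(j := q * b j)) c c' - C * kseries I x J (b(j := q * b j)) (b j0) c c'"
    if jJ: "j \<in> J" for j
  proof -
    have ne: "j0 \<noteq> j" using jJ j0 by blast
    have pr: "(\<Prod>k\<in>J. (b(j := q * b j)) k) = (\<Prod>k\<in>J. b k) * q"
      using prod_fun_upd_mult[OF J(1) jJ, of "\<lambda>y. y" "q * b j" b q] by simp
    have z: "c * c' / (\<Prod>i\<in>I. x i) * ((\<Prod>k\<in>J. b k) * q) = q * (c * c' / (\<Prod>i\<in>I. x i) * (\<Prod>k\<in>J. b k))" by simp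
    have b0: "(b(j := q * b j)) j0 = b j0" using ne by simp
    show ?thesis unfolding mdiff_def pr z b0 A_def C_def ..
  qed
  have finJ: "finite (insert j0 J)" using J by simp
  have jI: "j1 \<in> insert j0 J" "j2 \<in> insert j0 J" "j3 \<in> insert j0 J" using j by simp_all
  show ?thesis
    unfolding md[OF j(1)] md[OF j(2)] md[OF j(3)]
    by (rule three_term_combine[OF jnorm_three_term[OF fin finJ jI] kseries_three_term[OF gen J j c lt]])
qed

lemma holomorphic_mdiff:
  assumes gen: "generic_nodes I x c c'" and J: "finite J" "j \<in> J" and j0: "j0 \<notin> J" and S: "open S"
    and lt: "\<And>w. w \<in> S \<Longrightarrow> norm (c * c' / (\<Prod>i\<in>I. x i) * (w * (\<Prod>k\<in>J - {j}. b k))) < 1"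
  shows "(\<lambda>w. mdiff I x J j0 c c' (b(j := w))) holomorphic_on S"
proof -
  have fin: "finite I" and xnz: "\<And>i. i \<in> I \<Longrightarrow> x i \<noteq> 0" using gen by (auto simp: generic_nodes_def)
  have ne: "(b(j := w)) j0 = b j0" for w using J j0 by auto
  have pr: "(\<Prod>k\<in>J. (b(j := w)) k) = w * (\<Prod>k\<in>J - {j}. b k)" for w
    using prod_fun_upd[OF J, of "\<lambda>y. y" b w] .
  have hb: "(\<lambda>w. (b(j := w)) k) holomorphic_on S" for k
    by (cases "k = j") simp_all
  have hb0: "(\<lambda>w. b j0) holomorphic_on S" by simp
  have 1: "(\<lambda>w. jnorm I x (insert j0 J) (b(j := w)) c c') holomorphic_on S"
    by (rule holomorphic_jnorm[OF fin _ S hb xnz]) (use J in simp_all)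
  have 2: "(\<lambda>w. kseries I x J (b(j := w)) (b j0) c c') holomorphic_on S"
    by (rule holomorphic_kseries[OF gen J(1) S hb hb0]) (simp only: pr lt)
  have 3: "(\<lambda>w. P (c * c' / (\<Prod>i\<in>I. x i) * (w * (\<Prod>k\<in>J - {j}. b k)))) holomorphic_on S"
    by (rule holomorphic_qpoch_inf)
      (intro holomorphic_on_mult holomorphic_on_const holomorphic_on_ident)
  show ?thesis
    unfolding mdiff_def ne pr
    by (intro holomorphic_on_diff holomorphic_on_mult holomorphic_on_const 1 2 3)
qed

text \<open>The series has a single term, which supplies the two products with \<open>b j0\<close>.
  The third product of the q-Saalschuetz sum is the factor \<open>P\<close> of the argument
  \<open>c * c' * b j1 * b j2\<close>.\<close>

lemma mdiff_empty:
  assumes J: "card J = 2" "j0 \<notin> J" and c: "c \<noteq> 0" "c' \<noteq> 0"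
  shows "mdiff {} x J j0 c c' b = 0"
proof -
  obtain j1 j2 where j: "J = {j1, j2}" "j1 \<noteq> j2" using J(1) by (meson card_2_iff)
  have J3: "insert j0 J = {j1, j2, j0}" "j1 \<noteq> j2" "j1 \<noteq> j0" "j2 \<noteq> j0" using j J(2) by auto
  have "kseries {} x J b (b j0) c c' = P (c * c' * b j1 * b j0) * P (c * c' * b j2 * b j0)"
    unfolding kseries_def using j by (simp add: kterm_def vdm_ratio_def pairs_def mult_ac)
  then show ?thesis
    unfolding mdiff_def nonterminating_q_Saalschuetz[OF c J3] using j by (simp add: mult_ac)
qed

lemma mdiff_remove:
  assumes gen: "generic_nodes I x c c'" and J: "finite J" "j \<in> J" "j0 \<notin> J" and m: "m \<in> I" and b: "b j = x m"
  shows "mdiff I x J j0 c c' b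
    = P (c * c' * b j0 * x m / q) * (P (c * x m) * P (c' * x m)) * mdiff (I - {m}) x (J - {j}) j0 c c' b"
proof -
  have fin: "finite I" and xm: "x m \<noteq> 0" using gen m by (auto simp: generic_nodes_def)
  have ins: "insert j0 J - {j} = insert j0 (J - {j})" using J by auto
  have jn: "jnorm I x (insert j0 J) b c c' = P (c * x m) * P (c' * x m) * jnorm (I - {m}) x (insert j0 (J - {j})) b c c'"
  proof -
    have f: "finite (insert j0 J)" and jj: "j \<in> insert j0 J" using J by simp_all
    show ?thesis using jnorm_remove[where I = I and J = "insert j0 J" and b = b and x = x and m = m and j = j, OF fin f m jj b xm] unfolding ins .
  qed
  have z: "c * c' / (\<Prod>i\<in>I. x i) * (\<Prod>j\<in>J. b j) = c * c' / (\<Prod>i\<in>I - {m}. x i) * (\<Prod>j\<in>J - {j}. b j)"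
    unfolding prod.remove[OF fin m, of x] prod.remove[OF J(1,2), of b] b using xm by simp
  show ?thesis
    unfolding mdiff_def jn z kseries_remove[where b = b and x = x and m = m and j = j, OF gen J(1,2) m b]
      prod.remove[OF fin m, of "\<lambda>i. P (c * c' * b j0 * x i / q)"]
      prod.remove[OF fin m, of "\<lambda>i. P (c * x i) * P (c' * x i)"]
    by (simp add: algebra_simps)
qed

lemma generic_nodes_subset: "generic_nodes I x c c' \<Longrightarrow> I' \<subseteq> I \<Longrightarrow> generic_nodes I' x c c'"
  unfolding generic_nodes_def by (meson finite_subset subsetD)

lemma open_norm_mult_less: "open {w :: complex. norm (k * w) < 1}"
  by (intro open_Collect_less continuous_intros)

lemma connected_norm_mult_less: "connected {w :: complex. norm (k * w) < 1}"
proof (cases "k = 0")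
  case False
  then have "{w. norm (k * w) < 1} = ball 0 (1 / norm k)"
    by (auto simp: norm_mult field_simps)
  then show ?thesis by simp
qed (simp add: convex_connected)

lemma mdiff_eq_0:
  assumes gen: "generic_nodes I x c c'" and J: "finite J" "card J = card I + 2" and j0: "j0 \<notin> J"
    and c: "c \<noteq> 0" "c' \<noteq> 0"
    and lt: "norm (c * c' / (\<Prod>i\<in>I. x i) * (\<Prod>j\<in>J. b j)) < 1"
  shows "mdiff I x J j0 c c' b = 0"
  using assms
proof (induction "card I" arbitrary: I J b)
  case 0
  then have "I = {}" by (simp add: generic_nodes_def)
  with 0 show ?case using mdiff_empty by simp
next
  case (Suc n)
  note gen = Suc.prems(1) and J = Suc.prems(2,3) and j0 = Suc.prems(4) and c = Suc.prems(5,6)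
  have fin: "finite I" using gen by (simp add: generic_nodes_def)
  obtain m where m: "m \<in> I" using Suc.hyps(2) by fastforce
  have "3 \<le> card J" using J(2) Suc.hyps(2) by simp
  then obtain T where T: "T \<subseteq> J" "card T = 3" by (rule obtain_subset_with_card_n)
  then obtain j1 j2 j3 where T3: "T = {j1, j2, j3}" "j1 \<noteq> j2" "j2 \<noteq> j3" "j3 \<noteq> j1"
    unfolding card_3_iff by blast
  then have j: "j1 \<in> J" "j2 \<in> J" "j3 \<in> J" "j1 \<noteq> j2" "j2 \<noteq> j3" "j3 \<noteq> j1" using T by auto
  have xm: "x m \<noteq> 0" using gen m by (auto simp: generic_nodes_def)
  define \<zeta> where "\<zeta> = c * c' / (\<Prod>i\<in>I. x i)"
  define D where "D = mdiff I x J j0 c c'"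
  have pr_rem: "(\<Prod>k\<in>J. (b(j := w)) k) = w * (\<Prod>k\<in>J - {j}. b k)" if "j \<in> J" for b :: "nat \<Rightarrow> complex" and j w
    using prod_fun_upd[OF J(1) that, of "\<lambda>y. y" b w] .
  have hol: "(\<lambda>w. D (b(j := w))) holomorphic_on {w. norm (\<zeta> * (\<Prod>k\<in>J - {j}. b k) * w) < 1}" if "j \<in> J" for b j
    unfolding D_def
    by (rule holomorphic_mdiff[OF gen J(1) that j0 open_norm_mult_less]) (simp add: \<zeta>_def mult_ac)
  have geometric: "D b = 0" if "b j1 = x m * q ^ N" "norm (\<zeta> * (\<Prod>j\<in>J. b j)) < 1" for N b
    using that
  proof (induction N arbitrary: b)
    case 0
    have b: "b j1 = x m" using 0 by simp
    have z: "c * c' / (\<Prod>i\<in>I. x i) * (\<Prod>j\<in>J. b j) = c * c' / (\<Prod>i\<in>I - {m}. x i) * (\<Prod>j\<in>J - {j1}. b j)"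
      unfolding prod.remove[OF fin m, of x] prod.remove[OF J(1) j(1), of b] b using xm by simp
    have "mdiff (I - {m}) x (J - {j1}) j0 c c' b = 0"
    proof (rule Suc.hyps(1))
      show "n = card (I - {m})" using Suc.hyps(2) m fin by simp
      show "generic_nodes (I - {m}) x c c'" by (rule generic_nodes_subset[OF gen]) auto
      show "card (J - {j1}) = card (I - {m}) + 2" using J j(1) m fin Suc.hyps(2) by simp
      show "norm (c * c' / (\<Prod>i\<in>I - {m}. x i) * (\<Prod>j\<in>J - {j1}. b j)) < 1"
        using 0(2) unfolding \<zeta>_def z .
    qed (use J j0 c in auto)
    then show ?case
      unfolding D_def mdiff_remove[where b = b and x = x and m = m and j = j1, OF gen J(1) j(1) j0 m b] by simp
  next
    case (Suc N)
    have step: "D b = 0" if b1: "b j1 = x m * q ^ Suc N" and lt: "norm (\<zeta> * (\<Prod>j\<in>J. b j)) < 1" and ne: "b j2 \<noteq> b j3" for b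
    proof -
      \<comment> \<open>Chosen so that the shift of \<open>b0\<close> at \<open>j1\<close> is
        \<open>b\<close>, while the shifts at \<open>j2\<close> and \<open>j3\<close> keep the value
        \<open>x m * q ^ N\<close> at \<open>j1\<close> and fall under the induction hypothesis. All
        three shifts have the same product of parameters as \<open>b\<close>, so convergence is
        inherited, although it may fail for \<open>b0\<close> itself.\<close>
      define b0 where "b0 = b(j1 := x m * q ^ N)"
      have b0: "b0 j1 = x m * q ^ N" "b0 j2 = b j2" "b0 j3 = b j3" using j by (auto simp: b0_def)
      have bb: "b0(j1 := q * b0 j1) = b" using b1 by (auto simp: b0_def)
      have pr: "(\<Prod>k\<in>J. (b0(j := q * b0 j)) k) = q * (\<Prod>k\<in>J. b0 k)" if "j \<in> J" for j
        using prod_fun_upd_mult[OF J(1) that, of "\<lambda>y. y" "q * b0 j" b0 q] by (simp add: mult.commute)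
      have lt0: "norm (\<zeta> * (q * (\<Prod>k\<in>J. b0 k))) < 1" using lt pr[OF j(1)] unfolding bb by simp
      have z2: "D (b0(j2 := q * b0 j2)) = 0"
      proof (rule Suc.IH)
        show "(b0(j2 := q * b0 j2)) j1 = x m * q ^ N" using j b0 by simp
        show "norm (\<zeta> * (\<Prod>j\<in>J. (b0(j2 := q * b0 j2)) j)) < 1" unfolding pr[OF j(2)] by (rule lt0)
      qed
      have z3: "D (b0(j3 := q * b0 j3)) = 0"
      proof (rule Suc.IH)
        show "(b0(j3 := q * b0 j3)) j1 = x m * q ^ N" using j b0 by simp
        show "norm (\<zeta> * (\<Prod>j\<in>J. (b0(j3 := q * b0 j3)) j)) < 1" unfolding pr[OF j(3)] by (rule lt0)
      qed
      have "norm (q * (c * c' / (\<Prod>i\<in>I. x i) * (\<Prod>k\<in>J. b0 k))) < 1"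
        using lt0 by (simp only: \<zeta>_def mult_ac)
      from mdiff_three_term[OF gen J j0 j c this]
      have "(b j2 - b j3) * ((1 - b0 j1 * c) * (1 - b0 j1 * c') * D b) = 0"
        using z2 z3 unfolding D_def bb b0(2,3) by simp
      moreover have "1 - b0 j1 * c \<noteq> 0" "1 - b0 j1 * c' \<noteq> 0"
      proof -
        have "P (c * x m) \<noteq> 0" "P (c' * x m) \<noteq> 0" using gen m by (auto simp: generic_nodes_def)
        then have "c * x m * q ^ N \<noteq> 1" "c' * x m * q ^ N \<noteq> 1" unfolding qpoch_inf_nonzero_iff by blast+
        then show "1 - b0 j1 * c \<noteq> 0" "1 - b0 j1 * c' \<noteq> 0" unfolding b0 by (simp_all add: mult_ac)
      qed
      ultimately show ?thesis using ne by simp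
    qed
    define S where "S = {w. norm (\<zeta> * (\<Prod>k\<in>J - {j2}. b k) * w) < 1}"
    have eq: "\<zeta> * (\<Prod>k\<in>J - {j2}. b k) * w = \<zeta> * (\<Prod>k\<in>J. (b(j2 := w)) k)" for w
      unfolding pr_rem[OF j(2)] by simp
    \<comment> \<open>The coefficient \<open>b j2 - b j3\<close> must not vanish in
      \<open>step\<close>; the remaining case follows by continuity in \<open>b j2\<close>. The
      trivial update exhibits \<open>D\<close> as a function of this one variable.\<close>
    have "D (b(j2 := b j2)) = 0"
    proof (rule continuous_zero_off_countable[where f = "\<lambda>w. D (b(j2 := w))" and S = S and N = "{b j3}" and w = "b j2"])
      show "continuous_on S (\<lambda>w. D (b(j2 := w)))"
        unfolding S_def by (rule holomorphic_on_imp_continuous_on[OF hol[OF j(2)]])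
      show "open S" unfolding S_def by (rule open_norm_mult_less)
      show "b j2 \<in> S" using Suc.prems(2) unfolding S_def mem_Collect_eq eq fun_upd_triv .
      fix w assume w: "w \<in> S - {b j3}"
      show "D (b(j2 := w)) = 0"
      proof (rule step)
        show "(b(j2 := w)) j1 = x m * q ^ Suc N" using Suc.prems(1) j by simp
        show "norm (\<zeta> * (\<Prod>j\<in>J. (b(j2 := w)) j)) < 1" using w unfolding S_def eq[symmetric] by simp
        show "(b(j2 := w)) j2 \<noteq> (b(j2 := w)) j3" using w j by simp
      qed
    qed simp
    then show ?case by simp
  qed
  define k where "k = \<zeta> * (\<Prod>k\<in>J - {j1}. b k)"
  define S where "S = {w. norm (k * w) < 1}"
  define U where "U = S \<inter> range (\<lambda>N. x m * q ^ N)"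
  have eq: "k * w = \<zeta> * (\<Prod>k\<in>J. (b(j1 := w)) k)" for w
    unfolding pr_rem[OF j(1)] k_def by simp
  \<comment> \<open>\<open>S\<close> is a disc around \<open>0\<close>, or the whole plane if
    \<open>k = 0\<close>, so it contains \<open>x m * q ^ N\<close> for all large \<open>N\<close>,
    and the accumulation point \<open>0\<close> is interior.\<close>
  have "D (b(j1 := b j1)) = 0"
  proof (rule analytic_continuation[where f = "\<lambda>w. D (b(j1 := w))" and S = S and U = U and \<xi> = 0 and w = "b j1"])
    show "(\<lambda>w. D (b(j1 := w))) holomorphic_on S" unfolding S_def k_def by (rule hol[OF j(1)])
    show "open S" "connected S" unfolding S_def by (rule open_norm_mult_less, rule connected_norm_mult_less)
    show "U \<subseteq> S" "0 \<in> S" by (auto simp: U_def S_def)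
    show "b j1 \<in> S" using Suc.prems(7) unfolding S_def mem_Collect_eq eq fun_upd_triv \<zeta>_def .
    show "0 islimpt U"
      unfolding islimpt_approachable
    proof safe
      fix \<epsilon> :: real assume "\<epsilon> > 0"
      have "(\<lambda>N. x m * q ^ N) \<longlonglongrightarrow> 0" by (rule power_q_LIMSEQ)
      then have "eventually (\<lambda>N. x m * q ^ N \<in> S \<inter> ball 0 \<epsilon>) sequentially"
        using \<open>open S\<close> \<open>0 \<in> S\<close> \<open>\<epsilon> > 0\<close> by (intro topological_tendstoD) auto
      then obtain N where "x m * q ^ N \<in> S \<inter> ball 0 \<epsilon>" by (meson eventually_happens' sequentially_bot)
      then show "\<exists>x'\<in>U. x' \<noteq> 0 \<and> dist x' 0 < \<epsilon>"
        using xm q_nz by (intro bexI[of _ "x m * q ^ N"]) (auto simp: U_def)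
    qed
    fix w assume w: "w \<in> U"
    then obtain N where N: "w = x m * q ^ N" by (auto simp: U_def)
    show "D (b(j1 := w)) = 0"
    proof (rule geometric)
      show "(b(j1 := w)) j1 = x m * q ^ N" using N by simp
      show "norm (\<zeta> * (\<Prod>j\<in>J. (b(j1 := w)) j)) < 1" using w unfolding U_def S_def eq[symmetric] by simp
    qed
  qed
  then show ?case by (simp add: D_def)
qed

lemma main_identity:
  fixes J :: "nat set"
  assumes "generic_nodes I x c c'" "finite J" "card J = card I + 2" "j0 \<notin> J" "c \<noteq> 0" "c' \<noteq> 0"
    and "norm (c * c' / (\<Prod>i\<in>I. x i) * (\<Prod>j\<in>J. b j)) < 1"
  shows "(\<Prod>i\<in>I. P (c * c' * b j0 * x i / q)) * jnorm I x (insert j0 J) b c c'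
     = jconst c c' * P (c * c' / (\<Prod>i\<in>I. x i) * (\<Prod>j\<in>J. b j)) * (\<Prod>i\<in>I. P (c * x i) * P (c' * x i))
       * kseries I x J b (b j0) c c'"
  using mdiff_eq_0[OF assms] unfolding mdiff_def by simp

subsection \<open>Specialization to the integral and to balanced series\<close>

context
  fixes M :: nat and x u b :: "nat \<Rightarrow> complex" and a v1 v2 c c' B z :: complex
  assumes W_def: "kajihara_W_defined q M x a u v1 v2"
    and e: "c * c' * B = a * q" "c * B = v1" "c' * B = v2"
    and bu: "\<And>j. j \<in> {1..M+2} \<Longrightarrow> b j = 1 / u j"
    and z: "z = c * c' / (\<Prod>i=1..M. x i) * (\<Prod>j=1..M+2. b j)"
begin

lemma kaj_nz: "c \<noteq> 0" "c' \<noteq> 0" "B \<noteq> 0"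
  using W_def e by (auto simp: kajihara_W_defined_def)

lemma kaj_v: "a * q * y / v1 = c' * y" "a * q * y / v2 = c * y"
  unfolding e(1)[symmetric] e(2,3)[symmetric] using kaj_nz by (simp_all add: field_simps)

text \<open>A collision of \<open>x i * q ^ m\<close> and \<open>x k * q ^ n\<close> makes a factor
  \<open>R (q * x k / x i)\<close> or \<open>R (q * x i / x k)\<close> vanish if
  \<open>m \<noteq> n\<close>, and the Vandermonde product if \<open>m = n\<close>.\<close>

lemma generic_nodes_of_defined: "generic_nodes {1..M} x c c'"
  unfolding generic_nodes_def
proof (intro conjI ballI impI allI)
  have xnz: "\<And>i. i \<in> {1..M} \<Longrightarrow> x i \<noteq> 0"
    and Rq: "\<And>i j n. i \<in> {1..M} \<Longrightarrow> j \<in> {1..M} \<Longrightarrow> R (q * x i / x j) n \<noteq> 0"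
    and Rv: "\<And>i n. i \<in> {1..M} \<Longrightarrow> R (c' * x i) n \<noteq> 0 \<and> R (c * x i) n \<noteq> 0"
    and vdm: "vdm M x \<noteq> 0"
    using W_def unfolding kajihara_W_defined_def kaj_v by blast+
  show "x i \<noteq> 0" if "i \<in> {1..M}" for i by (rule xnz[OF that])
  show "P (c * x i) \<noteq> 0" if "i \<in> {1..M}" for i
    using Rv[OF that] by (intro qpoch_inf_nonzero) blast
  show "P (c' * x i) \<noteq> 0" if "i \<in> {1..M}" for i
    using Rv[OF that] by (intro qpoch_inf_nonzero) blast
  have less: "x i * q ^ m \<noteq> x k * q ^ (m + Suc n)" if "i \<in> {1..M}" "k \<in> {1..M}" for i k m n
  proof
    assume "x i * q ^ m = x k * q ^ (m + Suc n)"
    then have "x i = q * x k * q ^ n" using q_nz by (simp add: power_add mult_ac)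
    then have "1 - q * x k / x i * q ^ n = 0" using xnz[OF that(1)] by simp
    then have "R (q * x k / x i) (Suc n) = 0" by (simp add: qpoch_Suc)
    then show False using Rq[OF that(2,1)] by blast
  qed
  have eq: "x i \<noteq> x k" if "i \<in> {1..M}" "k \<in> {1..M}" "i < k" for i k
  proof
    assume "x i = x k"
    have fin: "finite {(i, j). 1 \<le> i \<and> i < j \<and> j \<le> M}"
      by (rule finite_subset[of _ "{1..M} \<times> {1..M}"]) auto
    have "vdm M x = 0"
      unfolding vdm_def using fin that \<open>x i = x k\<close> by (auto intro!: bexI[of _ "(i, k)"])
    then show False using vdm by blast
  qed
  fix i k m n assume ik: "i \<in> {1..M}" "k \<in> {1..M}" "i \<noteq> k"
  show "x i * q ^ m \<noteq> x k * q ^ n"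
  proof (cases m n rule: linorder_cases)
    case less
    then obtain r where "n = m + Suc r" using less_iff_Suc_add by auto
    then show ?thesis using \<open>\<And>n m k i. i \<in> {1..M} \<Longrightarrow> k \<in> {1..M} \<Longrightarrow> x i * q ^ m \<noteq> x k * q ^ (m + Suc n)\<close> ik by blast
  next
    case greater
    then obtain r where "m = n + Suc r" using less_iff_Suc_add by auto
    then show ?thesis using \<open>\<And>n m k i. i \<in> {1..M} \<Longrightarrow> k \<in> {1..M} \<Longrightarrow> x i * q ^ m \<noteq> x k * q ^ (m + Suc n)\<close> ik by metis
  next
    case equal
    have "x i \<noteq> x k" using eq[of i k] eq[of k i] ik by (metis linorder_neqE_nat)
    then show ?thesis using equal q_nz by simp
  qed
qed simp

lemma kajihara_term_eq:
  "kajihara_term q M x a u v1 v2 z l * ((\<Prod>j=1..M+2. P (a * q / u j)) * (\<Prod>i=1..M. 1 - a * x i))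
   = kterm {1..M} x {1..M+2} b B c c' l"
proof -
  define s where "s = (\<Sum>i=1..M. l i)"
  have unz: "u j \<noteq> 0" if "j \<in> {1..M+2}" for j using W_def that by (auto simp: kajihara_W_defined_def)
  have anz: "1 - a * x i \<noteq> 0" if "i \<in> {1..M}" for i using W_def that by (auto simp: kajihara_W_defined_def)
  have Rnz: "R (a * q / u j) s \<noteq> 0" if "j \<in> {1..M+2}" for j using W_def that by (auto simp: kajihara_W_defined_def)
  have 1: "vdm M (\<lambda>i. x i * q ^ l i) / vdm M x = vdm_ratio {1..M} x l"
  proof -
    have "pairs {1..M} = {(i, j). 1 \<le> i \<and> i < j \<and> j \<le> M}" by (auto simp: pairs_def)
    then show ?thesis by (simp add: vdm_def vdm_ratio_def case_prod_unfold prod_dividef)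
  qed
  define RR where "RR = (\<lambda>i. \<Prod>j=1..M+2. R (x i * u j) (l i))"
  have 2: "(\<Prod>i=1..M. (1 - a * x i * q ^ (s + l i)) / (1 - a * x i)
        * (R (a * x i) s * (\<Prod>j=1..M+2. R (x i * u j) (l i)))
        / ((\<Prod>j=1..M. R (q * x i / x j) (l i)) * (R (a * q * x i / v1) (l i) * R (a * q * x i / v2) (l i))))
      * (\<Prod>i=1..M. 1 - a * x i)
     = (\<Prod>i=1..M. kfac {1..M} x c c' (c * c' * B) s i (l i)) * (\<Prod>i=1..M. RR i)"
    unfolding prod.distrib[symmetric]
  proof (rule prod.cong[OF refl])
    fix i assume i: "i \<in> {1..M}"
    have aq: "a * q * x i * y / q = a * x i * y" "a * q * x i / q = a * x i" for y
      using q_nz by simp_all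
    have alg: "h / w * (r * rr) / (d * (p' * p)) * w = h * r / (d * (p * p')) * rr" if "w \<noteq> 0" for h w r rr d p p' :: complex
      using that by (simp add: mult_ac)
    show "(1 - a * x i * q ^ (s + l i)) / (1 - a * x i)
        * (R (a * x i) s * (\<Prod>j=1..M+2. R (x i * u j) (l i)))
        / ((\<Prod>j=1..M. R (q * x i / x j) (l i)) * (R (a * q * x i / v1) (l i) * R (a * q * x i / v2) (l i)))
       * (1 - a * x i) = kfac {1..M} x c c' (c * c' * B) s i (l i) * RR i"
      unfolding kaj_v kfac_def e(1) aq RR_def by (rule alg[OF anz[OF i]])
  qed
  \<comment> \<open>The powers of the \<open>b j\<close> contained in \<open>z\<close> are used up
    in turning the factors \<open>R (x i * u j) (l i)\<close> into \<open>qmono\<close>.\<close>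
  have 3: "z ^ s * (\<Prod>i=1..M. RR i) = (c * c' / (\<Prod>i=1..M. x i)) ^ s * (\<Prod>j=1..M+2. \<Prod>i=1..M. qmono (b j) (x i) (l i))"
  proof -
    have "(\<Prod>j=1..M+2. \<Prod>i=1..M. qmono (b j) (x i) (l i)) = (\<Prod>j=1..M+2. b j ^ s * (\<Prod>i=1..M. R (x i * u j) (l i)))"
    proof (rule prod.cong[OF refl])
      fix j assume j: "j \<in> {1..M+2}"
      have bj: "b j \<noteq> 0" "x i / b j = x i * u j" for i using bu[OF j] unz[OF j] by auto
      show "(\<Prod>i=1..M. qmono (b j) (x i) (l i)) = b j ^ s * (\<Prod>i=1..M. R (x i * u j) (l i))"
        unfolding qmono_eq_qpoch[OF bj(1)] bj(2) prod.distrib s_def power_sum ..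
    qed
    also have "\<dots> = (\<Prod>j=1..M+2. b j) ^ s * (\<Prod>j=1..M+2. \<Prod>i=1..M. R (x i * u j) (l i))"
      unfolding prod.distrib prod_power_distrib ..
    also have "(\<Prod>j=1..M+2. \<Prod>i=1..M. R (x i * u j) (l i)) = (\<Prod>i=1..M. RR i)"
      unfolding RR_def by (rule prod.swap)
    finally show ?thesis unfolding z power_mult_distrib by simp
  qed
  have 4: "(\<Prod>j=1..M+2. P (a * q / u j)) / (\<Prod>j=1..M+2. R (a * q / u j) s)
     = (\<Prod>j=1..M+2. P (c * c' * B * b j * q ^ s))"
    unfolding prod_dividef[symmetric]
  proof (rule prod.cong[OF refl])
    fix j assume j: "j \<in> {1..M+2}"
    have "P (a * q / u j) = R (a * q / u j) s * P (a * q / u j * q ^ s)" by (rule qpoch_inf_shift)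
    moreover have "c * c' * B * b j * q ^ s = a * q / u j * q ^ s" unfolding e(1) bu[OF j] by simp
    ultimately show "P (a * q / u j) / R (a * q / u j) s = P (c * c' * B * b j * q ^ s)"
      using Rnz[OF j] by simp
  qed
  have alg: "zs * V * N * (r / D) * (E * F) = zs * V * (N * F) * r * (E / D)" for zs V N r D E F :: complex
    by simp
  have alg2: "zs * V * (K * Rr) * r * Q = (zs * Rr) * V * K * r * Q" for zs V K Rr r Q :: complex
    by simp
  show ?thesis
    unfolding kajihara_term_def Let_def s_def[symmetric] 1 alg 2 4 alg2 3
    unfolding kterm_def e(2,3) s_def[symmetric] prod.distrib by simp
qed

lemma kajihara_W_eq:
  "kajihara_W q M x a u v1 v2 z * ((\<Prod>j=1..M+2. P (a * q / u j)) * (\<Prod>i=1..M. 1 - a * x i))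
   = kseries {1..M} x {1..M+2} b B c c'"
  unfolding kajihara_W_def kseries_def infsum_cmult_left'[symmetric] kajihara_term_eq ..

end

lemma prod_Suc_Suc_Suc: "(\<Prod>k=1..M+3. g k) = (\<Prod>i=1..M. g i) * g (M + 1) * g (M + 2) * g (M + 3)"
  for g :: "nat \<Rightarrow> complex"
  by (simp add: eval_nat_numeral mult_ac)

text \<open>\<open>ends\<close> concerns the product of both numerator factors because they exchange
  roles: at \<open>c\<close> the factor of \<open>a (M + 2)\<close> gives
  \<open>P (q * q ^ n)\<close>, at \<open>c'\<close> that of \<open>a (M + 3)\<close> does.\<close>

lemma jackson0_eq:
  fixes a b :: "nat \<Rightarrow> complex"
  assumes ends: "\<And>n. P (a (M + 2) * (t * q ^ n)) * P (a (M + 3) * (t * q ^ n)) = P (q * q ^ n) * P (q * t / t' * q ^ n)"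
    and nz: "\<And>k. k \<in> {1..M+3} \<Longrightarrow> P (b k * t) \<noteq> 0"
  shows "jackson0 q (\<lambda>t. \<Prod>k=1..M+3. P (a k * t) / P (b k * t)) t * (\<Prod>k=1..M+3. P (b k * t))
    = (1 - q) * (t * jhalf {1..M} a {1..M+3} b (a (M + 1)) t t')"
proof -
  define N where "N = (\<Prod>k=1..M+3. P (b k * t))"
  have N: "N \<noteq> 0" using nz by (simp add: N_def)
  have trm: "(\<Prod>k=1..M+3. P (a k * (t * q ^ n)) / P (b k * (t * q ^ n))) * (t * q ^ n)
      = t / N * jterm {1..M} a {1..M+3} b (a (M + 1)) t t' n" for n
  proof -
    have 1: "(\<Prod>k=1..M+3. P (a k * (t * q ^ n)))
        = P (q * q ^ n) * P (q * t / t' * q ^ n) * (\<Prod>i=1..M. P (a i * t * q ^ n)) * P (a (M + 1) * t * q ^ n)"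
      unfolding prod_Suc_Suc_Suc ends[symmetric] by (simp add: mult_ac)
    have 2: "(\<Prod>k=1..M+3. R (b k * t) n) = N / (\<Prod>k=1..M+3. P (b k * (t * q ^ n)))"
      unfolding N_def prod_dividef[symmetric]
    proof (rule prod.cong[OF refl])
      fix k assume k: "k \<in> {1..M+3}"
      have s: "P (b k * t) = R (b k * t) n * P (b k * (t * q ^ n))"
        using qpoch_inf_shift[of "b k * t" n] by (simp add: mult_ac)
      then have "P (b k * (t * q ^ n)) \<noteq> 0" using nz[OF k] by auto
      then show "R (b k * t) n = P (b k * t) / P (b k * (t * q ^ n))" using s by simp
    qed
    show ?thesis unfolding prod_dividef jterm_def 1 2 using N by simp
  qed
  have "jterm {1..M} a {1..M+3} b (a (M + 1)) t t' sums jhalf {1..M} a {1..M+3} b (a (M + 1)) t t'"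
    unfolding jhalf_def by (intro has_sum_imp_sums has_sum_infsum jterm_summable) simp_all
  then have "(\<lambda>n. t / N * jterm {1..M} a {1..M+3} b (a (M + 1)) t t' n)
      sums (t / N * jhalf {1..M} a {1..M+3} b (a (M + 1)) t t')"
    by (rule sums_mult)
  then show ?thesis
    unfolding jackson0_def trm N_def[symmetric] using N by (simp add: sums_iff)
qed

lemma jackson_integral_eq_jnorm:
  fixes a b :: "nat \<Rightarrow> complex"
  assumes anz: "a (M + 2) \<noteq> 0" "a (M + 3) \<noteq> 0"
  defines "c \<equiv> q / a (M + 2)" and "c' \<equiv> q / a (M + 3)"
  assumes nz: "\<And>k. k \<in> {1..M+3} \<Longrightarrow> P (b k * c) \<noteq> 0" "\<And>k. k \<in> {1..M+3} \<Longrightarrow> P (b k * c') \<noteq> 0"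
    and al: "jalpha {1..M} a {1..M+3} b c c' = a (M + 1)"
  shows "jackson_integral q c c' (\<lambda>t. \<Prod>k=1..M+3. P (a k * t) / P (b k * t))
      * ((\<Prod>k=1..M+3. P (b k * c)) * (\<Prod>k=1..M+3. P (b k * c'))) = (1 - q) * jnorm {1..M} a {1..M+3} b c c'"
proof -
  have cc: "a (M + 2) * (c * y) = q * y" "a (M + 3) * (c * y) = q * c / c' * y"
    "a (M + 3) * (c' * y) = q * y" "a (M + 2) * (c' * y) = q * c' / c * y" for y
    using anz q_nz by (simp_all add: c_def c'_def)
  have 1: "jackson0 q (\<lambda>t. \<Prod>k=1..M+3. P (a k * t) / P (b k * t)) c * (\<Prod>k=1..M+3. P (b k * c))
    = (1 - q) * (c * jhalf {1..M} a {1..M+3} b (a (M + 1)) c c')"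
    by (rule jackson0_eq[OF _ nz(1)]) (simp_all only: cc)
  have 2: "jackson0 q (\<lambda>t. \<Prod>k=1..M+3. P (a k * t) / P (b k * t)) c' * (\<Prod>k=1..M+3. P (b k * c'))
    = (1 - q) * (c' * jhalf {1..M} a {1..M+3} b (a (M + 1)) c' c)"
    by (rule jackson0_eq[OF _ nz(2)]) (unfold cc, rule mult.commute)
  have alg: "(J2 - J1) * (p1 * p2) = (J2 * p2) * p1 - (J1 * p1) * p2" for J1 J2 p1 p2 :: complex
    by (simp add: algebra_simps)
  show ?thesis
    unfolding jackson_integral_def alg 1 2 jnorm_def al by (simp add: algebra_simps)
qed

lemma kajihara_jackson_integral:
  fixes a b :: "nat \<Rightarrow> complex"
  assumes bal: "(\<Prod>k=1..M+3. a k) = q^2 * (\<Prod>k=1..M+3. b k)"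
    and lt: "norm (a (M+1) / b (M+3)) < 1"
    and anz: "a (M+2) \<noteq> 0" "a (M+3) \<noteq> 0" "a (M+2) \<noteq> a (M+3)"
    and bnz: "\<forall>k\<in>{1..M+3}. b k \<noteq> 0"
    and pole: "\<forall>k\<in>{1..M+3}. P (q * b k / a (M+2)) \<noteq> 0 \<and> P (q * b k / a (M+3)) \<noteq> 0"
    and pole': "\<forall>i\<in>{1..M}. P (q^2 * a i * b (M+3) / (a (M+2) * a (M+3))) \<noteq> 0"
    and W_def: "kajihara_W_defined q M a (q * b (M+3) / (a (M+2) * a (M+3))) (\<lambda>j. 1 / b j)
              (q * b (M+3) / a (M+2)) (q * b (M+3) / a (M+3))"
  shows "jackson_integral q (q / a (M+2)) (q / a (M+3)) (\<lambda>t. \<Prod>k=1..M+3. P (a k * t) / P (b k * t))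
      = (\<Prod>i=1..M. P (q * a i / a (M+2)) * P (q * a i / a (M+3)) / P (q^2 * a i * b (M+3) / (a (M+2) * a (M+3))))
        * (\<Prod>j=1..M+2. P (q^2 * b j * b (M+3) / (a (M+2) * a (M+3))))
        * (\<Prod>j=1..M+3. 1 / (P (q * b j / a (M+2)) * P (q * b j / a (M+3))))
        * (P q * P (a (M+1) / b (M+3)) * P (a (M+2) / a (M+3)) * P (a (M+3) / a (M+2)))
        * ((1 - q) * q / (a (M+3) - a (M+2)))
        * kajihara_W q M a (q * b (M+3) / (a (M+2) * a (M+3))) (\<lambda>j. 1 / b j)
            (q * b (M+3) / a (M+2)) (q * b (M+3) / a (M+3)) (a (M+1) / b (M+3))"
proof -
  define c where "c = q / a (M+2)"
  define c' where "c' = q / a (M+3)"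
  define B where "B = b (M+3)"
  define A where "A = q * b (M+3) / (a (M+2) * a (M+3))"
  define z where "z = a (M+1) / b (M+3)"
  have cnz: "c \<noteq> 0" "c' \<noteq> 0" using anz q_nz by (simp_all add: c_def c'_def)
  have Bnz: "B \<noteq> 0" using bnz by (simp add: B_def)
  have e: "c * c' * B = A * q" "c * B = q * b (M+3) / a (M+2)" "c' * B = q * b (M+3) / a (M+3)"
    by (simp_all add: c_def c'_def B_def A_def)
  have xnz: "(\<Prod>i=1..M. a i) \<noteq> 0" using W_def by (simp add: kajihara_W_defined_def)
  \<comment> \<open>The balancing condition solved for \<open>a (M+1)\<close>, which thereby becomes
    \<open>jalpha\<close>; the other two numerator parameters beyond \<open>M\<close> determine the
    end points.\<close>
  have alz: "a (M+1) = c * c' * (\<Prod>k=1..M+3. b k) / (\<Prod>i=1..M. a i)"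
  proof -
    have "a (M+1) * ((\<Prod>i=1..M. a i) * (a (M+2) * a (M+3))) = q^2 * (\<Prod>k=1..M+3. b k)"
      using bal unfolding prod_Suc_Suc_Suc[of a] by (simp add: mult_ac)
    moreover have "c * c' = q^2 / (a (M+2) * a (M+3))" by (simp add: c_def c'_def power2_eq_square)
    ultimately have "(a (M+1) * (\<Prod>i=1..M. a i)) * (a (M+2) * a (M+3))
        = (c * c' * (\<Prod>k=1..M+3. b k)) * (a (M+2) * a (M+3))"
      using anz by (simp add: mult_ac)
    then have "a (M+1) * (\<Prod>i=1..M. a i) = c * c' * (\<Prod>k=1..M+3. b k)"
      using anz by (metis mult_right_cancel no_zero_divisors)
    then show ?thesis using xnz by (simp only: nonzero_eq_divide_eq not_False_eq_True)
  qed
  have pb: "(\<Prod>k=1..M+3. b k) = (\<Prod>k=1..M+2. b k) * B"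
    unfolding B_def by (simp add: eval_nat_numeral)
  have z: "z = c * c' / (\<Prod>i=1..M. a i) * (\<Prod>j=1..M+2. b j)"
    unfolding z_def alz pb using Bnz by (simp add: B_def)
  have J: "finite {1..M+2}" "card {1..M+2} = card {1..M} + 2" "M + 3 \<notin> {1..M+2}" by simp_all
  have ins: "insert (M + 3) {1..M+2} = {1..M+3}" by auto
  have gen: "generic_nodes {1..M} a c c'"
    by (rule generic_nodes_of_defined[OF W_def[folded A_def] e _ z]) simp
  have W: "kajihara_W q M a A (\<lambda>j. 1 / b j) (q * b (M+3) / a (M+2)) (q * b (M+3) / a (M+3)) z
      * ((\<Prod>j=1..M+2. P (A * q / (1 / b j))) * (\<Prod>i=1..M. 1 - A * a i)) = kseries {1..M} a {1..M+2} b B c c'"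
    by (rule kajihara_W_eq[OF W_def[folded A_def] e _ z]) simp
  note main = main_identity[OF gen J cnz, of b, folded z, unfolded ins, folded B_def]
  define W0 where "W0 = kajihara_W q M a A (\<lambda>j. 1 / b j) (q * b (M+3) / a (M+2)) (q * b (M+3) / a (M+3)) z"
  define E where "E = (\<Prod>j=1..M+2. P (A * q * b j))"
  define F where "F = (\<Prod>i=1..M. 1 - A * a i)"
  define G where "G = (\<Prod>i=1..M. P (A * q * a i))"
  define C where "C = (\<Prod>i=1..M. P (c * a i) * P (c' * a i))"
  define N where "N = (\<Prod>k=1..M+3. P (b k * c)) * (\<Prod>k=1..M+3. P (b k * c'))"
  have "1 - A * a i \<noteq> 0" if "i \<in> {1..M}" for i
    using W_def that unfolding A_def kajihara_W_defined_def by blast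
  then have Fnz: "F \<noteq> 0" by (simp add: F_def)
  have Gnz: "G \<noteq> 0"
    using pole' by (simp add: G_def A_def power2_eq_square mult_ac)
  have nz: "P (b k * c) \<noteq> 0" "P (b k * c') \<noteq> 0" if "k \<in> {1..M+3}" for k
    using pole that by (auto simp: c_def c'_def mult.commute)
  have Nnz: "N \<noteq> 0" using nz by (simp add: N_def)
  have ks: "kseries {1..M} a {1..M+2} b B c c' = W0 * (E * F)"
    using W by (simp add: W0_def E_def F_def)
  have AF: "(\<Prod>i=1..M. P (c * c' * B * a i / q)) = F * G"
    unfolding F_def G_def prod.distrib[symmetric] e(1)
  proof (rule prod.cong[OF refl])
    fix i
    have "A * q * a i / q = A * a i" "A * a i * q = A * q * a i" using q_nz by simp_all
    then show "P (A * q * a i / q) = (1 - A * a i) * P (A * q * a i)"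
      using qpoch_inf_step[of "A * a i"] by (simp only:)
  qed
  have "norm z < 1" using lt by (simp add: z_def)
  from main[OF this] have jn: "F * G * jnorm {1..M} a {1..M+3} b c c' = jconst c c' * P z * C * (W0 * (E * F))"
    unfolding AF ks C_def .
  have al: "jalpha {1..M} a {1..M+3} b c c' = a (M+1)"
    unfolding jalpha_def alz ..
  define JI where "JI = jackson_integral q c c' (\<lambda>t. \<Prod>k=1..M+3. P (a k * t) / P (b k * t))"
  have JN: "JI * N = (1 - q) * jnorm {1..M} a {1..M+3} b c c'"
    unfolding JI_def N_def c_def c'_def
    by (rule jackson_integral_eq_jnorm[OF anz(1,2)]) (use nz al in \<open>auto simp: c_def c'_def\<close>)
  have "JI = C / G * E * (1 / N) * ((1 - q) * jconst c c' * P z) * W0"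
  proof -
    have "jnorm {1..M} a {1..M+3} b c c' = jconst c c' * P z * C * W0 * E / G"
      using jn Fnz Gnz by (simp add: eq_divide_eq mult_ac)
    moreover have "JI = (1 - q) * jnorm {1..M} a {1..M+3} b c c' / N"
      unfolding JN[symmetric] using Nnz by simp
    ultimately show ?thesis by simp
  qed
  moreover have "(1 - q) * jconst c c' = P q * P (a (M+2) / a (M+3)) * P (a (M+3) / a (M+2)) * ((1 - q) * q / (a (M+3) - a (M+2)))"
  proof -
    \<comment> \<open>\<open>jconst\<close> contains \<open>c' * P (r * q)\<close>. Since
      \<open>c' = q / (a (M+3) - a (M+2)) * (1 - r)\<close>, the factor \<open>1 - r\<close>
      completes \<open>P (r * q)\<close> to \<open>P r\<close>.\<close>
    define r where "r = a (M+2) / a (M+3)"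
    have r: "c' / c = r" "c / c' = a (M+3) / a (M+2)" "1 - r \<noteq> 0"
      using anz q_nz by (simp_all add: c_def c'_def r_def)
    have "a (M+3) - a (M+2) = a (M+3) * (1 - r)" using anz by (simp add: r_def right_diff_distrib)
    then have k: "q / (a (M+3) - a (M+2)) * (1 - r) = c'" using r(3) by (simp add: c'_def)
    have qr: "q * c' / c = r * q" unfolding r(1)[symmetric] by simp
    have cr: "jconst c c' = q / (a (M+3) - a (M+2)) * (1 - r) * P q * P (r * q) * P (a (M+3) / a (M+2))"
      unfolding jconst_def r(2) qr k ..
    show ?thesis unfolding cr r_def[symmetric] qpoch_inf_step[of r] by simp
  qed
  moreover have "C / G = (\<Prod>i=1..M. P (q * a i / a (M+2)) * P (q * a i / a (M+3)) / P (q^2 * a i * b (M+3) / (a (M+2) * a (M+3))))"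
    unfolding C_def G_def prod_dividef[symmetric] by (simp add: c_def c'_def A_def power2_eq_square mult_ac)
  moreover have "E = (\<Prod>j=1..M+2. P (q^2 * b j * b (M+3) / (a (M+2) * a (M+3))))"
    unfolding E_def by (simp add: A_def power2_eq_square mult_ac)
  moreover have "1 / N = (\<Prod>j=1..M+3. 1 / (P (q * b j / a (M+2)) * P (q * b j / a (M+3))))"
    unfolding N_def prod_dividef prod.distrib by (simp add: c_def c'_def mult_ac)
  ultimately show ?thesis
    unfolding JI_def W0_def c_def[symmetric] c'_def[symmetric] A_def[symmetric] z_def[symmetric]
    by (simp add: mult_ac)
qed

section \<open>Half integrals as basic hypergeometric series, and the case
  \<open>a = 0\<close>\<close>

lemma basic_hypergeom_eq:
  "basic_hypergeom q (\<beta> # map f [1..<M+3]) (\<gamma> # \<delta> # map g [1..<M+1]) w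
   = (\<Sum>l. (R \<beta> l * (\<Prod>j=1..M+2. R (f j) l)) / (R q l * (R \<gamma> l * (R \<delta> l * (\<Prod>i=1..M. R (g i) l)))) * w ^ l)"
proof -
  have 1: "(\<Prod>y\<leftarrow>map f [1..<M+3]. R y l) = (\<Prod>j=1..M+2. R (f j) l)" for l
  proof -
    have "(\<Prod>y\<leftarrow>map f [1..<M+3]. R y l) = (\<Prod>j\<leftarrow>[1..<M+3]. R (f j) l)"
      by (simp only: map_map o_def)
    also have "\<dots> = (\<Prod>j\<in>set [1..<M+3]. R (f j) l)"
      by (rule prod.distinct_set_conv_list[symmetric], rule distinct_upt)
    also have "set [1..<M+3] = {1..M+2}" by auto
    finally show ?thesis .
  qed
  have 2: "(\<Prod>y\<leftarrow>map g [1..<M+1]. R y l) = (\<Prod>i=1..M. R (g i) l)" for l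
  proof -
    have "(\<Prod>y\<leftarrow>map g [1..<M+1]. R y l) = (\<Prod>i\<leftarrow>[1..<M+1]. R (g i) l)"
      by (simp only: map_map o_def)
    also have "\<dots> = (\<Prod>i\<in>set [1..<M+1]. R (g i) l)"
      by (rule prod.distinct_set_conv_list[symmetric], rule distinct_upt)
    also have "set [1..<M+1] = {1..M}" by auto
    finally show ?thesis .
  qed
  show ?thesis
    unfolding basic_hypergeom_def list.map(2) prod_list.Cons 1 2 ..
qed

text \<open>Writing \<open>P (y * q ^ n) = P y / R y n\<close> turns numerator parameters of the
  integrand into lower parameters of the series; the denominator parameters are upper ones already,
  with \<open>j0\<close> singled out as the first.\<close>

lemma jhalf_eq_series:
  assumes fin: "finite I" "finite J" "j0 \<notin> J"
    and nz: "P (q * c / c') \<noteq> 0" "\<And>n. R (\<alpha> * c) n \<noteq> 0" "\<And>i. i \<in> I \<Longrightarrow> P (x i * c) \<noteq> 0"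
  shows "jhalf I x (insert j0 J) b \<alpha> c c' = P q * P (q * c / c') * (\<Prod>i\<in>I. P (x i * c)) * P (\<alpha> * c)
    * (\<Sum>l. (R (b j0 * c) l * (\<Prod>j\<in>J. R (b j * c) l))
        / (R q l * (R (q * c / c') l * (R (\<alpha> * c) l * (\<Prod>i\<in>I. R (x i * c) l)))) * q ^ l)"
proof -
  define K where "K = P q * P (q * c / c') * (\<Prod>i\<in>I. P (x i * c)) * P (\<alpha> * c)"
  define t where "t = (\<lambda>l. (R (b j0 * c) l * (\<Prod>j\<in>J. R (b j * c) l))
        / (R q l * (R (q * c / c') l * (R (\<alpha> * c) l * (\<Prod>i\<in>I. R (x i * c) l)))) * q ^ l)"
  have sh: "P (y * q ^ n) = P y / R y n" if "R y n \<noteq> 0" for y n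
    using qpoch_inf_shift[of y n] that by simp
  have Pq: "P q \<noteq> 0" by (rule qpoch_inf_nonzero_lt_1[OF q_lt])
  have jt: "jterm I x (insert j0 J) b \<alpha> c c' n = K * t n" for n
  proof -
    have "(\<Prod>i\<in>I. P (x i * c * q ^ n)) = (\<Prod>i\<in>I. P (x i * c)) / (\<Prod>i\<in>I. R (x i * c) n)"
      unfolding prod_dividef[symmetric] by (intro prod.cong refl sh qpoch_nonzero nz(3))
    then show ?thesis
      unfolding jterm_def K_def t_def sh[OF qpoch_nonzero[OF Pq]] sh[OF qpoch_nonzero[OF nz(1)]] sh[OF nz(2)]
      using fin by (simp add: mult_ac)
  qed
  have Knz: "K \<noteq> 0"
    unfolding K_def using Pq nz qpoch_inf_nonzero[of "\<alpha> * c"] fin by simp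
  have "jterm I x (insert j0 J) b \<alpha> c c' sums jhalf I x (insert j0 J) b \<alpha> c c'"
    unfolding jhalf_def using fin by (intro has_sum_imp_sums has_sum_infsum jterm_summable) simp_all
  then have "(\<lambda>n. K * t n) sums jhalf I x (insert j0 J) b \<alpha> c c'" unfolding jt[abs_def] .
  then have "t sums (jhalf I x (insert j0 J) b \<alpha> c c' / K)"
    using sums_divide[of "\<lambda>n. K * t n" _ K] Knz by simp
  then have "jhalf I x (insert j0 J) b \<alpha> c c' = K * suminf t" using Knz by (simp add: sums_iff)
  then show ?thesis unfolding K_def t_def .
qed

text \<open>For argument \<open>0\<close> only the zero multi-index contributes, by
  \<open>0 ^ 0 = 1\<close>.\<close>

lemma kajihara_W_at_zero:
  assumes "kajihara_W_defined q M x 0 u v1 v2"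
  shows "kajihara_W q M x 0 u v1 v2 0 = 1"
proof -
  define l0 :: "nat \<Rightarrow> nat" where "l0 = (\<lambda>i\<in>{1..M}. 0)"
  have l0: "l0 i = 0" if "i \<in> {1..M}" for i using that by (simp add: l0_def)
  have vdm: "vdm M x \<noteq> 0" using assms by (simp add: kajihara_W_defined_def)
  have "kajihara_W q M x 0 u v1 v2 0 = (\<Sum>\<^sub>\<infinity>l\<in>{l0}. kajihara_term q M x 0 u v1 v2 0 l)"
    unfolding kajihara_W_def
  proof (rule infsum_cong_neutral)
    fix l assume l: "l \<in> ({1..M} \<rightarrow>\<^sub>E UNIV) - {l0}"
    have "(\<Sum>i=1..M. l i) \<noteq> 0"
    proof
      assume "(\<Sum>i=1..M. l i) = 0"
      then have "l i = l0 i" if "i \<in> {1..M}" for i using that l0 by simp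
      then have "l = l0" using l by (intro PiE_ext[of _ "{1..M}" "\<lambda>_. UNIV"]) (auto simp: l0_def)
      then show False using l by simp
    qed
    then show "kajihara_term q M x 0 u v1 v2 0 l = 0"
      unfolding kajihara_term_def Let_def by (simp add: power_0_left del: sum_eq_0_iff)
  next
    fix l assume "l \<in> {l0} - ({1..M} \<rightarrow>\<^sub>E UNIV)"
    then show "kajihara_term q M x 0 u v1 v2 0 l = 0" by (auto simp: l0_def)
  qed simp
  also have "\<dots> = kajihara_term q M x 0 u v1 v2 0 l0" by simp
  also have "\<dots> = 1"
  proof -
    have s: "(\<Sum>i=1..M. l0 i) = 0" using l0 by simp
    have "vdm M (\<lambda>i. x i * q ^ l0 i) = vdm M x"
      unfolding vdm_def by (rule prod.cong) (auto simp: l0)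
    then show ?thesis
      unfolding kajihara_term_def Let_def s using vdm by (simp add: l0)
  qed
  finally show ?thesis .
qed

text \<open>Each end point supplies two of the three infinite products in one of the two forms of
  \<open>jconst\<close>; the missing one appears as a denominator.\<close>

lemma jconst_split:
  assumes "c \<noteq> 0" "c' \<noteq> 0" "P (c / c') \<noteq> 0" "P (c' / c) \<noteq> 0"
  shows "c' * (P q * P (q * c' / c) * A) - c * (P q * P (q * c / c') * A')
    = jconst c c' * (A / P (c / c') + A' / P (c' / c))"
proof -
  have 1: "c' * (P q * P (q * c' / c) * A) = jconst c c' * (A / P (c / c'))"
    unfolding jconst_def using assms by simp
  have 2: "- (c * (P q * P (q * c / c') * A')) = jconst c c' * (A' / P (c' / c))"
    unfolding jconst_alt[OF assms(1,2)] using assms by simp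
  have "c' * (P q * P (q * c' / c) * A) - c * (P q * P (q * c / c') * A')
    = c' * (P q * P (q * c' / c) * A) + - (c * (P q * P (q * c / c') * A'))" by simp
  then show ?thesis unfolding 1 2 distrib_left .
qed

lemma qpoch_inf_step_nonzero: "P a \<noteq> 0 \<Longrightarrow> P (q * a) \<noteq> 0"
  using qpoch_inf_step[of a] by (auto simp: mult.commute)

lemma jconst_nonzero:
  assumes "c \<noteq> 0" "c' \<noteq> 0" "P (c / c') \<noteq> 0" "P (c' / c) \<noteq> 0"
  shows "jconst c c' \<noteq> 0"
  unfolding jconst_def
  using assms qpoch_inf_step_nonzero[of "c' / c"] qpoch_inf_nonzero_lt_1[OF q_lt] by simp

text \<open>The series 2phi1 with upper parameters \<open>c\<close>, \<open>0\<close>, lower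
  parameter \<open>q * c / c'\<close> and argument \<open>q\<close>, to which the right side of part
  (i) reduces for \<open>a = 0\<close>.\<close>

definition two_phi_one :: "complex \<Rightarrow> complex \<Rightarrow> complex" where
  "two_phi_one c c' = (\<Sum>l. R c l / (R q l * R (q * c / c') l) * q ^ l)"

lemma qpoch_zero_left [simp]: "R 0 n = 1"
  by (simp add: qpoch_def)

lemma two_term_rhs_at_zero:
  "two_term_rhs q M x 0 u 0 c1 c2 = P c2 / P (c2 / c1) * two_phi_one c1 c2"
  unfolding two_term_rhs_def basic_hypergeom_eq two_phi_one_def by simp

text \<open>The q-Saalschuetz sum with denominator parameters \<open>1, 0, 0\<close>: all products
  on its right side become \<open>P 0 = 1\<close>, and each half integral is a multiple of
  \<open>two_phi_one\<close>.\<close>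

lemma two_phi_one_sum:
  assumes "c \<noteq> 0" "c' \<noteq> 0" "P (c / c') \<noteq> 0" "P (c' / c) \<noteq> 0"
  shows "P c' / P (c' / c) * two_phi_one c c' + P c / P (c / c') * two_phi_one c' c = 1"
proof -
  define b :: "nat \<Rightarrow> complex" where "b = (\<lambda>j. if j = 0 then 1 else 0)"
  define x :: "nat \<Rightarrow> complex" where "x = (\<lambda>_. 0)"
  define J :: "nat set" where "J = {0, 1, 2}"
  have J: "J = insert 0 {1, 2}" by (simp add: J_def)
  have jn: "jnorm {} x J b c c' = jconst c c'"
    using nonterminating_q_Saalschuetz[OF assms(1,2), of J 0 1 2 x b] by (simp add: b_def J_def)
  have jh: "jhalf {} x J b 0 y y' = P q * P (q * y / y') * two_phi_one y y'" if "P (y / y') \<noteq> 0" for y y'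
  proof -
    have "P (q * y / y') \<noteq> 0" using qpoch_inf_step_nonzero[OF that] by simp
    then show ?thesis
      unfolding J two_phi_one_def by (subst jhalf_eq_series) (simp_all add: b_def)
  qed
  have al: "jalpha {} x J b c c' = 0" by (simp add: jalpha_def J_def b_def)
  have pr: "(\<Prod>j\<in>J. P (b j * y)) = P y" for y by (simp add: J_def b_def)
  have "jnorm {} x J b c c' = c' * (P q * P (q * c' / c) * (P c * two_phi_one c' c))
      - c * (P q * P (q * c / c') * (P c' * two_phi_one c c'))"
    unfolding jnorm_def al pr jh[OF assms(3)] jh[OF assms(4)] by (simp add: mult_ac)
  also have "\<dots> = jconst c c' * (P c * two_phi_one c' c / P (c / c') + P c' * two_phi_one c c' / P (c' / c))"
    by (rule jconst_split[OF assms])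
  finally show ?thesis using jn jconst_nonzero[OF assms] by (simp add: add.commute)
qed

lemma jhalf_hypergeom:
  assumes b0: "b 0 * c = c1" and bj: "\<And>j. j \<in> {1..M+2} \<Longrightarrow> b j * c = a * q / (c2 * u j)"
    and cc: "c / c' = c1 / c2" and al: "\<alpha> * c = c1 * d" and xi: "\<And>i. x i * c = a * q * x i / c2"
    and nz: "P (c1 / c2) \<noteq> 0" "\<And>n. R (c1 * d) n \<noteq> 0" "\<And>i. i \<in> {1..M} \<Longrightarrow> P (a * q * x i / c2) \<noteq> 0"
  shows "jhalf {1..M} x (insert 0 {1..M+2}) b \<alpha> c c'
    = P q * P (q * c1 / c2) * (\<Prod>i=1..M. P (a * q * x i / c2)) * P (c1 * d)
      * basic_hypergeom q (c1 # map (\<lambda>j. a * q / (c2 * u j)) [1..<M+3])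
         (q * c1 / c2 # c1 * d # map (\<lambda>i. a * q * x i / c2) [1..<M+1]) q"
proof -
  have qc: "q * c / c' = q * c1 / c2" using cc by (metis times_divide_eq_right)
  have "P (q * c / c') \<noteq> 0" unfolding qc using qpoch_inf_step_nonzero[OF nz(1)] by simp
  then have "jhalf {1..M} x (insert 0 {1..M+2}) b \<alpha> c c' = P q * P (q * c / c') * (\<Prod>i=1..M. P (x i * c)) * P (\<alpha> * c)
    * (\<Sum>l. (R (b 0 * c) l * (\<Prod>j=1..M+2. R (b j * c) l))
        / (R q l * (R (q * c / c') l * (R (\<alpha> * c) l * (\<Prod>i=1..M. R (x i * c) l)))) * q ^ l)"
    by (intro jhalf_eq_series) (use nz in \<open>simp_all add: al xi\<close>)
  moreover have "(\<Prod>j=1..M+2. R (b j * c) l) = (\<Prod>j=1..M+2. R (a * q / (c2 * u j)) l)" for l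
    by (rule prod.cong) (simp_all only: bj)
  ultimately show ?thesis
    unfolding basic_hypergeom_eq b0 qc al xi by simp
qed

lemma kajihara_two_term:
  assumes d: "d = a^2 * q^2 / (c1 * c2 * (\<Prod>j=1..M+2. u j) * (\<Prod>i=1..M. x i))"
    and lt: "norm d < 1"
    and W_def: "kajihara_W_defined q M x a u c1 c2"
    and nz: "P (c2 / c1) \<noteq> 0" "P (c1 / c2) \<noteq> 0"
    and dn: "\<forall>n. R (c1 * d) n \<noteq> 0 \<and> R (c2 * d) n \<noteq> 0"
  shows "kajihara_W q M x a u c1 c2 d = two_term_rhs q M x a u d c1 c2 + two_term_rhs q M x a u d c2 c1"
\<comment> \<open>The end points chosen below vanish for \<open>a = 0\<close>. In that case
  \<open>d = 0\<close>, the left side is \<open>1\<close>, and the right side no longer involves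
  \<open>x\<close> and \<open>u\<close>.\<close>
proof (cases "a = 0")
  case True
  have "d = 0" using d True by simp
  moreover have "c1 \<noteq> 0" "c2 \<noteq> 0" using W_def by (auto simp: kajihara_W_defined_def)
  ultimately show ?thesis
    using kajihara_W_at_zero[of M x u c1 c2] W_def two_phi_one_sum[of c1 c2] nz True
    by (simp add: two_term_rhs_at_zero)
next
  case False
  have c12: "c1 \<noteq> 0" "c2 \<noteq> 0" and unz: "\<And>j. j \<in> {1..M+2} \<Longrightarrow> u j \<noteq> 0"
    using W_def by (auto simp: kajihara_W_defined_def)
  \<comment> \<open>\<open>c\<close>, \<open>c'\<close>, \<open>B\<close> solve
    \<open>c * B = c1\<close>, \<open>c' * B = c2\<close>, \<open>c * c' * B = a * q\<close>. The
    index \<open>0\<close> plays the part of \<open>j0\<close>, so \<open>b 0 * c = c1\<close>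
    becomes the first upper parameter at the end point \<open>c\<close>.\<close>
  define c where "c = a * q / c2"
  define c' where "c' = a * q / c1"
  define B where "B = c1 * c2 / (a * q)"
  define b where "b = (\<lambda>j. if j = 0 then B else 1 / u j)"
  have cnz: "c \<noteq> 0" "c' \<noteq> 0" using False q_nz c12 by (simp_all add: c_def c'_def)
  have e: "c * c' * B = a * q" "c * B = c1" "c' * B = c2"
    using False q_nz c12 by (simp_all add: c_def c'_def B_def)
  have cc: "c / c' = c1 / c2" "c' / c = c2 / c1"
    using False q_nz c12 by (simp_all add: c_def c'_def)
  have bu: "\<And>j. j \<in> {1..M+2} \<Longrightarrow> b j = 1 / u j" by (auto simp: b_def)
  have b0: "b 0 = B" by (simp add: b_def)
  have z: "d = c * c' / (\<Prod>i=1..M. x i) * (\<Prod>j=1..M+2. b j)"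
  proof -
    have "(\<Prod>j=1..M+2. b j) = (\<Prod>j=1..M+2. 1 / u j)" by (rule prod.cong[OF refl bu])
    also have "\<dots> = 1 / (\<Prod>j=1..M+2. u j)" by (simp only: prod_dividef prod.neutral_const)
    finally show ?thesis unfolding d c_def c'_def by (simp add: power2_eq_square mult_ac)
  qed
  have J: "finite {1..M+2}" "card {1..M+2} = card {1..M} + 2" "0 \<notin> {1..M+2}" by simp_all
  have gen: "generic_nodes {1..M} x c c'"
    by (rule generic_nodes_of_defined[OF W_def e bu z])
  have W: "kajihara_W q M x a u c1 c2 d * ((\<Prod>j=1..M+2. P (a * q / u j)) * (\<Prod>i=1..M. 1 - a * x i))
      = kseries {1..M} x {1..M+2} b B c c'"
    by (rule kajihara_W_eq[OF W_def e bu z])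
  have v: "a * q * y / c1 = c' * y" "a * q * y / c2 = c * y" for y
    unfolding c_def c'_def by simp_all
  define E where "E = (\<Prod>j=1..M+2. P (a * q / u j))"
  define F where "F = (\<Prod>i=1..M. 1 - a * x i)"
  define G where "G = (\<Prod>i=1..M. P (a * q * x i))"
  define C where "C = (\<Prod>i=1..M. P (a * q * x i / c2))"
  define C' where "C' = (\<Prod>i=1..M. P (a * q * x i / c1))"
  define Q where "Q = (\<Prod>j=1..M+2. P (a * q / (c2 * u j)))"
  define Q' where "Q' = (\<Prod>j=1..M+2. P (a * q / (c1 * u j)))"
  define \<Phi> where "\<Phi> = basic_hypergeom q (c1 # map (\<lambda>j. a * q / (c2 * u j)) [1..<M+3])
         (q * c1 / c2 # c1 * d # map (\<lambda>i. a * q * x i / c2) [1..<M+1]) q"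
  define \<Phi>' where "\<Phi>' = basic_hypergeom q (c2 # map (\<lambda>j. a * q / (c1 * u j)) [1..<M+3])
         (q * c2 / c1 # c2 * d # map (\<lambda>i. a * q * x i / c1) [1..<M+1]) q"
  have "1 - a * x i \<noteq> 0" if "i \<in> {1..M}" for i
    using W_def that unfolding kajihara_W_defined_def by blast
  then have Fnz: "F \<noteq> 0" by (simp add: F_def)
  have "P (a * q / u j) \<noteq> 0" if "j \<in> {1..M+2}" for j
    using W_def that unfolding kajihara_W_defined_def by (intro qpoch_inf_nonzero) blast
  then have Enz: "E \<noteq> 0" by (simp add: E_def)
  have Pc: "P (a * q * x i / c2) \<noteq> 0" "P (a * q * x i / c1) \<noteq> 0" if "i \<in> {1..M}" for i
    using gen that unfolding v generic_nodes_def by blast+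
  have Cnz: "C \<noteq> 0" "C' \<noteq> 0" using Pc by (simp_all add: C_def C'_def)
  have Pd: "P d \<noteq> 0" by (rule qpoch_inf_nonzero_lt_1[OF lt])
  have al: "jalpha {1..M} x (insert 0 {1..M+2}) b c c' = d * B"
  proof -
    have "(\<Prod>j\<in>insert 0 {1..M+2}. b j) = B * (\<Prod>j=1..M+2. b j)" using J b0 by simp
    then show ?thesis unfolding jalpha_def z by simp
  qed
  have bc: "b j * c = a * q / (c2 * u j)" "b j * c' = a * q / (c1 * u j)" if "j \<in> {1..M+2}" for j
    unfolding bu[OF that] c_def c'_def by simp_all
  have H: "jhalf {1..M} x (insert 0 {1..M+2}) b (d * B) c c' = P q * P (q * c1 / c2) * C * P (c1 * d) * \<Phi>"
    unfolding C_def \<Phi>_def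
  proof (rule jhalf_hypergeom)
    show "b 0 * c = c1" unfolding b0 using e(2) by (simp only: mult.commute)
    show "d * B * c = c1 * d" unfolding e(2)[symmetric] by (simp only: mult_ac)
    show "x i * c = a * q * x i / c2" for i unfolding v by (rule mult.commute)
    show "R (c1 * d) n \<noteq> 0" for n using dn by blast
  qed (simp_all only: bc cc nz Pc not_False_eq_True)
  have H': "jhalf {1..M} x (insert 0 {1..M+2}) b (d * B) c' c = P q * P (q * c2 / c1) * C' * P (c2 * d) * \<Phi>'"
    unfolding C'_def \<Phi>'_def
  proof (rule jhalf_hypergeom)
    show "b 0 * c' = c2" unfolding b0 using e(3) by (simp only: mult.commute)
    show "d * B * c' = c2 * d" unfolding e(3)[symmetric] by (simp only: mult_ac)
    show "x i * c' = a * q * x i / c1" for i unfolding v by (rule mult.commute)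
    show "R (c2 * d) n \<noteq> 0" for n using dn by blast
  qed (simp_all only: bc cc nz Pc not_False_eq_True)
  have pQ: "(\<Prod>j\<in>insert 0 {1..M+2}. P (b j * c)) = P c1 * Q"
  proof -
    have "(\<Prod>j=1..M+2. P (b j * c)) = Q" unfolding Q_def by (rule prod.cong) (simp_all only: bc)
    then show ?thesis using J b0 e(2) by (simp only: prod.insert[OF J(1,3)] mult.commute)
  qed
  have pQ': "(\<Prod>j\<in>insert 0 {1..M+2}. P (b j * c')) = P c2 * Q'"
  proof -
    have "(\<Prod>j=1..M+2. P (b j * c')) = Q'" unfolding Q'_def by (rule prod.cong) (simp_all only: bc)
    then show ?thesis using J b0 e(3) by (simp only: prod.insert[OF J(1,3)] mult.commute)
  qed
  \<comment> \<open>\<open>P c1\<close>, \<open>P c2\<close>, \<open>Q\<close> and \<open>Q'\<close>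
    may vanish and are never divided by; this is why the argument runs through \<open>jnorm\<close>
    and not through the Jackson integral.\<close>
  define Y where "Y = P c1 * Q * (C' * P (c2 * d) * \<Phi>') / P (c1 / c2) + P c2 * Q' * (C * P (c1 * d) * \<Phi>) / P (c2 / c1)"
  have qcc: "q * c1 / c2 = q * c / c'" "q * c2 / c1 = q * c' / c"
    using cc by (metis times_divide_eq_right)+
  have "jnorm {1..M} x (insert 0 {1..M+2}) b c c'
     = c' * (P q * P (q * c' / c) * (P c1 * Q * (C' * P (c2 * d) * \<Phi>')))
       - c * (P q * P (q * c / c') * (P c2 * Q' * (C * P (c1 * d) * \<Phi>)))"
    unfolding jnorm_def al H H' pQ pQ' qcc by (simp add: mult_ac)
  also have "\<dots> = jconst c c' * Y"
    unfolding Y_def cc[symmetric] by (rule jconst_split[OF cnz]) (simp_all only: cc nz not_False_eq_True)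
  finally have jn: "jnorm {1..M} x (insert 0 {1..M+2}) b c c' = jconst c c' * Y" .
  have AF: "(\<Prod>i=1..M. P (c * c' * b 0 * x i / q)) = F * G"
    unfolding F_def G_def prod.distrib[symmetric] b0 e(1)
  proof (rule prod.cong[OF refl])
    fix i
    have "a * q * x i / q = a * x i" "a * x i * q = a * q * x i" using q_nz by simp_all
    then show "P (a * q * x i / q) = (1 - a * x i) * P (a * q * x i)"
      using qpoch_inf_step[of "a * x i"] by (simp only:)
  qed
  have CC: "(\<Prod>i=1..M. P (c * x i) * P (c' * x i)) = C * C'"
    unfolding C_def C'_def v prod.distrib ..
  have "norm (c * c' / (\<Prod>i=1..M. x i) * (\<Prod>j=1..M+2. b j)) < 1"
    unfolding z[symmetric] by (rule lt)
  from main_identity[OF gen J cnz this]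
  have "F * G * (jconst c c' * Y) = jconst c c' * P d * (C * C') * (kajihara_W q M x a u c1 c2 d * (E * F))"
    unfolding z[symmetric] AF jn CC unfolding b0 W[symmetric] E_def[symmetric] F_def[symmetric] .
  then have "G * Y = P d * (C * C') * (kajihara_W q M x a u c1 c2 d * E)"
    using Fnz jconst_nonzero[OF cnz] nz by (simp add: cc mult_ac)
  then have "kajihara_W q M x a u c1 c2 d = G * Y / (P d * (C * C') * E)"
    using Pd Cnz Enz by (simp add: eq_divide_eq mult_ac)
  also have "\<dots> = G / C' * (Q' / E) * ((P (c1 * d) * P c2) / (P d * P (c2 / c1))) * \<Phi>
     + G / C * (Q / E) * ((P (c2 * d) * P c1) / (P d * P (c1 / c2))) * \<Phi>'"
    unfolding Y_def distrib_left add_divide_distrib using Cnz by (simp add: mult_ac)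
  also have "\<dots> = two_term_rhs q M x a u d c1 c2 + two_term_rhs q M x a u d c2 c1"
    unfolding two_term_rhs_def \<Phi>_def \<Phi>'_def G_def C_def C'_def Q_def Q'_def E_def prod_dividef ..
  finally show ?thesis .
qed

end

theorem theorem3p1:
  fixes q :: complex and M :: nat
  assumes q: "0 < norm q" "norm q < 1"
    and M: "M \<ge> 1"
  shows "(\<forall>(x :: nat \<Rightarrow> complex) (a :: complex) (b :: nat \<Rightarrow> complex) (c1 :: complex) (c2 :: complex) (d :: complex).
            d = a^2 * q^2 / (c1 * c2 * (\<Prod>j=1..M+2. b j) * (\<Prod>i=1..M. x i)) \<longrightarrow>
            norm d < 1 \<longrightarrow>
            kajihara_W_defined q M x a b c1 c2 \<longrightarrow>
            qpoch_inf q (c2 / c1) \<noteq> 0 \<longrightarrow>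
            qpoch_inf q (c1 / c2) \<noteq> 0 \<longrightarrow>
            (\<forall>n. qpoch q (c1 * d) n \<noteq> 0 \<and> qpoch q (c2 * d) n \<noteq> 0) \<longrightarrow>
            kajihara_W q M x a b c1 c2 d
              = two_term_rhs q M x a b d c1 c2 + two_term_rhs q M x a b d c2 c1)
       \<and>
         (\<forall>(a :: nat \<Rightarrow> complex) (b :: nat \<Rightarrow> complex).
            (\<Prod>k=1..M+3. a k) = q^2 * (\<Prod>k=1..M+3. b k) \<longrightarrow>
            norm (a (M+1) / b (M+3)) < 1 \<longrightarrow>
            a (M+2) \<noteq> 0 \<longrightarrow> a (M+3) \<noteq> 0 \<longrightarrow> a (M+2) \<noteq> a (M+3) \<longrightarrow>
            (\<forall>k\<in>{1..M+3}. b k \<noteq> 0) \<longrightarrow>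
            (\<forall>k\<in>{1..M+3}. qpoch_inf q (q * b k / a (M+2)) \<noteq> 0
                         \<and> qpoch_inf q (q * b k / a (M+3)) \<noteq> 0) \<longrightarrow>
            (\<forall>i\<in>{1..M}. qpoch_inf q (q^2 * a i * b (M+3) / (a (M+2) * a (M+3))) \<noteq> 0) \<longrightarrow>
            kajihara_W_defined q M a (q * b (M+3) / (a (M+2) * a (M+3))) (\<lambda>j. 1 / b j)
              (q * b (M+3) / a (M+2)) (q * b (M+3) / a (M+3)) \<longrightarrow>
            jackson_integral q (q / a (M+2)) (q / a (M+3))
                (\<lambda>t. \<Prod>k=1..M+3. qpoch_inf q (a k * t) / qpoch_inf q (b k * t))
              = (\<Prod>i=1..M. qpoch_inf q (q * a i / a (M+2)) * qpoch_inf q (q * a i / a (M+3))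
                            / qpoch_inf q (q^2 * a i * b (M+3) / (a (M+2) * a (M+3))))
                * (\<Prod>j=1..M+2. qpoch_inf q (q^2 * b j * b (M+3) / (a (M+2) * a (M+3))))
                * (\<Prod>j=1..M+3. 1 / (qpoch_inf q (q * b j / a (M+2)) * qpoch_inf q (q * b j / a (M+3))))
                * (qpoch_inf q q * qpoch_inf q (a (M+1) / b (M+3))
                   * qpoch_inf q (a (M+2) / a (M+3)) * qpoch_inf q (a (M+3) / a (M+2)))
                * ((1 - q) * q / (a (M+3) - a (M+2)))
                * kajihara_W q M a (q * b (M+3) / (a (M+2) * a (M+3))) (\<lambda>j. 1 / b j)
                    (q * b (M+3) / a (M+2)) (q * b (M+3) / a (M+3)) (a (M+1) / b (M+3)))"
proof -
  interpret q_disc q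
    using q by unfold_locales auto
  show ?thesis
    by (intro conjI allI impI kajihara_two_term kajihara_jackson_integral) blast+
qed

end
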